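(* Let $K$ be a field, $Q$ a finite quiver with vertex set $I$, $<$ a total ordering on the arrows of the double $\overline{Q}$, and $v\in I$ a loopfree vertex. For each $q\in(K^* )^I$ with $q_v\neq 1$ there is an equivalence $F_q$ from the category of representations of $\Lambda^q$ to the category of representations of $\Lambda^{u_v(q)}$. It acts on dimension vectors as the reflection $s_v$: if $X$ is a finite-dimensional representation of $\Lambda^q$ of dimension vector $\alpha$, then $F_q(X)$ has dimension vector $s_v(\alpha)$. The inverse equivalence of $F_q$ is $F_{u_v(q)}$.
   Context: Arrows $a$ have head $h(a)$ and tail $t(a)$; a vertex $v$ is loopfree if no arrow has head and tail both equal to $v$. The path algebra $KQ$ has as basis the paths $a_1\cdots a_n$ with $t(a_i)=h(a_{i+1})$ together with trivial paths $e_v$ ($v\in I$). The double $\overline{Q}$ is obtained from $Q$ by adjoining a reverse arrow $a^*$ for each arrow $a\in Q$; $(a^* )^*=a$; $\epsilon(a)=1$ if $a\in Q$ and $\epsilon(a)=-1$ if $a^*\in Q$. With $a_1<a_2<\dots<a_n$ the arrows of $\overline{Q}$, the multiplicative preprojective algebra $\Lambda^q=\Lambda^q(Q,<)$ is the target of the universal $K$-algebra homomorphism $K\overline{Q}\to R$ such that $1+aa^*$ is invertible in $R$ for all $a\in\overline{Q}$ and $(1+a_1a_1^* )^{\epsilon(a_1)}\cdots(1+a_na_n^* )^{\epsilon(a_n)}=\sum_{v\in I}q_ve_v$ in $R$. Representations of $\Lambda^q$ are left $\Lambda^q$-modules. The dimension vector of a finite-dimensional representation $X$ is the element of $\mathbb{N}^I$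 with $v$-component $\dim_K e_vX$. The symmetric bilinear form on $\mathbb{Z}^I$ is $(\alpha,\beta)=2\sum_{v\in I}\alpha_v\beta_v-\sum_{a\in Q}(\alpha_{h(a)}\beta_{t(a)}+\alpha_{t(a)}\beta_{h(a)})$, and $\epsilon_v$ are the coordinate vectors. For loopfree $v$: $s_v(\alpha)=\alpha-(\alpha,\epsilon_v)\epsilon_v$ on $\mathbb{Z}^I$, and $u_v:(K^* )^I\to(K^* )^I$ is defined by $u_v(q)_w=q_v^{-(\epsilon_v,\epsilon_w)}q_w$ (so $u_v(q)_v=q_v^{-1}$ and $u_v(u_v(q))=q$). *)

theory Defs
  imports
    "Graph_Theory.Digraph"
    "HOL-Library.Poly_Mapping"
    "HOL-Algebra.QuotRing"
    "Jordan_Normal_Form.VS_Connect"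
begin

section \<open>Quivers, doubles and path algebras\<close>

text \<open>A finite quiver is a \<^locale>\<open>fin_digraph\<close>: loops and parallel arrows are allowed.\<close>

datatype 'a darrow = Orig 'a | Star 'a

fun star :: "'a darrow \<Rightarrow> 'a darrow" where
  "star (Orig a) = Star a"
| "star (Star a) = Orig a"

fun eps :: "'a darrow \<Rightarrow> int" where
  "eps (Orig a) = 1"
| "eps (Star a) = - 1"

definition double :: "('v, 'a) pre_digraph \<Rightarrow> ('v, 'a darrow) pre_digraph" where
  "double Q = \<lparr> verts = verts Q, arcs = Orig ` arcs Q \<union> Star ` arcs Q,
     tail = case_darrow (tail Q) (head Q), head = case_darrow (head Q) (tail Q) \<rparr>"

definition loopfree_at :: "('v, 'a) pre_digraph \<Rightarrow> 'v \<Rightarrow> bool" where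
  "loopfree_at Q v \<longleftrightarrow> \<not> (\<exists>a \<in> arcs Q. head Q a = v \<and> tail Q a = v)"

text \<open>Paths compose like functions: \<open>Walk [a, b]\<close> is first \<open>b\<close>, then \<open>a\<close>. This is the reverse of
  the convention for arc walks in \<open>Graph_Theory\<close>.\<close>

datatype ('v, 'b) qpath = Trivial 'v | Walk "'b list"

fun path_head :: "('v, 'b) pre_digraph \<Rightarrow> ('v, 'b) qpath \<Rightarrow> 'v" where
  "path_head G (Trivial w) = w"
| "path_head G (Walk as) = head G (hd as)"

fun path_tail :: "('v, 'b) pre_digraph \<Rightarrow> ('v, 'b) qpath \<Rightarrow> 'v" where
  "path_tail G (Trivial w) = w"
| "path_tail G (Walk as) = tail G (last as)"

fun path_comp :: "('v, 'b) qpath \<Rightarrow> ('v, 'b) qpath \<Rightarrow> ('v, 'b) qpath" where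
  "path_comp (Trivial w) p = p"
| "path_comp p (Trivial w) = p"
| "path_comp (Walk as) (Walk bs) = Walk (as @ bs)"

definition qpaths :: "('v, 'b) pre_digraph \<Rightarrow> ('v, 'b) qpath set" where
  "qpaths G = Trivial ` verts G \<union>
     {Walk as | as. as \<noteq> [] \<and> set as \<subseteq> arcs G \<and> successively (\<lambda>a b. tail G a = head G b) as}"

text \<open>\<open>K\<close>-algebras are records of type \<^typ>\<open>('k, 'r) module\<close>, which carry a ring structure and a
  scalar multiplication.\<close>

definition path_algebra ::
  "('v, 'b) pre_digraph \<Rightarrow> ('k::field, ('v, 'b) qpath \<Rightarrow>\<^sub>0 'k) module" where
  "path_algebra G = \<lparr>
     carrier = {f. Poly_Mapping.keys f \<subseteq> qpaths G},
     mult = (\<lambda>f g. \<Sum>p \<in> Poly_Mapping.keys f. \<Sum>r \<in> Poly_Mapping.keys g.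
        if path_tail G p = path_head G r
        then Poly_Mapping.single (path_comp p r) (Poly_Mapping.lookup f p * Poly_Mapping.lookup g r)
        else 0),
     one = (\<Sum>w \<in> verts G. Poly_Mapping.single (Trivial w) 1),
     zero = 0,
     add = (+),
     smult = (\<lambda>c. Poly_Mapping.map ((*) c)) \<rparr>"

type_synonym ('v, 'a, 'k) path_elem = "('v, 'a darrow) qpath \<Rightarrow>\<^sub>0 'k"

definition path_idem :: "'v \<Rightarrow> ('v, 'a, 'k::field) path_elem" where
  "path_idem w = Poly_Mapping.single (Trivial w) 1"

definition path_arrow :: "'a darrow \<Rightarrow> ('v, 'a, 'k::field) path_elem" where
  "path_arrow a = Poly_Mapping.single (Walk [a]) 1"

definition one_plus ::
  "('v, 'a) pre_digraph \<Rightarrow> 'a darrow \<Rightarrow> ('v, 'a, 'k::field) path_elem" where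
  "one_plus Q a = \<one>\<^bsub>path_algebra (double Q)\<^esub>
     \<oplus>\<^bsub>path_algebra (double Q)\<^esub> path_arrow a \<otimes>\<^bsub>path_algebra (double Q)\<^esub> path_arrow (star a)"

definition weight_elem ::
  "('v, 'a) pre_digraph \<Rightarrow> ('v \<Rightarrow> 'k::field) \<Rightarrow> ('v, 'a, 'k) path_elem" where
  "weight_elem Q q = (\<Sum>w \<in> verts Q. Poly_Mapping.single (Trivial w) (q w))"

text \<open>The increasing enumeration \<open>a\<^sub>1 < \<dots> < a\<^sub>n\<close> of the arrows of the double.\<close>

definition arrow_list :: "('v, 'a) pre_digraph \<Rightarrow> 'a darrow rel \<Rightarrow> 'a darrow list" where
  "arrow_list Q lt = (THE as. set as = arcs (double Q) \<and> sorted_wrt (\<lambda>a b. (a, b) \<in> lt) as)"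


section \<open>The multiplicative preprojective algebra\<close>

definition k_algebra :: "('k::field, 'r) module \<Rightarrow> bool" where
  "k_algebra R \<longleftrightarrow> ring R \<and> module class_ring R \<and>
     (\<forall>c. \<forall>x \<in> carrier R. \<forall>y \<in> carrier R.
        (c \<odot>\<^bsub>R\<^esub> x) \<otimes>\<^bsub>R\<^esub> y = c \<odot>\<^bsub>R\<^esub> (x \<otimes>\<^bsub>R\<^esub> y) \<and> x \<otimes>\<^bsub>R\<^esub> (c \<odot>\<^bsub>R\<^esub> y) = c \<odot>\<^bsub>R\<^esub> (x \<otimes>\<^bsub>R\<^esub> y))"

definition k_algebra_hom :: "('k::field, 'r) module \<Rightarrow> ('k, 's) module \<Rightarrow> ('r \<Rightarrow> 's) set" where
  "k_algebra_hom R S =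
     {\<phi> \<in> Ring.ring_hom R S. \<forall>c. \<forall>x \<in> carrier R. \<phi> (c \<odot>\<^bsub>R\<^esub> x) = c \<odot>\<^bsub>S\<^esub> \<phi> x}"

text \<open>The condition on a homomorphism \<open>\<phi>\<close> from the path algebra of the double to a \<open>K\<close>-algebra \<open>R\<close>
  for which the multiplicative preprojective algebra is universal.\<close>

definition mpa_condition ::
  "('v, 'a) pre_digraph \<Rightarrow> 'a darrow rel \<Rightarrow> ('v \<Rightarrow> 'k::field) \<Rightarrow> ('k, 'r) module \<Rightarrow>
   (('v, 'a, 'k) path_elem \<Rightarrow> 'r) \<Rightarrow> bool" where
  "mpa_condition Q lt q R \<phi> \<longleftrightarrow>
     \<phi> \<in> k_algebra_hom (path_algebra (double Q)) R \<and>
     (\<forall>a \<in> arcs (double Q). \<phi> (one_plus Q a) \<in> Units R) \<and>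
     foldr (\<lambda>a x. (\<phi> (one_plus Q a) [^]\<^bsub>R\<^esub> eps a) \<otimes>\<^bsub>R\<^esub> x) (arrow_list Q lt) \<one>\<^bsub>R\<^esub>
       = \<phi> (weight_elem Q q)"

text \<open>The free monoid is wrapped in a type of its own in order to make it an instance of
  \<^class>\<open>monoid_add\<close>, so that finitely supported functions on it form a ring
  (the free associative algebra) with the convolution product of \<open>Poly_Mapping\<close>.\<close>

datatype 'g free_mon = FMon (letters: "'g list")

instantiation free_mon :: (type) monoid_add
begin

definition zero_free_mon :: "'a free_mon" where
  "zero_free_mon = FMon []"

definition plus_free_mon :: "'a free_mon \<Rightarrow> 'a free_mon \<Rightarrow> 'a free_mon" where
  "plus_free_mon x y = FMon (letters x @ letters y)"

instance
  by standard (simp_all add: zero_free_mon_def plus_free_mon_def)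

end

definition free_algebra :: "'g set \<Rightarrow> ('k::field, 'g free_mon \<Rightarrow>\<^sub>0 'k) module" where
  "free_algebra G = \<lparr>
     carrier = {f. \<forall>w \<in> Poly_Mapping.keys f. set (letters w) \<subseteq> G},
     mult = (*), one = 1, zero = 0, add = (+),
     smult = (\<lambda>c. Poly_Mapping.map ((*) c)) \<rparr>"

definition free_gen :: "'g \<Rightarrow> ('g free_mon \<Rightarrow>\<^sub>0 'k::field)" where
  "free_gen g = Poly_Mapping.single (FMon [g]) 1"

definition quotient_algebra ::
  "('k::field, 'r) module \<Rightarrow> 'r set \<Rightarrow> ('k, 'r set) module" where
  "quotient_algebra A J = ring.extend (A Quot J)
     (module.fields (\<lambda>c C. \<Union>x \<in> C. J +>\<^bsub>A\<^esub> (c \<odot>\<^bsub>A\<^esub> x)))"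

text \<open>The algebra is generated by symbols \<open>Elt f\<close> for the elements \<open>f\<close> of the path algebra of the double
  and formal inverses \<open>Inv a\<close> of the elements \<open>1 + a a*\<close>. The first four families of relations say that
  \<open>Elt\<close> is a homomorphism of \<open>K\<close>-algebras.\<close>

datatype ('e, 'b) loc_gen = Elt 'e | Inv 'b

type_synonym ('v, 'a, 'k) mpa_free =
  "(('v, 'a, 'k) path_elem, 'a darrow) loc_gen free_mon \<Rightarrow>\<^sub>0 'k"

definition mpa_gens ::
  "('v, 'a) pre_digraph \<Rightarrow> (('v, 'a, 'k::field) path_elem, 'a darrow) loc_gen set" where
  "mpa_gens Q = Elt ` carrier (path_algebra (double Q)) \<union> Inv ` arcs (double Q)"

definition mpa_rels ::
  "('v, 'a) pre_digraph \<Rightarrow> 'a darrow rel \<Rightarrow> ('v \<Rightarrow> 'k::field) \<Rightarrow> ('v, 'a, 'k) mpa_free set" where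
  "mpa_rels Q lt q = (let P = path_algebra (double Q) in
     {free_gen (Elt (f \<oplus>\<^bsub>P\<^esub> g)) - (free_gen (Elt f) + free_gen (Elt g)) | f g.
        f \<in> carrier P \<and> g \<in> carrier P} \<union>
     {free_gen (Elt (f \<otimes>\<^bsub>P\<^esub> g)) - free_gen (Elt f) * free_gen (Elt g) | f g.
        f \<in> carrier P \<and> g \<in> carrier P} \<union>
     {free_gen (Elt (c \<odot>\<^bsub>P\<^esub> f)) - Poly_Mapping.map ((*) c) (free_gen (Elt f)) | c f.
        f \<in> carrier P} \<union>
     {free_gen (Elt \<one>\<^bsub>P\<^esub>) - 1} \<union>
     {free_gen (Elt (one_plus Q a)) * free_gen (Inv a) - 1 | a. a \<in> arcs (double Q)} \<union>
     {free_gen (Inv a) * free_gen (Elt (one_plus Q a)) - 1 | a. a \<in> arcs (double Q)} \<union>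
     {prod_list (map (\<lambda>a. if eps a = 1 then free_gen (Elt (one_plus Q a)) else free_gen (Inv a))
        (arrow_list Q lt)) - free_gen (Elt (weight_elem Q q))})"

definition mpa_ideal ::
  "('v, 'a) pre_digraph \<Rightarrow> 'a darrow rel \<Rightarrow> ('v \<Rightarrow> 'k::field) \<Rightarrow> ('v, 'a, 'k) mpa_free set" where
  "mpa_ideal Q lt q =
     genideal (free_algebra (mpa_gens Q) :: ('k, ('v, 'a, 'k) mpa_free) module) (mpa_rels Q lt q)"

definition mpa ::
  "('v, 'a) pre_digraph \<Rightarrow> 'a darrow rel \<Rightarrow> ('v \<Rightarrow> 'k::field) \<Rightarrow>
   ('k, ('v, 'a, 'k) mpa_free set) module" where
  "mpa Q lt q = quotient_algebra (free_algebra (mpa_gens Q)) (mpa_ideal Q lt q)"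

definition mpa_map ::
  "('v, 'a) pre_digraph \<Rightarrow> 'a darrow rel \<Rightarrow> ('v \<Rightarrow> 'k::field) \<Rightarrow>
   ('v, 'a, 'k) path_elem \<Rightarrow> ('v, 'a, 'k) mpa_free set" where
  "mpa_map Q lt q f = mpa_ideal Q lt q
     +>\<^bsub>free_algebra (mpa_gens Q) :: ('k, ('v, 'a, 'k) mpa_free) module\<^esub> free_gen (Elt f)"


section \<open>Categories and equivalences\<close>

record ('o, 'm) category =
  Obj :: "'o set"
  Hom :: "'o \<Rightarrow> 'o \<Rightarrow> 'm set"
  Ident :: "'o \<Rightarrow> 'm"
  Comp :: "'o \<Rightarrow> 'o \<Rightarrow> 'o \<Rightarrow> 'm \<Rightarrow> 'm \<Rightarrow> 'm"

text \<open>\<open>Comp C X Y Z g f\<close> is \<open>g\<close> after \<open>f\<close>, where \<open>f : X \<rightarrow> Y\<close> and \<open>g : Y \<rightarrow> Z\<close>.\<close>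

record ('o1, 'm1, 'o2, 'm2) functor_data =
  on_obj :: "'o1 \<Rightarrow> 'o2"
  on_hom :: "'o1 \<Rightarrow> 'o1 \<Rightarrow> 'm1 \<Rightarrow> 'm2"

definition is_functor ::
  "('o1, 'm1) category \<Rightarrow> ('o2, 'm2) category \<Rightarrow> ('o1, 'm1, 'o2, 'm2) functor_data \<Rightarrow> bool" where
  "is_functor C D F \<longleftrightarrow>
     (\<forall>X \<in> Obj C. on_obj F X \<in> Obj D) \<and>
     (\<forall>X \<in> Obj C. \<forall>Y \<in> Obj C. \<forall>f \<in> Hom C X Y.
        on_hom F X Y f \<in> Hom D (on_obj F X) (on_obj F Y)) \<and>
     (\<forall>X \<in> Obj C. on_hom F X X (Ident C X) = Ident D (on_obj F X)) \<and>
     (\<forall>X \<in> Obj C. \<forall>Y \<in> Obj C. \<forall>Z \<in> Obj C. \<forall>f \<in> Hom C X Y. \<forall>g \<in> Hom C Y Z.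
        on_hom F X Z (Comp C X Y Z g f) =
          Comp D (on_obj F X) (on_obj F Y) (on_obj F Z) (on_hom F Y Z g) (on_hom F X Y f))"

definition id_functor :: "('o, 'm, 'o, 'm) functor_data" where
  "id_functor = \<lparr> on_obj = (\<lambda>X. X), on_hom = (\<lambda>X Y f. f) \<rparr>"

definition comp_functor ::
  "('o2, 'm2, 'o3, 'm3) functor_data \<Rightarrow> ('o1, 'm1, 'o2, 'm2) functor_data \<Rightarrow>
   ('o1, 'm1, 'o3, 'm3) functor_data" where
  "comp_functor G F = \<lparr> on_obj = (\<lambda>X. on_obj G (on_obj F X)),
     on_hom = (\<lambda>X Y f. on_hom G (on_obj F X) (on_obj F Y) (on_hom F X Y f)) \<rparr>"

definition cat_iso :: "('o, 'm) category \<Rightarrow> 'o \<Rightarrow> 'o \<Rightarrow> 'm set" where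
  "cat_iso C X Y = {f \<in> Hom C X Y. \<exists>g \<in> Hom C Y X.
     Comp C X Y X g f = Ident C X \<and> Comp C Y X Y f g = Ident C Y}"

definition naturally_isomorphic ::
  "('o1, 'm1) category \<Rightarrow> ('o2, 'm2) category \<Rightarrow>
   ('o1, 'm1, 'o2, 'm2) functor_data \<Rightarrow> ('o1, 'm1, 'o2, 'm2) functor_data \<Rightarrow> bool" where
  "naturally_isomorphic C D F G \<longleftrightarrow> (\<exists>\<eta>.
     (\<forall>X \<in> Obj C. \<eta> X \<in> cat_iso D (on_obj F X) (on_obj G X)) \<and>
     (\<forall>X \<in> Obj C. \<forall>Y \<in> Obj C. \<forall>f \<in> Hom C X Y.
        Comp D (on_obj F X) (on_obj F Y) (on_obj G Y) (\<eta> Y) (on_hom F X Y f) =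
        Comp D (on_obj F X) (on_obj G X) (on_obj G Y) (on_hom G X Y f) (\<eta> X)))"

definition inverse_equivalences ::
  "('o1, 'm1) category \<Rightarrow> ('o2, 'm2) category \<Rightarrow>
   ('o1, 'm1, 'o2, 'm2) functor_data \<Rightarrow> ('o2, 'm2, 'o1, 'm1) functor_data \<Rightarrow> bool" where
  "inverse_equivalences C D F G \<longleftrightarrow>
     is_functor C D F \<and> is_functor D C G \<and>
     naturally_isomorphic C C (comp_functor G F) id_functor \<and>
     naturally_isomorphic D D (comp_functor F G) id_functor"


section \<open>Representations\<close>

text \<open>The library locale \<^locale>\<open>module\<close> requires a commutative ring of scalars.\<close>

locale left_module = R?: ring R + M?: abelian_group M
  for R :: "('r, 's) ring_scheme" (structure) and M :: "('r, 'm) module" (structure) +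
  assumes smult_closed:
      "\<lbrakk>r \<in> carrier R; x \<in> carrier M\<rbrakk> \<Longrightarrow> r \<odot>\<^bsub>M\<^esub> x \<in> carrier M"
    and smult_l_distr:
      "\<lbrakk>r \<in> carrier R; s \<in> carrier R; x \<in> carrier M\<rbrakk> \<Longrightarrow>
       (r \<oplus>\<^bsub>R\<^esub> s) \<odot>\<^bsub>M\<^esub> x = r \<odot>\<^bsub>M\<^esub> x \<oplus>\<^bsub>M\<^esub> s \<odot>\<^bsub>M\<^esub> x"
    and smult_r_distr:
      "\<lbrakk>r \<in> carrier R; x \<in> carrier M; y \<in> carrier M\<rbrakk> \<Longrightarrow>
       r \<odot>\<^bsub>M\<^esub> (x \<oplus>\<^bsub>M\<^esub> y) = r \<odot>\<^bsub>M\<^esub> x \<oplus>\<^bsub>M\<^esub> r \<odot>\<^bsub>M\<^esub> y"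
    and smult_assoc1:
      "\<lbrakk>r \<in> carrier R; s \<in> carrier R; x \<in> carrier M\<rbrakk> \<Longrightarrow>
       (r \<otimes>\<^bsub>R\<^esub> s) \<odot>\<^bsub>M\<^esub> x = r \<odot>\<^bsub>M\<^esub> (s \<odot>\<^bsub>M\<^esub> x)"
    and smult_one:
      "x \<in> carrier M \<Longrightarrow> \<one>\<^bsub>R\<^esub> \<odot>\<^bsub>M\<^esub> x = x"

text \<open>The fields \<^const>\<open>mult\<close> and \<^const>\<open>one\<close> of a module record are irrelevant here. Homomorphisms are
  extensional functions, so that equal homomorphisms are equal as functions.\<close>

definition left_module_hom ::
  "('r, 's) ring_scheme \<Rightarrow> ('r, 'm) module \<Rightarrow> ('r, 'n) module \<Rightarrow> ('m \<Rightarrow> 'n) set" where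
  "left_module_hom R X Y = {f \<in> carrier X \<rightarrow>\<^sub>E carrier Y.
     (\<forall>x \<in> carrier X. \<forall>y \<in> carrier X. f (x \<oplus>\<^bsub>X\<^esub> y) = f x \<oplus>\<^bsub>Y\<^esub> f y) \<and>
     (\<forall>r \<in> carrier R. \<forall>x \<in> carrier X. f (r \<odot>\<^bsub>X\<^esub> x) = r \<odot>\<^bsub>Y\<^esub> f x)}"

text \<open>The type \<^typ>\<open>'m\<close> acts as a universe: the objects are the modules whose carrier is a subset of it.
  If it is infinite, this class of modules is closed under finite direct sums up to isomorphism.\<close>

definition module_category ::
  "('r, 's) ring_scheme \<Rightarrow> (('r, 'm) module, 'm \<Rightarrow> 'm) category" where
  "module_category R = \<lparr>
     Obj = {X. left_module R X},
     Hom = left_module_hom R,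
     Ident = (\<lambda>X. \<lambda>x \<in> carrier X. x),
     Comp = (\<lambda>X Y Z g f. compose (carrier X) g f) \<rparr>"

definition underlying_space ::
  "('k::field, 'r) module \<Rightarrow> ('r, 'm) module \<Rightarrow> ('k, 'm) module" where
  "underlying_space A X = \<lparr> carrier = carrier X, mult = mult X, one = one X, zero = zero X,
     add = add X, smult = (\<lambda>c x. (c \<odot>\<^bsub>A\<^esub> \<one>\<^bsub>A\<^esub>) \<odot>\<^bsub>X\<^esub> x) \<rparr>"

type_synonym ('v, 'a, 'k, 'm) mpa_rep = "(('v, 'a, 'k) mpa_free set, 'm) module"

definition finite_dimensional ::
  "('v, 'a) pre_digraph \<Rightarrow> 'a darrow rel \<Rightarrow> ('v \<Rightarrow> 'k::field) \<Rightarrow>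
   ('v, 'a, 'k, 'm) mpa_rep \<Rightarrow> bool" where
  "finite_dimensional Q lt q X \<longleftrightarrow>
     vectorspace.fin_dim class_ring (underlying_space (mpa Q lt q) X)"

definition vertex_space ::
  "('v, 'a) pre_digraph \<Rightarrow> 'a darrow rel \<Rightarrow> ('v \<Rightarrow> 'k::field) \<Rightarrow>
   ('v, 'a, 'k, 'm) mpa_rep \<Rightarrow> 'v \<Rightarrow> ('k, 'm) module" where
  "vertex_space Q lt q X w = (underlying_space (mpa Q lt q) X)
     \<lparr> carrier := (\<lambda>x. mpa_map Q lt q (path_idem w) \<odot>\<^bsub>X\<^esub> x) ` carrier X \<rparr>"

text \<open>Only the values at the vertices of the quiver are meaningful.\<close>

definition dim_vector ::
  "('v, 'a) pre_digraph \<Rightarrow> 'a darrow rel \<Rightarrow> ('v \<Rightarrow> 'k::field) \<Rightarrow>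
   ('v, 'a, 'k, 'm) mpa_rep \<Rightarrow> 'v \<Rightarrow> nat" where
  "dim_vector Q lt q X w = vectorspace.dim class_ring (vertex_space Q lt q X w)"


section \<open>Reflections\<close>

definition sym_form :: "('v, 'a) pre_digraph \<Rightarrow> ('v \<Rightarrow> int) \<Rightarrow> ('v \<Rightarrow> int) \<Rightarrow> int" where
  "sym_form Q \<alpha> \<beta> = 2 * (\<Sum>w \<in> verts Q. \<alpha> w * \<beta> w)
     - (\<Sum>a \<in> arcs Q. \<alpha> (head Q a) * \<beta> (tail Q a) + \<alpha> (tail Q a) * \<beta> (head Q a))"

definition coord_vec :: "'v \<Rightarrow> 'v \<Rightarrow> int" where
  "coord_vec v w = (if w = v then 1 else 0)"

definition refl_dim :: "('v, 'a) pre_digraph \<Rightarrow> 'v \<Rightarrow> ('v \<Rightarrow> int) \<Rightarrow> 'v \<Rightarrow> int" where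
  "refl_dim Q v \<alpha> w = \<alpha> w - sym_form Q \<alpha> (coord_vec v) * coord_vec v w"

definition refl_weight ::
  "('v, 'a) pre_digraph \<Rightarrow> 'v \<Rightarrow> ('v \<Rightarrow> 'k::field) \<Rightarrow> 'v \<Rightarrow> 'k" where
  "refl_weight Q v q w = q v powi (- sym_form Q (coord_vec v) (coord_vec w)) * q w"

section \<open>The universal property\<close>

text \<open>The algebra \<open>mpa Q lt q\<close> is indeed the target of the universal homomorphism. This section is not
  needed for the definitions above.\<close>

lemma poly_mapping_add_induct [case_names zero add]:
  assumes "P 0" "\<And>f k c. P f \<Longrightarrow> P (f + Poly_Mapping.single k c)"
  shows "P (f :: 'a \<Rightarrow>\<^sub>0 'k::field)"
proof (induction f rule: update_induct)
  case const
  show ?case by (rule assms(1))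
next
  case (update f a b)
  have "Poly_Mapping.update a b f = f + Poly_Mapping.single a b"
    by (rule poly_mapping_eqI) (use update(1) in \<open>auto simp add: lookup_update lookup_add lookup_single when_def in_keys_iff\<close>)
  then show ?case using assms(2)[OF update(3)] by simp
qed

lemma poly_mapping_scale: "Poly_Mapping.map ((*) (c::'k::field)) f = Poly_Mapping.single (0::'g::monoid_add) c * f"
proof (induction f rule: poly_mapping_add_induct)
  case zero
  show ?case by (intro poly_mapping_eqI) (simp add: map.rep_eq when_def)
next
  case (add f k d)
  have "Poly_Mapping.map ((*) c) (f + Poly_Mapping.single k d) =
    Poly_Mapping.map ((*) c) f + Poly_Mapping.single k (c * d)"
    by (intro poly_mapping_eqI) (auto simp add: map.rep_eq when_def lookup_add lookup_single simp flip: distrib_left)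
  then show ?case using add by (simp add: distrib_left mult_single)
qed

lemma poly_mapping_scale_comm: "f * Poly_Mapping.single (0::'g::monoid_add) (c::'k::field) = Poly_Mapping.single 0 c * f"
  by (induction f rule: poly_mapping_add_induct) (simp_all add: distrib_left distrib_right mult_single mult.commute)

locale free_algebra_ctx = fixes G :: "'g set" and K :: "'k::field itself"
begin
definition A :: "('k, 'g free_mon \<Rightarrow>\<^sub>0 'k) module" where "A = free_algebra G"
lemma A_simps: "carrier A = {f. \<forall>w \<in> Poly_Mapping.keys f. set (letters w) \<subseteq> G}" 
  "x \<otimes>\<^bsub>A\<^esub> y = x * y" "x \<oplus>\<^bsub>A\<^esub> y = x + y" "\<one>\<^bsub>A\<^esub> = 1" "\<zero>\<^bsub>A\<^esub> = 0" "c \<odot>\<^bsub>A\<^esub> x = Poly_Mapping.single 0 c * x"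
  by (simp_all add: A_def free_algebra_def poly_mapping_scale)
lemma c_single: "set (letters w) \<subseteq> G \<Longrightarrow> Poly_Mapping.single w c \<in> carrier A"
  by (auto simp: A_simps split: if_splits)
lemma c_add: "x \<in> carrier A \<Longrightarrow> y \<in> carrier A \<Longrightarrow> x + y \<in> carrier A"
  using keys_add[of x y] by (auto simp: A_simps)
lemma c_mult: "x \<in> carrier A \<Longrightarrow> y \<in> carrier A \<Longrightarrow> x * y \<in> carrier A"
  using keys_mult[of x y] by (fastforce simp: A_simps plus_free_mon_def)
lemma c_1: "1 \<in> carrier A" and c_0: "0 \<in> carrier A"
  by (auto simp: A_simps zero_free_mon_def)
lemma c_k: "Poly_Mapping.single 0 c \<in> carrier A"
  by (rule c_single) (simp add: zero_free_mon_def)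
lemma c_neg: "x \<in> carrier A \<Longrightarrow> - x \<in> carrier A"
  by (auto simp: A_simps in_keys_iff)
lemma c_diff: "x \<in> carrier A \<Longrightarrow> y \<in> carrier A \<Longrightarrow> x - y \<in> carrier A"
  using c_add[of x "-y"] c_neg by simp
lemmas cs = c_single c_add c_mult c_1 c_0 c_k c_neg c_diff
lemma gen: "g \<in> G \<Longrightarrow> free_gen g \<in> carrier A" unfolding free_gen_def by (rule c_single) simp

lemma ring_A: "ring A"
proof (rule ringI)
  show "abelian_group A"
  proof (rule abelian_groupI, unfold A_simps(2-6))
    fix x assume "x \<in> carrier A"
    then show "\<exists>y\<in>carrier A. y + x = 0" using c_neg by (intro bexI[of _ "-x"]) simp_all
  qed (use cs in \<open>auto simp: add.assoc add.commute\<close>)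
  show "Group.monoid A"
    by (rule Group.monoid.intro, unfold A_simps(2-6)) (use cs in \<open>auto simp: mult.assoc\<close>)
qed (unfold A_simps(2-6), auto simp: distrib_left distrib_right)

lemma k_algebra_A: "k_algebra A"
proof -
  interpret ring A by (rule ring_A)
  have "module class_ring A"
  proof (rule moduleI)
    show "cring (class_ring :: 'k ring)" using class_field field.axioms(1) domain.axioms(1) by blast
  qed (use is_abelian_group in \<open>(auto simp: A_simps(2-6) intro!: c_mult c_k 
      simp: distrib_left distrib_right single_add mult_single simp flip: mult.assoc)\<close>)
  moreover have "x * (Poly_Mapping.single 0 c * y) = Poly_Mapping.single 0 c * (x * y)" for x y :: "'g free_mon \<Rightarrow>\<^sub>0 'k" and c
    by (metis mult.assoc poly_mapping_scale_comm)
  ultimately show ?thesis using ring_A unfolding k_algebra_def by (simp add: A_simps(2-6) mult.assoc)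
qed
end


lemma k_algebraD:
  assumes "k_algebra R"
  shows "ring R" "module class_ring R"
    "x \<in> carrier R \<Longrightarrow> y \<in> carrier R \<Longrightarrow> (c \<odot>\<^bsub>R\<^esub> x) \<otimes>\<^bsub>R\<^esub> y = c \<odot>\<^bsub>R\<^esub> (x \<otimes>\<^bsub>R\<^esub> y)"
    "x \<in> carrier R \<Longrightarrow> y \<in> carrier R \<Longrightarrow> x \<otimes>\<^bsub>R\<^esub> (c \<odot>\<^bsub>R\<^esub> y) = c \<odot>\<^bsub>R\<^esub> (x \<otimes>\<^bsub>R\<^esub> y)"
  using assms by (auto simp: k_algebra_def)

lemma k_algebra_smult:
  assumes "k_algebra (R :: ('k::field,'r) module)"
  shows "x \<in> carrier R \<Longrightarrow> c \<odot>\<^bsub>R\<^esub> x \<in> carrier R"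
    "x \<in> carrier R \<Longrightarrow> (c + d) \<odot>\<^bsub>R\<^esub> x = c \<odot>\<^bsub>R\<^esub> x \<oplus>\<^bsub>R\<^esub> d \<odot>\<^bsub>R\<^esub> x"
    "x \<in> carrier R \<Longrightarrow> y \<in> carrier R \<Longrightarrow> c \<odot>\<^bsub>R\<^esub> (x \<oplus>\<^bsub>R\<^esub> y) = c \<odot>\<^bsub>R\<^esub> x \<oplus>\<^bsub>R\<^esub> c \<odot>\<^bsub>R\<^esub> y"
    "x \<in> carrier R \<Longrightarrow> (c * d) \<odot>\<^bsub>R\<^esub> x = c \<odot>\<^bsub>R\<^esub> (d \<odot>\<^bsub>R\<^esub> x)"
    "x \<in> carrier R \<Longrightarrow> 1 \<odot>\<^bsub>R\<^esub> x = x"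
proof -
  interpret module class_ring R using assms by (rule k_algebraD(2))
  show "x \<in> carrier R \<Longrightarrow> c \<odot>\<^bsub>R\<^esub> x \<in> carrier R"
    "x \<in> carrier R \<Longrightarrow> (c + d) \<odot>\<^bsub>R\<^esub> x = c \<odot>\<^bsub>R\<^esub> x \<oplus>\<^bsub>R\<^esub> d \<odot>\<^bsub>R\<^esub> x"
    "x \<in> carrier R \<Longrightarrow> y \<in> carrier R \<Longrightarrow> c \<odot>\<^bsub>R\<^esub> (x \<oplus>\<^bsub>R\<^esub> y) = c \<odot>\<^bsub>R\<^esub> x \<oplus>\<^bsub>R\<^esub> c \<odot>\<^bsub>R\<^esub> y"
    "x \<in> carrier R \<Longrightarrow> (c * d) \<odot>\<^bsub>R\<^esub> x = c \<odot>\<^bsub>R\<^esub> (d \<odot>\<^bsub>R\<^esub> x)"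
    "x \<in> carrier R \<Longrightarrow> 1 \<odot>\<^bsub>R\<^esub> x = x"
    using smult_closed[of c x] smult_l_distr[of c d x] smult_r_distr[of c x y] smult_assoc1[of c d x] smult_one[of x] by auto
qed

lemma quotient_algebra_simps:
  "carrier (quotient_algebra A J) = carrier (A Quot J)"
  "mult (quotient_algebra A J) = mult (A Quot J)"
  "add (quotient_algebra A J) = add (A Quot J)"
  "one (quotient_algebra A J) = one (A Quot J)"
  "zero (quotient_algebra A J) = zero (A Quot J)"
  "c \<odot>\<^bsub>quotient_algebra A J\<^esub> C = (\<Union>x \<in> C. J +>\<^bsub>A\<^esub> (c \<odot>\<^bsub>A\<^esub> x))"
  by (simp_all add: quotient_algebra_def ring.extend_def module.fields_def FactRing_def)

locale quotient_ctx = fixes A :: "('k::field,'r) module" and J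
  assumes kA: "k_algebra A" and id: "ideal J A"
begin
sublocale ideal J A by (rule id)
abbreviation "B \<equiv> quotient_algebra A J"
abbreviation "pr \<equiv> (\<lambda>x. J +>\<^bsub>A\<^esub> x)"
lemmas ksm = k_algebra_smult[OF kA] k_algebraD(3-)[OF kA]

lemma smJ: "x \<in> J \<Longrightarrow> c \<odot>\<^bsub>A\<^esub> x \<in> J"
proof -
  assume x: "x \<in> J"
  then have xA: "x \<in> carrier A" using a_subset by auto
  have "c \<odot>\<^bsub>A\<^esub> x = (c \<odot>\<^bsub>A\<^esub> \<one>\<^bsub>A\<^esub>) \<otimes>\<^bsub>A\<^esub> x" using ksm(6)[of "\<one>\<^bsub>A\<^esub>" x c] xA by simp
  then show ?thesis using I_l_closed[OF x, of "c \<odot>\<^bsub>A\<^esub> \<one>\<^bsub>A\<^esub>"] ksm(1)[of "\<one>\<^bsub>A\<^esub>" c] by simp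
qed

lemma pr_eqI: "x \<in> carrier A \<Longrightarrow> y \<in> carrier A \<Longrightarrow> x \<ominus>\<^bsub>A\<^esub> y \<in> J \<Longrightarrow> pr x = pr y"
  using quotient_eq_iff_same_a_r_cos[OF id] by blast

lemma pr_smult: "x \<in> carrier A \<Longrightarrow> c \<odot>\<^bsub>B\<^esub> pr x = pr (c \<odot>\<^bsub>A\<^esub> x)"
proof -
  assume x: "x \<in> carrier A"
  have "pr (c \<odot>\<^bsub>A\<^esub> z) = pr (c \<odot>\<^bsub>A\<^esub> x)" if z: "z \<in> pr x" for z
  proof -
    from z obtain j where j: "j \<in> J" "z = j \<oplus>\<^bsub>A\<^esub> x" by (auto simp: a_r_coset_def')
    have jA: "j \<in> carrier A" using j a_subset by auto
    have "c \<odot>\<^bsub>A\<^esub> z = c \<odot>\<^bsub>A\<^esub> j \<oplus>\<^bsub>A\<^esub> c \<odot>\<^bsub>A\<^esub> x" using j jA x ksm(3) by simp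
    then have m: "c \<odot>\<^bsub>A\<^esub> z \<in> pr (c \<odot>\<^bsub>A\<^esub> x)" using smJ[OF j(1)] by (auto simp: a_r_coset_def')
    show ?thesis using a_repr_independence[OF m ksm(1)[OF x] a_subgroup] by simp
  qed
  then have "(\<Union>z\<in>pr x. pr (c \<odot>\<^bsub>A\<^esub> z)) = (\<Union>z\<in>pr x. pr (c \<odot>\<^bsub>A\<^esub> x))" by (rule SUP_cong[OF refl])
  moreover have "x \<in> pr x" using x a_rcos_self by simp
  ultimately have "(\<Union>z\<in>pr x. pr (c \<odot>\<^bsub>A\<^esub> z)) = pr (c \<odot>\<^bsub>A\<^esub> x)" by auto
  then show ?thesis unfolding quotient_algebra_simps(6) .
qed

lemma carrB: "carrier B = pr ` carrier A"
  by (auto simp: quotient_algebra_simps FactRing_def A_RCOSETS_def' )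

lemma pr_hom: "pr \<in> Ring.ring_hom A (A Quot J)" by (rule rcos_ring_hom)
lemma pr_simps: 
  "x \<in> carrier A \<Longrightarrow> y \<in> carrier A \<Longrightarrow> pr x \<oplus>\<^bsub>B\<^esub> pr y = pr (x \<oplus>\<^bsub>A\<^esub> y)"
  "x \<in> carrier A \<Longrightarrow> y \<in> carrier A \<Longrightarrow> pr x \<otimes>\<^bsub>B\<^esub> pr y = pr (x \<otimes>\<^bsub>A\<^esub> y)"
  "\<one>\<^bsub>B\<^esub> = pr \<one>\<^bsub>A\<^esub>"
  using ring_hom_add[OF pr_hom] ring_hom_mult[OF pr_hom] ring_hom_one[OF pr_hom] by (simp_all add: quotient_algebra_simps)

lemma ring_B: "ring B"
proof -
  interpret q: ring "A Quot J" by (rule quotient_is_ring)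
  show ?thesis
  proof (rule ringI)
    show "abelian_group B"
    proof (rule abelian_groupI, unfold quotient_algebra_simps(1-5))
      fix x assume "x \<in> carrier (A Quot J)"
      then show "\<exists>y\<in>carrier (A Quot J). y \<oplus>\<^bsub>A Quot J\<^esub> x = \<zero>\<^bsub>A Quot J\<^esub>"
        by (intro bexI[of _ "\<ominus>\<^bsub>A Quot J\<^esub> x"]) (simp_all add: q.l_neg)
    qed (simp_all add: q.a_assoc q.add.m_comm q.add.m_lcomm)
    show "Group.monoid B"
      by (rule Group.monoid.intro; unfold quotient_algebra_simps(1-5)) (simp_all add: q.m_assoc)
  qed (unfold quotient_algebra_simps(1-5), simp_all add: q.l_distr q.r_distr)
qed

lemma k_algebra_B: "k_algebra B"
proof -
  interpret b: ring B by (rule ring_B)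
  have "module class_ring B"
  proof (rule moduleI)
    show "cring (class_ring :: 'k ring)" using class_field field.axioms(1) domain.axioms(1) by blast
  qed (use b.is_abelian_group in \<open>(auto simp: carrB pr_smult pr_simps ksm)\<close>)
  then show ?thesis using ring_B by (auto simp: k_algebra_def carrB pr_smult pr_simps ksm)
qed

lemma descend:
  assumes kR: "k_algebra R" and h: "h \<in> k_algebra_hom A R" and J: "\<And>x. x \<in> J \<Longrightarrow> h x = \<zero>\<^bsub>R\<^esub>"
  shows "\<exists>\<psi> \<in> k_algebra_hom B R. \<forall>x \<in> carrier A. \<psi> (pr x) = h x"
proof -
  interpret R: ring R using kR by (rule k_algebraD)
  have hr: "h \<in> Ring.ring_hom A R" using h by (simp add: k_algebra_hom_def)
  define \<psi> where "\<psi> C = h (SOME x. x \<in> C)" for C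
  have psi: "\<psi> (pr x) = h x" if x: "x \<in> carrier A" for x
  proof -
    have "x \<in> pr x" using x a_rcos_self by simp
    then have "(SOME z. z \<in> pr x) \<in> pr x" by (rule someI)
    then obtain j where j: "j \<in> J" "(SOME z. z \<in> pr x) = j \<oplus>\<^bsub>A\<^esub> x" by (auto simp: a_r_coset_def')
    then show ?thesis using J[OF j(1)] ring_hom_add[OF hr, of j x] x a_subset ring_hom_closed[OF hr x] by (auto simp: \<psi>_def)
  qed
  have "\<psi> \<in> k_algebra_hom B R"
    unfolding k_algebra_hom_def
    by (auto intro!: ring_hom_memI simp: carrB pr_simps psi pr_smult ksm ring_hom_closed[OF hr] ring_hom_add[OF hr] ring_hom_mult[OF hr] ring_hom_one[OF hr])
      (use h in \<open>simp add: k_algebra_hom_def\<close>)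
  with psi show ?thesis by auto
qed
end

locale eval_ctx = fixes R :: "('k::field,'r) module" and \<gamma> :: "'g \<Rightarrow> 'r"
  assumes kR: "k_algebra R" and gR: "\<And>g. \<gamma> g \<in> carrier R"
begin
sublocale ring R by (rule k_algebraD(1)[OF kR])
lemmas ksm = k_algebra_smult[OF kR] k_algebraD(3-)[OF kR]
definition "w2r w = foldr (\<lambda>g x. \<gamma> g \<otimes>\<^bsub>R\<^esub> x) (letters w) \<one>\<^bsub>R\<^esub>"
lemma w_c[simp]: "w2r w \<in> carrier R"
proof -
  have "foldr (\<lambda>g x. \<gamma> g \<otimes>\<^bsub>R\<^esub> x) as \<one>\<^bsub>R\<^esub> \<in> carrier R" for as using gR by (induction as) auto
  then show ?thesis by (simp add: w2r_def)
qed
lemma w_0: "w2r 0 = \<one>\<^bsub>R\<^esub>" by (simp add: w2r_def zero_free_mon_def)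
lemma w_add: "w2r (v + w) = w2r v \<otimes>\<^bsub>R\<^esub> w2r w"
proof -
  have c: "foldr (\<lambda>g x. \<gamma> g \<otimes>\<^bsub>R\<^esub> x) as \<one>\<^bsub>R\<^esub> \<in> carrier R" for as using gR by (induction as) auto
  have "foldr (\<lambda>g x. \<gamma> g \<otimes>\<^bsub>R\<^esub> x) (as @ bs) \<one>\<^bsub>R\<^esub> = foldr (\<lambda>g x. \<gamma> g \<otimes>\<^bsub>R\<^esub> x) as \<one>\<^bsub>R\<^esub> \<otimes>\<^bsub>R\<^esub> foldr (\<lambda>g x. \<gamma> g \<otimes>\<^bsub>R\<^esub> x) bs \<one>\<^bsub>R\<^esub>" for as bs
    by (induction as) (use c gR m_assoc in \<open>simp_all del: foldr_append add: foldr_append[symmetric]\<close>)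
  then show ?thesis by (simp add: w2r_def plus_free_mon_def del: foldr_append)
qed
definition "evl f = finsum R (\<lambda>w. Poly_Mapping.lookup f w \<odot>\<^bsub>R\<^esub> w2r w) (Poly_Mapping.keys f)"
lemma z: "x \<in> carrier R \<Longrightarrow> 0 \<odot>\<^bsub>R\<^esub> x = \<zero>\<^bsub>R\<^esub>"
proof -
  assume x: "x \<in> carrier R"
  have "0 \<odot>\<^bsub>R\<^esub> x \<oplus>\<^bsub>R\<^esub> 0 \<odot>\<^bsub>R\<^esub> x = 0 \<odot>\<^bsub>R\<^esub> x" using ksm(2)[OF x, of 0 0] by simp
  then show ?thesis using ksm(1)[OF x, of 0] local.add.r_cancel_one by blast
qed
lemma cz: "c \<odot>\<^bsub>R\<^esub> \<zero>\<^bsub>R\<^esub> = \<zero>\<^bsub>R\<^esub>"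
proof -
  have "c \<odot>\<^bsub>R\<^esub> \<zero>\<^bsub>R\<^esub> \<oplus>\<^bsub>R\<^esub> c \<odot>\<^bsub>R\<^esub> \<zero>\<^bsub>R\<^esub> = c \<odot>\<^bsub>R\<^esub> \<zero>\<^bsub>R\<^esub>" using ksm(3)[of "\<zero>\<^bsub>R\<^esub>" "\<zero>\<^bsub>R\<^esub>" c] by simp
  then show ?thesis using ksm(1)[of "\<zero>\<^bsub>R\<^esub>" c] local.add.r_cancel_one by blast
qed
lemma sup: "finite S \<Longrightarrow> Poly_Mapping.keys f \<subseteq> S \<Longrightarrow> evl f = finsum R (\<lambda>w. Poly_Mapping.lookup f w \<odot>\<^bsub>R\<^esub> w2r w) S"
  unfolding evl_def by (rule add.finprod_mono_neutral_cong_left) (auto simp: in_keys_iff ksm z)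
lemma e_c[simp]: "evl f \<in> carrier R" unfolding evl_def by (rule finsum_closed) (auto simp: ksm)
lemma e_0: "evl 0 = \<zero>\<^bsub>R\<^esub>" unfolding evl_def by simp
lemma e_single: "evl (Poly_Mapping.single w c) = c \<odot>\<^bsub>R\<^esub> w2r w"
  by (subst sup[of "{w}"]) (auto simp: ksm)
lemma e_add: "evl (f + g) = evl f \<oplus>\<^bsub>R\<^esub> evl g"
proof -
  let ?S = "Poly_Mapping.keys f \<union> Poly_Mapping.keys g"
  have "evl (f + g) = finsum R (\<lambda>w. Poly_Mapping.lookup (f+g) w \<odot>\<^bsub>R\<^esub> w2r w) ?S"
    by (rule sup) (use keys_add[of f g] in auto)
  also have "\<dots> = finsum R (\<lambda>w. Poly_Mapping.lookup f w \<odot>\<^bsub>R\<^esub> w2r w \<oplus>\<^bsub>R\<^esub> Poly_Mapping.lookup g w \<odot>\<^bsub>R\<^esub> w2r w) ?S"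
    by (simp add: lookup_add ksm)
  also have "\<dots> = finsum R (\<lambda>w. Poly_Mapping.lookup f w \<odot>\<^bsub>R\<^esub> w2r w) ?S \<oplus>\<^bsub>R\<^esub> finsum R (\<lambda>w. Poly_Mapping.lookup g w \<odot>\<^bsub>R\<^esub> w2r w) ?S"
    by (rule finsum_addf) (auto simp: ksm)
  also have "\<dots> = evl f \<oplus>\<^bsub>R\<^esub> evl g" by (simp add: sup[of ?S f] sup[of ?S g])
  finally show ?thesis .
qed
lemma e_mult_single: "evl (Poly_Mapping.single w c * g) = evl (Poly_Mapping.single w c) \<otimes>\<^bsub>R\<^esub> evl g"
proof (induction g rule: poly_mapping_add_induct)
  case (add f k d)
  have "c \<odot>\<^bsub>R\<^esub> w2r w \<otimes>\<^bsub>R\<^esub> (d \<odot>\<^bsub>R\<^esub> w2r k) = (c * d) \<odot>\<^bsub>R\<^esub> w2r (w + k)"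
  proof -
    have "(c * d) \<odot>\<^bsub>R\<^esub> w2r (w + k) = (d * c) \<odot>\<^bsub>R\<^esub> w2r (w + k)" by (rule arg_cong[of _ _ "\<lambda>c. c \<odot>\<^bsub>R\<^esub> w2r (w + k)"]) (rule mult.commute)
    also have "\<dots> = d \<odot>\<^bsub>R\<^esub> (c \<odot>\<^bsub>R\<^esub> w2r (w + k))" by (rule ksm(4)) simp
    finally show ?thesis by (simp add: ksm(1,6,7) w_add)
  qed
  then show ?case using add by (simp add: distrib_left mult_single e_add e_single r_distr ksm)
qed (simp add: e_0)
lemma e_mult: "evl (f * g) = evl f \<otimes>\<^bsub>R\<^esub> evl g"
  by (induction f rule: poly_mapping_add_induct) (simp_all add: e_0 distrib_right e_add e_mult_single l_distr)
lemma e_1: "evl 1 = \<one>\<^bsub>R\<^esub>" using e_single[of 0 1] by (simp add: w_0 ksm)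
lemma e_gen: "evl (free_gen g) = \<gamma> g" unfolding free_gen_def using gR[of g] by (simp add: e_single w2r_def ksm)
lemma e_diff: "evl (f - g) = \<zero>\<^bsub>R\<^esub> \<longleftrightarrow> evl f = evl g"
proof -
  have "evl f = evl (f - g) \<oplus>\<^bsub>R\<^esub> evl g" using e_add[of "f - g" g] by simp
  then show ?thesis using e_c[of "f-g"] e_c[of g] by (metis local.add.r_cancel_one)
qed
lemma e_k: "evl (Poly_Mapping.single 0 c * g) = c \<odot>\<^bsub>R\<^esub> evl g"
  by (simp add: e_mult_single e_single w_0 ksm)
lemma e_hom: "evl \<in> k_algebra_hom (free_algebra G) R"
proof -
  interpret free_algebra_ctx G "TYPE('k)" .
  have "evl \<in> k_algebra_hom A R"
    unfolding k_algebra_hom_def by (auto intro!: ring_hom_memI simp: A_simps(2-5) e_add e_mult e_1) (simp add: A_simps(6) e_k)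
  then show ?thesis by (simp add: A_def)
qed
end


lemma fin_digraph_double: "fin_digraph Q \<Longrightarrow> fin_digraph (double Q)"
proof -
  assume "fin_digraph Q"
  then interpret fin_digraph Q .
  show ?thesis by unfold_locales (auto simp: double_def)
qed

lemma path_comp_qpaths:
  assumes p: "p \<in> qpaths G" and r: "r \<in> qpaths G" and e: "path_tail G p = path_head G r"
  shows "path_comp p r \<in> qpaths G"
proof (cases p)
  case (Trivial w) with r show ?thesis by simp
next
  case (Walk as)
  show ?thesis
  proof (cases r)
    case (Trivial w) with p Walk show ?thesis by simp
  next
    case (Walk bs)
    with p r e \<open>p = Walk as\<close> show ?thesis by (auto simp: qpaths_def successively_append_iff)
  qed
qed

lemma path_algebra_simps:
  "carrier (path_algebra G) = {f. Poly_Mapping.keys f \<subseteq> qpaths G}"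
  "f \<oplus>\<^bsub>path_algebra G\<^esub> g = f + g"
  "\<one>\<^bsub>path_algebra G\<^esub> = (\<Sum>w \<in> verts G. Poly_Mapping.single (Trivial w) 1)"
  by (simp_all add: path_algebra_def)

lemma path_algebra_sum_closed: "(\<And>i. i \<in> S \<Longrightarrow> f i \<in> carrier (path_algebra G)) \<Longrightarrow> (\<Sum>i\<in>S. f i) \<in> carrier (path_algebra G)"
  using keys_sum[of f S] unfolding path_algebra_simps by fastforce

lemma path_algebra_single_closed: "p \<in> qpaths G \<Longrightarrow> Poly_Mapping.single p c \<in> carrier (path_algebra G)"
  by (auto simp: path_algebra_simps split: if_splits)

lemma path_algebra_zero_closed: "0 \<in> carrier (path_algebra G)" by (simp add: path_algebra_simps)

lemma path_algebra_add_closed: "f \<in> carrier (path_algebra G) \<Longrightarrow> g \<in> carrier (path_algebra G) \<Longrightarrow> f \<oplus>\<^bsub>path_algebra G\<^esub> g \<in> carrier (path_algebra G)"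
  unfolding path_algebra_simps using keys_add[of f g] by auto

lemma path_algebra_mult_closed: "f \<in> carrier (path_algebra G) \<Longrightarrow> g \<in> carrier (path_algebra G) \<Longrightarrow> f \<otimes>\<^bsub>path_algebra G\<^esub> g \<in> carrier (path_algebra G)"
  unfolding path_algebra_def monoid.simps
  by (fold path_algebra_def) (intro path_algebra_sum_closed, auto intro!: path_algebra_single_closed path_comp_qpaths path_algebra_zero_closed simp: path_algebra_simps)

lemma path_algebra_smult_closed: "f \<in> carrier (path_algebra G) \<Longrightarrow> c \<odot>\<^bsub>path_algebra G\<^esub> f \<in> carrier (path_algebra G)"
  unfolding path_algebra_simps by (auto simp: path_algebra_def in_keys_iff map.rep_eq when_def split: if_splits)

lemma path_algebra_one_closed: "\<one>\<^bsub>path_algebra G\<^esub> \<in> carrier (path_algebra G)"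
  unfolding path_algebra_simps(3) by (intro path_algebra_sum_closed path_algebra_single_closed) (auto simp: qpaths_def)

lemma path_algebra_weight_elem_closed: "weight_elem Q q \<in> carrier (path_algebra (double Q))"
  unfolding weight_elem_def by (intro path_algebra_sum_closed path_algebra_single_closed) (auto simp: qpaths_def double_def)

lemma star_in_double: "a \<in> arcs (double Q) \<Longrightarrow> star a \<in> arcs (double Q)"
  by (cases a) (auto simp: double_def)

lemma path_algebra_one_plus_closed: "a \<in> arcs (double Q) \<Longrightarrow> one_plus Q a \<in> carrier (path_algebra (double Q))"
  unfolding one_plus_def path_arrow_def by (intro path_algebra_add_closed path_algebra_one_closed path_algebra_mult_closed path_algebra_single_closed) (auto simp: qpaths_def star_in_double)

lemma sorted_wrt_unique:
  assumes r: "\<And>a b c. r a b \<Longrightarrow> r b c \<Longrightarrow> r a c" "\<And>a. \<not> r a a"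
  shows "sorted_wrt r as \<Longrightarrow> sorted_wrt r bs \<Longrightarrow> set as = set bs \<Longrightarrow> as = bs"
proof (induction as arbitrary: bs)
  case (Cons a as)
  then obtain b bs' where bs: "bs = b # bs'" by (cases bs) auto
  have "a = b" using Cons.prems r bs by (metis list.set_intros(1) set_ConsD sorted_wrt.simps(2))
  moreover have "a \<notin> set as" "b \<notin> set bs'" using Cons.prems r bs by auto
  ultimately have "set as = set bs'" using Cons.prems bs by auto
  then show ?case using Cons bs \<open>a = b\<close> by simp
qed simp

lemma sorted_wrt_exists:
  assumes "finite S" "trans lt" "total_on S lt"
  shows "\<exists>as. set as = S \<and> sorted_wrt (\<lambda>a b. (a,b) \<in> lt) as"
  using assms(1,3)
proof (induction S rule: finite_induct)
  case empty show ?case by simp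
next
  case (insert x S)
  then obtain as where as: "set as = S" "sorted_wrt (\<lambda>a b. (a,b) \<in> lt) as" by (auto simp: total_on_def)
  let ?l = "filter (\<lambda>a. (a,x) \<in> lt) as" and ?r = "filter (\<lambda>a. (a,x) \<notin> lt) as"
  have t: "(x,a) \<in> lt" if "a \<in> set ?r" for a using that insert as(1) by (auto simp: total_on_def)
  have "sorted_wrt (\<lambda>a b. (a,b) \<in> lt) (?l @ x # ?r)"
    using as(2) t assms(2) by (auto simp: sorted_wrt_append sorted_wrt_filter dest: transD)
  moreover have "set (?l @ x # ?r) = insert x S" using as by auto
  ultimately show ?case by blast
qed

lemma arrow_list_sorted:
  assumes "fin_digraph Q" "strict_linear_order_on (arcs (double Q)) lt"
  shows "set (arrow_list Q lt) = arcs (double Q)" "sorted_wrt (\<lambda>a b. (a,b) \<in> lt) (arrow_list Q lt)"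
proof -
  interpret fin_digraph "double Q" using assms fin_digraph_double by blast
  have o: "trans lt" "irrefl lt" "total_on (arcs (double Q)) lt" using assms(2) by (auto simp: strict_linear_order_on_def)
  have "\<exists>!as. set as = arcs (double Q) \<and> sorted_wrt (\<lambda>a b. (a, b) \<in> lt) as"
    using sorted_wrt_exists[OF finite_arcs o(1,3)] sorted_wrt_unique[of "\<lambda>a b. (a,b) \<in> lt"] o(1,2)
    by (metis (mono_tags, lifting) irreflD transD)
  from theI'[OF this] show "set (arrow_list Q lt) = arcs (double Q)" "sorted_wrt (\<lambda>a b. (a,b) \<in> lt) (arrow_list Q lt)"
    by (simp_all add: arrow_list_def)
qed

locale mpa_ctx = fixes Q :: "('v,'a) pre_digraph" and lt and q :: "'v \<Rightarrow> 'k::field"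
  assumes fd: "fin_digraph Q" and lin: "strict_linear_order_on (arcs (double Q)) lt"
begin
abbreviation "P \<equiv> path_algebra (double Q) :: ('k,_) module"
definition "J = mpa_ideal Q lt q"
sublocale free_algebra_ctx "mpa_gens Q" "TYPE('k)" .
abbreviation "yy a \<equiv> free_gen (Inv a) :: ('v,'a,'k) mpa_free"
abbreviation "xx f \<equiv> free_gen (Elt f) :: ('v,'a,'k) mpa_free"

lemma xc: "f \<in> carrier P \<Longrightarrow> xx f \<in> carrier A" by (rule gen) (simp add: mpa_gens_def)
lemma yc: "a \<in> arcs (double Q) \<Longrightarrow> yy a \<in> carrier A" by (rule gen) (simp add: mpa_gens_def)

definition "fac a = (if eps a = 1 then xx (one_plus Q a) else yy a)"
lemma fc: "a \<in> arcs (double Q) \<Longrightarrow> fac a \<in> carrier A" by (auto simp: fac_def xc yc path_algebra_one_plus_closed)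
lemma pc: "set as \<subseteq> arcs (double Q) \<Longrightarrow> prod_list (map fac as) \<in> carrier A"
  by (induction as) (auto simp: c_1 c_mult fc)

lemma rels_cases:
  assumes "x \<in> mpa_rels Q lt q"
  obtains f g where "x = xx (f \<oplus>\<^bsub>P\<^esub> g) - (xx f + xx g)" "f \<in> carrier P" "g \<in> carrier P"
  | f g where "x = xx (f \<otimes>\<^bsub>P\<^esub> g) - xx f * xx g" "f \<in> carrier P" "g \<in> carrier P"
  | c f where "x = xx (c \<odot>\<^bsub>P\<^esub> f) - Poly_Mapping.single 0 c * xx f" "f \<in> carrier P"
  | "x = xx \<one>\<^bsub>P\<^esub> - 1"
  | a where "x = xx (one_plus Q a) * yy a - 1" "a \<in> arcs (double Q)"
  | a where "x = yy a * xx (one_plus Q a) - 1" "a \<in> arcs (double Q)"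
  | "x = prod_list (map fac (arrow_list Q lt)) - xx (weight_elem Q q)"
  using assms unfolding mpa_rels_def Let_def fac_def[abs_def] poly_mapping_scale by blast

lemma rels_c: "mpa_rels Q lt q \<subseteq> carrier A"
proof
  fix x assume "x \<in> mpa_rels Q lt q"
  then show "x \<in> carrier A"
    by (cases rule: rels_cases)
      (simp_all add: c_diff c_add c_mult xc yc path_algebra_add_closed path_algebra_mult_closed path_algebra_smult_closed path_algebra_one_closed path_algebra_one_plus_closed path_algebra_weight_elem_closed c_1 pc c_k arrow_list_sorted[OF fd lin])
qed

lemma J_ideal: "ideal J A"
  unfolding J_def mpa_ideal_def A_def[symmetric] by (rule ring.genideal_ideal[OF ring_A rels_c])
lemma J_rels: "x \<in> mpa_rels Q lt q \<Longrightarrow> x \<in> J"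
  unfolding J_def mpa_ideal_def A_def[symmetric] using ring.genideal_self[OF ring_A rels_c] by auto
lemma J_min: "ideal I A \<Longrightarrow> mpa_rels Q lt q \<subseteq> I \<Longrightarrow> J \<subseteq> I"
  unfolding J_def mpa_ideal_def A_def[symmetric] using ring.genideal_minimal[OF ring_A] by blast

sublocale qu: quotient_ctx A J by (rule quotient_ctx.intro[OF k_algebra_A J_ideal])

lemma mpa_eq: "mpa Q lt q = quotient_algebra A J" by (simp add: mpa_def A_def J_def)
lemma map_eq: "mpa_map Q lt q f = qu.pr (xx f)" by (simp add: mpa_map_def A_def J_def)

theorem mpa_k_algebra: "k_algebra (mpa Q lt q)" unfolding mpa_eq by (rule qu.k_algebra_B)

lemma minus: "x \<in> carrier A \<Longrightarrow> y \<in> carrier A \<Longrightarrow> x \<ominus>\<^bsub>A\<^esub> y = x - y"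
proof -
  interpret ring A by (rule ring_A)
  assume xy: "x \<in> carrier A" "y \<in> carrier A"
  have "\<ominus>\<^bsub>A\<^esub> y = - y" by (rule minus_equality) (auto simp: A_simps(2-5) xy c_neg)
  then show ?thesis by (simp add: a_minus_def A_simps(2-5))
qed

lemma rel: "x - y \<in> mpa_rels Q lt q \<Longrightarrow> x \<in> carrier A \<Longrightarrow> y \<in> carrier A \<Longrightarrow> qu.pr x = qu.pr y"
  by (rule qu.pr_eqI) (auto simp: minus J_rels)

lemma mem:
  "f \<in> carrier P \<Longrightarrow> g \<in> carrier P \<Longrightarrow> xx (f \<oplus>\<^bsub>P\<^esub> g) - (xx f + xx g) \<in> mpa_rels Q lt q"
  "f \<in> carrier P \<Longrightarrow> g \<in> carrier P \<Longrightarrow> xx (f \<otimes>\<^bsub>P\<^esub> g) - xx f * xx g \<in> mpa_rels Q lt q"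
  "f \<in> carrier P \<Longrightarrow> xx (c \<odot>\<^bsub>P\<^esub> f) - Poly_Mapping.map ((*) c) (xx f) \<in> mpa_rels Q lt q"
  "xx \<one>\<^bsub>P\<^esub> - 1 \<in> mpa_rels Q lt q"
  "a \<in> arcs (double Q) \<Longrightarrow> xx (one_plus Q a) * yy a - 1 \<in> mpa_rels Q lt q"
  "a \<in> arcs (double Q) \<Longrightarrow> yy a * xx (one_plus Q a) - 1 \<in> mpa_rels Q lt q"
  "prod_list (map fac (arrow_list Q lt)) - xx (weight_elem Q q) \<in> mpa_rels Q lt q"
  unfolding mpa_rels_def Let_def fac_def[abs_def] by blast+

lemma rel_list:
  assumes f: "f \<in> carrier P" and g: "g \<in> carrier P" 
  shows "qu.pr (xx (f \<oplus>\<^bsub>P\<^esub> g)) = qu.pr (xx f + xx g)"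
   "qu.pr (xx (f \<otimes>\<^bsub>P\<^esub> g)) = qu.pr (xx f * xx g)"
  by (rule rel mem xc path_algebra_add_closed path_algebra_mult_closed c_add c_mult f g)+
lemma rel_smult:
  assumes f: "f \<in> carrier P"
  shows "qu.pr (xx (c \<odot>\<^bsub>P\<^esub> f)) = qu.pr (c \<odot>\<^bsub>A\<^esub> xx f)"
  unfolding A_simps(6)
  by (rule rel, unfold poly_mapping_scale[symmetric], rule mem(3)[OF f]) (unfold poly_mapping_scale, (rule xc path_algebra_smult_closed c_mult c_k f)+)
lemma rel_one: "qu.pr (xx \<one>\<^bsub>P\<^esub>) = qu.pr 1"
  by (rule rel mem xc path_algebra_one_closed c_1)+
lemma rel_inv:
  assumes a: "a \<in> arcs (double Q)"
  shows "qu.pr (xx (one_plus Q a) * yy a) = qu.pr 1" "qu.pr (yy a * xx (one_plus Q a)) = qu.pr 1"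
  by (rule rel mem xc yc path_algebra_one_plus_closed c_mult c_1 a)+
lemma rel_prod: "qu.pr (prod_list (map fac (arrow_list Q lt))) = qu.pr (xx (weight_elem Q q))"
  by (rule rel, rule mem, rule pc) (simp_all add: arrow_list_sorted[OF fd lin] xc path_algebra_weight_elem_closed)

lemma map_hom: "mpa_map Q lt q \<in> k_algebra_hom P (mpa Q lt q)"
  unfolding k_algebra_hom_def mpa_eq
  by (auto intro!: ring_hom_memI simp: map_eq rel_list rel_smult rel_one qu.pr_simps xc qu.carrB A_simps(2-5) qu.pr_smult)

lemma inv_map:
  assumes a: "a \<in> arcs (double Q)"
  shows "mpa_map Q lt q (one_plus Q a) \<in> Units (mpa Q lt q)" "inv\<^bsub>mpa Q lt q\<^esub> (mpa_map Q lt q (one_plus Q a)) = qu.pr (yy a)"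
proof -
  interpret b: ring "mpa Q lt q" unfolding mpa_eq by (rule qu.ring_B)
  have c: "mpa_map Q lt q (one_plus Q a) \<in> carrier (mpa Q lt q)" "qu.pr (yy a) \<in> carrier (mpa Q lt q)"
    unfolding mpa_eq map_eq qu.carrB using a by (auto intro!: xc yc path_algebra_one_plus_closed)
  have e: "mpa_map Q lt q (one_plus Q a) \<otimes>\<^bsub>mpa Q lt q\<^esub> qu.pr (yy a) = \<one>\<^bsub>mpa Q lt q\<^esub>"
    "qu.pr (yy a) \<otimes>\<^bsub>mpa Q lt q\<^esub> mpa_map Q lt q (one_plus Q a) = \<one>\<^bsub>mpa Q lt q\<^esub>"
    unfolding mpa_eq map_eq using rel_inv[OF a] a by (simp_all add: qu.pr_simps xc yc path_algebra_one_plus_closed A_simps(2-5))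
  show "mpa_map Q lt q (one_plus Q a) \<in> Units (mpa Q lt q)" using c e by (auto simp: Units_def)
  show "inv\<^bsub>mpa Q lt q\<^esub> (mpa_map Q lt q (one_plus Q a)) = qu.pr (yy a)" using c e by (intro b.inv_char) auto
qed

lemma eps_pow:
  assumes "ring R" "u \<in> carrier R"
  shows "u [^]\<^bsub>R\<^esub> eps a = (if eps a = 1 then u else inv\<^bsub>R\<^esub> u)"
proof -
  interpret ring R by fact
  show ?thesis using assms by (cases a) (auto simp: int_pow_def2)
qed

theorem mpa_cond: "mpa_condition Q lt q (mpa Q lt q) (mpa_map Q lt q)"
proof -
  interpret b: ring "mpa Q lt q" unfolding mpa_eq by (rule qu.ring_B)
  have "foldr (\<lambda>a x. (mpa_map Q lt q (one_plus Q a) [^]\<^bsub>mpa Q lt q\<^esub> eps a) \<otimes>\<^bsub>mpa Q lt q\<^esub> x) as \<one>\<^bsub>mpa Q lt q\<^esub> = qu.pr (prod_list (map fac as))"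
    if "set as \<subseteq> arcs (double Q)" for as
    using that
  proof (induction as)
    case Nil show ?case unfolding mpa_eq by (simp add: qu.pr_simps A_simps)
  next
    case (Cons a as)
    have "mpa_map Q lt q (one_plus Q a) [^]\<^bsub>mpa Q lt q\<^esub> eps a = qu.pr (fac a)"
      using Cons inv_map[of a] by (subst eps_pow) (auto simp: fac_def map_eq b.ring_axioms mpa_eq[symmetric])
    then show ?case using Cons unfolding mpa_eq by (simp add: qu.pr_simps fc pc A_simps(2-5))
  qed
  then show ?thesis unfolding mpa_condition_def using map_hom inv_map(1) rel_prod arrow_list_sorted(1)[OF fd lin]
    by (simp add: map_eq)
qed

theorem mpa_universal:
  fixes R :: "('k,'r) module"
  assumes kR: "k_algebra R" and cond: "mpa_condition Q lt q R \<phi>"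
  shows "\<exists>\<psi>. \<psi> \<in> k_algebra_hom (mpa Q lt q) R \<and> (\<forall>f \<in> carrier P. \<psi> (mpa_map Q lt q f) = \<phi> f)"
proof -
  interpret R: ring R using kR by (rule k_algebraD)
  have ph: "\<phi> \<in> k_algebra_hom P R" and un: "\<And>a. a \<in> arcs (double Q) \<Longrightarrow> \<phi> (one_plus Q a) \<in> Units R"
    and pr: "foldr (\<lambda>a x. (\<phi> (one_plus Q a) [^]\<^bsub>R\<^esub> eps a) \<otimes>\<^bsub>R\<^esub> x) (arrow_list Q lt) \<one>\<^bsub>R\<^esub> = \<phi> (weight_elem Q q)"
    using cond by (auto simp: mpa_condition_def)
  have pr': "\<phi> \<in> Ring.ring_hom P R" using ph by (simp add: k_algebra_hom_def)
  define \<gamma> where "\<gamma> g = (case g of Elt f \<Rightarrow> if f \<in> carrier P then \<phi> f else \<zero>\<^bsub>R\<^esub> | Inv a \<Rightarrow> if a \<in> arcs (double Q) then inv\<^bsub>R\<^esub> \<phi> (one_plus Q a) else \<zero>\<^bsub>R\<^esub>)" for g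
  interpret eval_ctx R \<gamma> 
    by unfold_locales (auto simp: kR \<gamma>_def ring_hom_closed[OF pr'] un split: loc_gen.splits)
  have ex: "evl (xx f) = \<phi> f" if "f \<in> carrier P" for f using that by (simp add: e_gen \<gamma>_def)
  have ey: "evl (yy a) = inv\<^bsub>R\<^esub> \<phi> (one_plus Q a)" if "a \<in> arcs (double Q)" for a using that by (simp add: e_gen \<gamma>_def)
  have "evl (prod_list (map fac as)) = foldr (\<lambda>a x. (\<phi> (one_plus Q a) [^]\<^bsub>R\<^esub> eps a) \<otimes>\<^bsub>R\<^esub> x) as \<one>\<^bsub>R\<^esub>" if "set as \<subseteq> arcs (double Q)" for as
    using that
  proof (induction as)
    case (Cons a as)
    have "\<phi> (one_plus Q a) [^]\<^bsub>R\<^esub> eps a = evl (fac a)"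
      using Cons un[of a] by (subst eps_pow) (auto simp: fac_def ex ey path_algebra_one_plus_closed R.ring_axioms)
    then show ?case using Cons by (simp add: e_mult)
  qed (simp add: e_1)
  then have ep: "evl (prod_list (map fac (arrow_list Q lt))) = \<phi> (weight_elem Q q)" using pr arrow_list_sorted(1)[OF fd lin] by simp
  have hom: "evl \<in> k_algebra_hom A R" using e_hom A_def by metis
  have "ideal (a_kernel A R evl) A"
    using hom by (intro ring_hom_ring.kernel_is_ideal ring_hom_ringI2) (auto simp: ring_A R.ring_axioms k_algebra_hom_def)
  moreover have "evl x = \<zero>\<^bsub>R\<^esub>" if "x \<in> mpa_rels Q lt q" for x
    using that
  proof (cases rule: rels_cases)
    case (3 c f)
    then have "\<phi> (c \<odot>\<^bsub>P\<^esub> f) = c \<odot>\<^bsub>R\<^esub> \<phi> f" using ph by (simp add: k_algebra_hom_def)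
    then show ?thesis using 3 by (simp add: e_diff e_k ex path_algebra_smult_closed)
  qed (simp_all add: e_diff e_add e_mult e_1 ex ey path_algebra_add_closed path_algebra_mult_closed path_algebra_one_closed path_algebra_one_plus_closed path_algebra_weight_elem_closed un ep
      ring_hom_add[OF pr'] ring_hom_mult[OF pr'] ring_hom_one[OF pr'])
  ultimately have "J \<subseteq> a_kernel A R evl" using rels_c by (intro J_min) (auto simp: a_kernel_def')
  then have "\<And>x. x \<in> J \<Longrightarrow> evl x = \<zero>\<^bsub>R\<^esub>" by (auto simp: a_kernel_def')
  from qu.descend[OF kR hom this] show ?thesis unfolding mpa_eq map_eq using ex xc by metis
qed

lemma word_prod: "Poly_Mapping.single (FMon gs) c = Poly_Mapping.single 0 (c::'k) * prod_list (map free_gen gs)"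
proof (induction gs arbitrary: c)
  case Nil show ?case by (simp add: zero_free_mon_def)
next
  case (Cons g gs)
  have "Poly_Mapping.single (FMon (g # gs)) c = Poly_Mapping.single (FMon [g]) c * Poly_Mapping.single (FMon gs) 1"
    by (simp add: mult_single plus_free_mon_def)
  also have "Poly_Mapping.single (FMon [g]) c = Poly_Mapping.single 0 c * free_gen g"
    by (simp add: free_gen_def mult_single zero_free_mon_def plus_free_mon_def)
  finally show ?case using Cons[of 1] by (simp add: mult.assoc)
qed

theorem mpa_hom_unique:
  fixes R :: "('k,'r) module"
  assumes kR: "k_algebra R" and h: "\<psi> \<in> k_algebra_hom (mpa Q lt q) R" "\<psi>' \<in> k_algebra_hom (mpa Q lt q) R"
    and eq: "\<And>f. f \<in> carrier P \<Longrightarrow> \<psi> (mpa_map Q lt q f) = \<psi>' (mpa_map Q lt q f)"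
    and x: "x \<in> carrier (mpa Q lt q)"
  shows "\<psi> x = \<psi>' x"
proof -
  interpret R: ring R using kR by (rule k_algebraD)
  have hom: "\<psi> \<in> Ring.ring_hom (mpa Q lt q) R" "\<psi>' \<in> Ring.ring_hom (mpa Q lt q) R"
    using h by (auto simp: k_algebra_hom_def)
  define S where "S = {f \<in> carrier A. \<psi> (qu.pr f) = \<psi>' (qu.pr f)}"
  have c: "qu.pr f \<in> carrier (mpa Q lt q)" if "f \<in> carrier A" for f using that unfolding mpa_eq qu.carrB by blast
  have add: "f + g \<in> S" if "f \<in> S" "g \<in> S" for f g
  proof -
    have *: "qu.pr (f + g) = qu.pr f \<oplus>\<^bsub>mpa Q lt q\<^esub> qu.pr g" using that qu.pr_simps(1)[of f g] by (simp add: S_def mpa_eq A_simps(2-5))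
    show ?thesis using that ring_hom_add[OF hom(1), of "qu.pr f" "qu.pr g"] ring_hom_add[OF hom(2), of "qu.pr f" "qu.pr g"] c
      by (auto simp: S_def c_add *)
  qed
  have mult: "f * g \<in> S" if "f \<in> S" "g \<in> S" for f g
  proof -
    have *: "qu.pr (f * g) = qu.pr f \<otimes>\<^bsub>mpa Q lt q\<^esub> qu.pr g" using that qu.pr_simps(2)[of f g] by (simp add: S_def mpa_eq A_simps(2-5))
    show ?thesis using that ring_hom_mult[OF hom(1), of "qu.pr f" "qu.pr g"] ring_hom_mult[OF hom(2), of "qu.pr f" "qu.pr g"] c
      by (auto simp: S_def c_mult *)
  qed
  have pr1: "qu.pr 1 = \<one>\<^bsub>mpa Q lt q\<^esub>" unfolding mpa_eq using qu.pr_simps(3) by (simp add: A_simps(2-5))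
  have one: "1 \<in> S" using ring_hom_one[OF hom(1)] ring_hom_one[OF hom(2)] by (simp add: S_def c_1 pr1)
  have sc: "Poly_Mapping.single 0 d \<in> S" for d
  proof -
    have "qu.pr (Poly_Mapping.single 0 d) = d \<odot>\<^bsub>mpa Q lt q\<^esub> qu.pr 1"
      unfolding mpa_eq using qu.pr_smult[of 1 d] by (simp add: A_simps(6) c_1)
    moreover have "\<psi> (d \<odot>\<^bsub>mpa Q lt q\<^esub> qu.pr 1) = d \<odot>\<^bsub>R\<^esub> \<psi> (qu.pr 1)" "\<psi>' (d \<odot>\<^bsub>mpa Q lt q\<^esub> qu.pr 1) = d \<odot>\<^bsub>R\<^esub> \<psi>' (qu.pr 1)"
      using h c[OF c_1] by (auto simp: k_algebra_hom_def)
    ultimately show ?thesis using one by (simp add: S_def c_k)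
  qed
  have zero: "0 \<in> S" using sc[of 0] by simp
  have gx: "xx f \<in> S" if "f \<in> carrier P" for f using that eq[OF that] by (simp add: S_def xc map_eq)
  have gy: "yy a \<in> S" if a: "a \<in> arcs (double Q)" for a
  proof -
    let ?u = "mpa_map Q lt q (one_plus Q a)"
    have u: "?u \<in> Units (mpa Q lt q)" and i: "inv\<^bsub>mpa Q lt q\<^esub> ?u = qu.pr (yy a)" using inv_map[OF a] .
    interpret b: ring "mpa Q lt q" unfolding mpa_eq by (rule qu.ring_B)
    have "\<rho> (qu.pr (yy a)) = inv\<^bsub>R\<^esub> (\<rho> ?u)" if r: "\<rho> \<in> Ring.ring_hom (mpa Q lt q) R" for \<rho>
    proof (rule R.inv_char[symmetric])
      have ic: "qu.pr (yy a) \<in> carrier (mpa Q lt q)" using c yc a by blast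
      have uc: "?u \<in> carrier (mpa Q lt q)" using b.Units_closed[OF u] .
      show "\<rho> ?u \<in> carrier R" by (rule ring_hom_closed[OF r uc])
      show "\<rho> (qu.pr (yy a)) \<in> carrier R" by (rule ring_hom_closed[OF r ic])
      show "\<rho> ?u \<otimes>\<^bsub>R\<^esub> \<rho> (qu.pr (yy a)) = \<one>\<^bsub>R\<^esub>"
        unfolding ring_hom_mult[OF r uc ic, symmetric] b.Units_r_inv[OF u, unfolded i] by (rule ring_hom_one[OF r])
      show "\<rho> (qu.pr (yy a)) \<otimes>\<^bsub>R\<^esub> \<rho> ?u = \<one>\<^bsub>R\<^esub>"
        unfolding ring_hom_mult[OF r ic uc, symmetric] b.Units_l_inv[OF u, unfolded i] by (rule ring_hom_one[OF r])
    qed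
    then have "\<psi> (qu.pr (yy a)) = inv\<^bsub>R\<^esub> (\<psi> ?u)" "\<psi>' (qu.pr (yy a)) = inv\<^bsub>R\<^esub> (\<psi>' ?u)" using hom by blast+
    then show ?thesis using eq[OF path_algebra_one_plus_closed[OF a]] yc[OF a] by (simp add: S_def)
  qed
  have g: "free_gen t \<in> S" if "t \<in> mpa_gens Q" for t using that gx gy by (auto simp: mpa_gens_def)
  have w: "Poly_Mapping.single w d \<in> S" if "set (letters w) \<subseteq> mpa_gens Q" for w d
  proof -
    have "prod_list (map free_gen ts) \<in> S" if "set ts \<subseteq> mpa_gens Q" for ts
      using that by (induction ts) (auto intro: one mult g)
    then show ?thesis using word_prod[of "letters w" d] sc mult that by simp
  qed
  have all: "f \<in> S" if f: "f \<in> carrier A" for f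
  proof -
    have fw: "set (letters v) \<subseteq> mpa_gens Q" if "v \<in> Poly_Mapping.keys f" for v
      using f that unfolding A_simps(1) by blast
    have *: "(\<Sum>v\<in>W. Poly_Mapping.single v (Poly_Mapping.lookup f v)) \<in> S"
      if "finite W" "W \<subseteq> Poly_Mapping.keys f" for W
      using that
    proof (induction W rule: finite_induct)
      case empty show ?case using zero by simp
    next
      case (insert v W)
      have "Poly_Mapping.single v (Poly_Mapping.lookup f v) \<in> S" by (rule w, rule fw) (use insert in blast)
      then show ?case unfolding sum.insert[OF insert(1,2)] by (rule add) (use insert in blast)
    qed
    have "(\<Sum>v\<in>Poly_Mapping.keys f. Poly_Mapping.single v (Poly_Mapping.lookup f v)) = f"
    proof (rule poly_mapping_eqI)
      fix k
      have "(\<Sum>v\<in>Poly_Mapping.keys f. Poly_Mapping.lookup (Poly_Mapping.single v (Poly_Mapping.lookup f v)) k)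
        = (\<Sum>v\<in>Poly_Mapping.keys f. if v = k then Poly_Mapping.lookup f v else 0)"
        by (rule sum.cong[OF refl]) (simp add: lookup_single when_def)
      also have "\<dots> = Poly_Mapping.lookup f k"
        by (simp add: sum.delta) (simp add: in_keys_iff)
      finally show "Poly_Mapping.lookup (\<Sum>v\<in>Poly_Mapping.keys f. Poly_Mapping.single v (Poly_Mapping.lookup f v)) k
        = Poly_Mapping.lookup f k" by (simp only: lookup_sum)
    qed
    with *[OF finite_keys order_refl] show ?thesis by (simp only:)
  qed
  from x obtain f where "f \<in> carrier A" "x = qu.pr f" unfolding mpa_eq qu.carrB by blast
  then show ?thesis using all[of f] by (simp add: S_def)
qed

end


theorem mpa_universal_property:
  fixes Q :: "('v, 'a) pre_digraph" and q :: "'v \<Rightarrow> 'k::field"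
  assumes "fin_digraph Q" and "strict_linear_order_on (arcs (double Q)) lt"
  shows "k_algebra (mpa Q lt q)"
    and "mpa_condition Q lt q (mpa Q lt q) (mpa_map Q lt q)"
    and "\<lbrakk>k_algebra R; mpa_condition Q lt q R \<phi>\<rbrakk> \<Longrightarrow>
      \<exists>!\<psi>. \<psi> \<in> k_algebra_hom (mpa Q lt q) R \<and> \<psi> \<in> extensional (carrier (mpa Q lt q)) \<and>
        (\<forall>f \<in> carrier (path_algebra (double Q)). \<psi> (mpa_map Q lt q f) = \<phi> f)"
proof -
  interpret mpa_ctx Q lt q using assms by (rule mpa_ctx.intro)
  show "k_algebra (mpa Q lt q)" by (rule mpa_k_algebra)
  show "mpa_condition Q lt q (mpa Q lt q) (mpa_map Q lt q)" by (rule mpa_cond)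
  show "\<exists>!\<psi>. \<psi> \<in> k_algebra_hom (mpa Q lt q) R \<and> \<psi> \<in> extensional (carrier (mpa Q lt q)) \<and>
        (\<forall>f \<in> carrier P. \<psi> (mpa_map Q lt q f) = \<phi> f)"
    if R: "k_algebra R" and c: "mpa_condition Q lt q R \<phi>"
  proof -
    interpret b: ring "mpa Q lt q" by (rule k_algebraD(1)[OF mpa_k_algebra])
    obtain \<psi> where p: "\<psi> \<in> k_algebra_hom (mpa Q lt q) R" "\<forall>f \<in> carrier P. \<psi> (mpa_map Q lt q f) = \<phi> f"
      using mpa_universal[OF R c] by blast
    have p': "\<psi> \<in> Ring.ring_hom (mpa Q lt q) R" using p(1) by (simp add: k_algebra_hom_def)
    let ?\<rho> = "restrict \<psi> (carrier (mpa Q lt q))"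
    have mc: "mpa_map Q lt q f \<in> carrier (mpa Q lt q)" if "f \<in> carrier P" for f
      using map_hom ring_hom_closed[OF _ that] unfolding k_algebra_hom_def by blast
    have sm: "d \<odot>\<^bsub>mpa Q lt q\<^esub> x \<in> carrier (mpa Q lt q)" if "x \<in> carrier (mpa Q lt q)" for d x
      using k_algebra_smult(1)[OF mpa_k_algebra that] .
    have "?\<rho> \<in> Ring.ring_hom (mpa Q lt q) R"
      by (intro ring_hom_memI)
        (simp_all add: ring_hom_closed[OF p'] ring_hom_add[OF p'] ring_hom_mult[OF p'] ring_hom_one[OF p'])
    then have "?\<rho> \<in> k_algebra_hom (mpa Q lt q) R" using p(1) sm by (simp add: k_algebra_hom_def)
    then have ex: "?\<rho> \<in> k_algebra_hom (mpa Q lt q) R \<and> ?\<rho> \<in> extensional (carrier (mpa Q lt q)) \<and>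
        (\<forall>f \<in> carrier P. ?\<rho> (mpa_map Q lt q f) = \<phi> f)" using p(2) mc by simp
    show ?thesis
    proof (rule ex1I, rule ex)
      fix \<psi>' assume a: "\<psi>' \<in> k_algebra_hom (mpa Q lt q) R \<and> \<psi>' \<in> extensional (carrier (mpa Q lt q)) \<and>
        (\<forall>f \<in> carrier P. \<psi>' (mpa_map Q lt q f) = \<phi> f)"
      show "\<psi>' = ?\<rho>"
      proof (rule extensionalityI)
        show "\<psi>' \<in> extensional (carrier (mpa Q lt q))" using a by blast
        show "?\<rho> \<in> extensional (carrier (mpa Q lt q))" by simp
        show "\<psi>' x = ?\<rho> x" if "x \<in> carrier (mpa Q lt q)" for x
          by (rule mpa_hom_unique[OF R conjunct1[OF a] conjunct1[OF ex] _ that]) (metis a ex)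
      qed
    qed
  qed
qed

end

theory Submission
  imports Defs
begin

text \<open>For an arrow \<open>a\<close> of the double with head \<open>v\<close> put \<open>b\<^sub>a = a\<close> if \<open>eps a = 1\<close> and
  \<open>b\<^sub>a = - (1 + a a*)\<^sup>-\<^sup>1 a\<close> otherwise, so that \<open>1 + b\<^sub>a a*\<close> and \<open>1 + a* b\<^sub>a\<close> are the powers of exponent
  \<open>eps a\<close> of \<open>1 + a a*\<close> and \<open>1 + a* a\<close>. Let \<open>a\<^sub>1 < \<dots> < a\<^sub>n\<close> be these arrows and let \<open>W\<close> be the sum of the
  spaces of a representation \<open>X\<close> at their tails. Let \<open>\<mu>\<close> from \<open>X\<^sub>v\<close> to \<open>W\<close> have the components \<open>a\<^sub>i*\<close>, and
  let \<open>\<pi>\<close> from \<open>W\<close> to \<open>X\<^sub>v\<close> have the components \<open>(1 + b\<^sub>1 a\<^sub>1*) \<dots> (1 + b\<^sub>i\<^sub>-\<^sub>1 a\<^sub>i\<^sub>-\<^sub>1*) b\<^sub>i\<close>. The relation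
  at \<open>v\<close> becomes \<open>\<pi> \<mu> = q v - 1\<close>. If \<open>U\<close> is the strictly upper triangular part of the matrix of the \<open>a\<^sub>i* b\<^sub>j\<close>,
  then \<open>\<pi> (1 - U)\<close> is the row of the \<open>b\<^sub>i\<close>, so \<open>(1 + \<mu> \<pi>) (1 - U)\<close> is lower triangular with
  diagonal entries \<open>1 + a\<^sub>i* b\<^sub>i\<close>.

  As \<open>q v \<noteq> 1\<close>, the operator \<open>\<tau> = \<mu> \<pi>\<close> on \<open>W\<close> satisfies \<open>\<tau>\<^sup>2 = (q v - 1) \<tau>\<close>, and \<open>X\<^sub>v\<close>, \<open>\<mu>\<close> and \<open>\<pi>\<close> are
  recovered from \<open>\<tau>\<close> as its image, the inclusion and \<open>\<tau>\<close>. The reflection keeps \<open>W\<close> and \<open>U\<close> and divides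
  \<open>1 + \<tau>\<close> by \<open>q v\<close>. The new \<open>\<tau>\<close> is \<open>((1 + \<tau>) - q v) / q v\<close>, with image \<open>ker \<pi>\<close>; it has the same
  property for \<open>1 / q v\<close>. The \<open>1 + a\<^sub>i* b\<^sub>i\<close> are divided by \<open>q v\<close>, which accounts for the change of the
  weights at the other vertices. Reflecting twice gives back \<open>\<tau>\<close>, and \<open>W\<close> is the direct sum of
  \<open>X\<^sub>v\<close> and \<open>ker \<pi>\<close>, which gives the dimensions. The finite sum \<open>W\<close> is coded back into the infinite
  type that serves as the universe of the modules.\<close>

section \<open>Vector spaces given by carriers\<close>

text \<open>Write q for \<open>q v\<close>, a' for \<open>star a\<close> and L for (1 + \<tau>)(1 -
  U). The reflected b_j is column j of \<pi>' (1 - U) = L / q - 1 + U. Its coordinates are the new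
  products a_i' b_j, because the new \<mu> is the inclusion of ker \<pi> in W. The strictly upper
  part is again U, so the factorisation for the same ordering reproduces \<pi>', and the diagonal
  block 1 + a_i' b_i becomes its multiple by 1 / q.

  That block acts at the tail of a_i and is inverse to the factor of a_i' there. So a vertex w other
  than v gains one factor q for each arrow of the double from v to w, and the number of these is -
  (\<epsilon>_v, \<epsilon>_w).

  Since q is not 1, \<tau> / (q - 1) is idempotent, and the new \<tau> is (1 - q) / q times the
  complementary idempotent; this is why two reflections cancel.

  The algebra is a quotient of a free algebra with a generator for every element of the path
  algebra. Modules over it are therefore exchanged for families of operators \<open>E\<close>,
  \<open>T\<close>, \<open>G\<close>, and the universal property turns such a family back into a
  module.\<close>

lemma class_cring: "cring (class_ring :: 'k::field ring)"
  using class_field field.axioms(1) domain.axioms(1) by blast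

locale kspace = module "class_ring :: 'k::field ring" M for M :: "('k::field, 'm) module" (structure)
begin

lemma sc_closed [simp]: "x \<in> carrier M \<Longrightarrow> c \<odot> x \<in> carrier M"
  using smult_closed[of c x] by simp
lemma sc_add: "x \<in> carrier M \<Longrightarrow> (c + d) \<odot> x = c \<odot> x \<oplus> d \<odot> x"
  using smult_l_distr[of c d x] by simp
lemma sc_distr: "x \<in> carrier M \<Longrightarrow> y \<in> carrier M \<Longrightarrow> c \<odot> (x \<oplus> y) = c \<odot> x \<oplus> c \<odot> y"
  using smult_r_distr[of c x y] by simp
lemma sc_sc: "x \<in> carrier M \<Longrightarrow> c \<odot> (d \<odot> x) = (c * d) \<odot> x"
  using smult_assoc1[of c d x] by simp
lemma sc_1 [simp]: "x \<in> carrier M \<Longrightarrow> 1 \<odot> x = x"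
  using smult_one[of x] by simp
lemma sc_0 [simp]: "x \<in> carrier M \<Longrightarrow> 0 \<odot> x = \<zero>"
  using smult_l_null[of x] by simp
lemma sc_zero [simp]: "c \<odot> \<zero> = \<zero>"
  using smult_r_null[of c] by simp
lemma sc_minus: "x \<in> carrier M \<Longrightarrow> c \<odot> (\<ominus> x) = \<ominus> (c \<odot> x)"
  using smult_r_minus[of c x] by simp
lemma sc_uminus: "x \<in> carrier M \<Longrightarrow> (- c) \<odot> x = \<ominus> (c \<odot> x)"
  using sc_add[of x c "- c"] minus_equality[of "(- c) \<odot> x" "c \<odot> x"] by (simp add: a_comm)

lemma minus_eq_eq: "x \<in> carrier M \<Longrightarrow> y \<in> carrier M \<Longrightarrow> z \<in> carrier M \<Longrightarrow> x \<ominus> y = z \<longleftrightarrow> x = z \<oplus> y"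
  by (auto simp: a_minus_def a_assoc l_neg r_neg)
lemma eq_minus_eq: "x \<in> carrier M \<Longrightarrow> y \<in> carrier M \<Longrightarrow> z \<in> carrier M \<Longrightarrow> z = x \<ominus> y \<longleftrightarrow> z \<oplus> y = x"
  by (auto simp: a_minus_def a_assoc l_neg r_neg)
lemma neg_eq: "x \<in> carrier M \<Longrightarrow> \<ominus> x = \<zero> \<ominus> x"
  by (simp add: a_minus_def)
lemma minus_plus: "x \<in> carrier M \<Longrightarrow> y \<in> carrier M \<Longrightarrow> z \<in> carrier M \<Longrightarrow> (x \<ominus> y) \<oplus> z = (x \<oplus> z) \<ominus> y"
  by (simp add: a_minus_def a_ac)
lemma plus_minus: "x \<in> carrier M \<Longrightarrow> y \<in> carrier M \<Longrightarrow> z \<in> carrier M \<Longrightarrow> x \<oplus> (y \<ominus> z) = (x \<oplus> y) \<ominus> z"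
  by (simp add: a_minus_def a_ac)
lemma minus_minus1: "x \<in> carrier M \<Longrightarrow> y \<in> carrier M \<Longrightarrow> z \<in> carrier M \<Longrightarrow> (x \<ominus> y) \<ominus> z = x \<ominus> (y \<oplus> z)"
  by (simp add: a_minus_def minus_add a_ac)
lemma minus_minus2: "x \<in> carrier M \<Longrightarrow> y \<in> carrier M \<Longrightarrow> z \<in> carrier M \<Longrightarrow> x \<ominus> (y \<ominus> z) = (x \<oplus> z) \<ominus> y"
  by (simp add: a_minus_def minus_add a_ac)
lemma sc_diff: "x \<in> carrier M \<Longrightarrow> y \<in> carrier M \<Longrightarrow> c \<odot> (x \<ominus> y) = c \<odot> x \<ominus> c \<odot> y"
  by (simp add: a_minus_def sc_distr sc_minus)
lemma sc_diff_l: "x \<in> carrier M \<Longrightarrow> (c - d) \<odot> x = c \<odot> x \<ominus> d \<odot> x"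
  using sc_add[of x c "- d"] by (simp add: a_minus_def sc_uminus)
lemma sc_uminus': "x \<in> carrier M \<Longrightarrow> (- c) \<odot> x = \<zero> \<ominus> c \<odot> x"
  by (simp add: a_minus_def sc_uminus)

lemmas vec_simps = minus_eq_eq eq_minus_eq minus_plus plus_minus minus_minus1 minus_minus2
  sc_diff sc_diff_l sc_distr sc_add sc_sc sc_uminus' neg_eq a_assoc a_comm a_lcomm

end

section \<open>Linear maps and the algebra of endomorphisms\<close>

definition klinear :: "('k::field, 'm) module \<Rightarrow> ('k, 'n) module \<Rightarrow> ('m \<Rightarrow> 'n) \<Rightarrow> bool" where
  "klinear M N f \<longleftrightarrow> f \<in> carrier M \<rightarrow> carrier N \<and>
     (\<forall>x \<in> carrier M. \<forall>y \<in> carrier M. f (x \<oplus>\<^bsub>M\<^esub> y) = f x \<oplus>\<^bsub>N\<^esub> f y) \<and>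
     (\<forall>c. \<forall>x \<in> carrier M. f (c \<odot>\<^bsub>M\<^esub> x) = c \<odot>\<^bsub>N\<^esub> f x)"

lemma klinearD:
  assumes "klinear M N f"
  shows "x \<in> carrier M \<Longrightarrow> f x \<in> carrier N"
    "x \<in> carrier M \<Longrightarrow> y \<in> carrier M \<Longrightarrow> f (x \<oplus>\<^bsub>M\<^esub> y) = f x \<oplus>\<^bsub>N\<^esub> f y"
    "x \<in> carrier M \<Longrightarrow> f (c \<odot>\<^bsub>M\<^esub> x) = c \<odot>\<^bsub>N\<^esub> f x"
  using assms by (auto simp: klinear_def)

lemma klinear_zero_minus:
  assumes "kspace M" "kspace N" "klinear M N f"
  shows "f \<zero>\<^bsub>M\<^esub> = \<zero>\<^bsub>N\<^esub>" "x \<in> carrier M \<Longrightarrow> f (\<ominus>\<^bsub>M\<^esub> x) = \<ominus>\<^bsub>N\<^esub> f x"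
    "x \<in> carrier M \<Longrightarrow> y \<in> carrier M \<Longrightarrow> f (x \<ominus>\<^bsub>M\<^esub> y) = f x \<ominus>\<^bsub>N\<^esub> f y"
proof -
  interpret M: kspace M by fact
  interpret N: kspace N by fact
  note d = klinearD[OF assms(3)]
  show z: "f \<zero>\<^bsub>M\<^esub> = \<zero>\<^bsub>N\<^esub>"
    using d(3)[of "\<zero>\<^bsub>M\<^esub>" 0] d(1)[of "\<zero>\<^bsub>M\<^esub>"] by simp
  show m: "x \<in> carrier M \<Longrightarrow> f (\<ominus>\<^bsub>M\<^esub> x) = \<ominus>\<^bsub>N\<^esub> f x" for x
    using d(1,3) M.sc_uminus[of x 1] N.sc_uminus[of "f x" 1] by simp metis
  show "x \<in> carrier M \<Longrightarrow> y \<in> carrier M \<Longrightarrow> f (x \<ominus>\<^bsub>M\<^esub> y) = f x \<ominus>\<^bsub>N\<^esub> f y"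
    by (simp add: a_minus_def d m)
qed

lemma (in kspace) klinear_finsum:
  assumes "kspace N" "klinear M N f" "g \<in> S \<rightarrow> carrier M"
  shows "f (finsum M g S) = finsum N (\<lambda>i. f (g i)) S"
proof -
  interpret N: kspace N by fact
  show ?thesis using assms(3)
  proof (induction S rule: infinite_finite_induct)
    case (insert i S)
    then show ?case using klinearD[OF assms(2)]
      by (subst finsum_insert) (auto simp: Pi_iff intro!: N.finsum_insert[symmetric])
  qed (simp_all add: klinear_zero_minus[OF kspace_axioms assms(1,2)])
qed

text \<open>Extensional maps make the algebra laws equalities of functions. As a target of the
  universal property this algebra turns operators into module actions.\<close>

definition end_algebra :: "('k::field, 'm) module \<Rightarrow> ('k, 'm \<Rightarrow> 'm) module" where
  "end_algebra M = \<lparr>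
     carrier = {f. klinear M M f \<and> f \<in> extensional (carrier M)},
     mult = compose (carrier M), one = (\<lambda>x \<in> carrier M. x),
     zero = (\<lambda>x \<in> carrier M. \<zero>\<^bsub>M\<^esub>), add = (\<lambda>f g. \<lambda>x \<in> carrier M. f x \<oplus>\<^bsub>M\<^esub> g x),
     smult = (\<lambda>c f. \<lambda>x \<in> carrier M. c \<odot>\<^bsub>M\<^esub> f x) \<rparr>"

context kspace
begin

lemma end_simps:
  "f \<in> carrier (end_algebra M) \<longleftrightarrow> klinear M M f \<and> f \<in> extensional (carrier M)"
  "f \<otimes>\<^bsub>end_algebra M\<^esub> g = compose (carrier M) f g" "\<one>\<^bsub>end_algebra M\<^esub> = (\<lambda>x \<in> carrier M. x)"
  "\<zero>\<^bsub>end_algebra M\<^esub> = (\<lambda>x \<in> carrier M. \<zero>)"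
  "f \<oplus>\<^bsub>end_algebra M\<^esub> g = (\<lambda>x \<in> carrier M. f x \<oplus> g x)"
  "c \<odot>\<^bsub>end_algebra M\<^esub> f = (\<lambda>x \<in> carrier M. c \<odot> f x)"
  by (simp_all add: end_algebra_def)

lemma klinear_ops:
  "klinear M M f \<Longrightarrow> klinear M M g \<Longrightarrow> klinear M M (compose (carrier M) f g)"
  "klinear M M (\<lambda>x \<in> carrier M. x)" "klinear M M (\<lambda>x \<in> carrier M. \<zero>)"
  "klinear M M f \<Longrightarrow> klinear M M g \<Longrightarrow> klinear M M (\<lambda>x \<in> carrier M. f x \<oplus> g x)"
  "klinear M M f \<Longrightarrow> klinear M M (\<lambda>x \<in> carrier M. c \<odot> f x)"
  unfolding klinear_def by (auto simp: Pi_iff compose_eq a_ac sc_distr sc_sc mult.commute)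

lemma end_k_algebra: "k_algebra (end_algebra M)"
proof -
  have ag: "abelian_group (end_algebra M)"
  proof (rule abelian_groupI)
    fix f assume f: "f \<in> carrier (end_algebra M)"
    then have "(\<lambda>x \<in> carrier M. (-1) \<odot> f x) \<in> carrier (end_algebra M)"
      by (simp add: end_simps klinear_ops)
    moreover have "(\<lambda>x \<in> carrier M. (-1) \<odot> f x) \<oplus>\<^bsub>end_algebra M\<^esub> f = \<zero>\<^bsub>end_algebra M\<^esub>"
      using f by (auto simp: end_simps klinearD sc_uminus l_neg intro!: restrict_ext)
    ultimately show "\<exists>g \<in> carrier (end_algebra M). g \<oplus>\<^bsub>end_algebra M\<^esub> f = \<zero>\<^bsub>end_algebra M\<^esub>" by blast
  qed (auto simp: end_simps klinear_ops klinearD a_ac intro!: restrict_ext extensionalityI[where A="carrier M"])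
  have r: "ring (end_algebra M)"
  proof (rule ringI)
    show "Group.monoid (end_algebra M)"
      by (rule Group.monoid.intro)
        (auto simp: end_simps klinear_ops klinearD compose_eq intro!: extensionalityI[where A="carrier M"])
  qed (use ag in \<open>auto simp: end_simps klinear_ops klinearD compose_eq intro!:
      extensionalityI[where A="carrier M"]\<close>)
  have "module class_ring (end_algebra M)"
    by (rule moduleI) (use ag class_cring in \<open>auto simp: end_simps klinear_ops klinearD sc_add sc_sc
        sc_distr intro!: extensionalityI[where A="carrier M"]\<close>)
  then show ?thesis using r
    by (auto simp: k_algebra_def end_simps klinear_ops klinearD compose_eq intro!:
        extensionalityI[where A="carrier M"])
qed

end

section \<open>Generators of the multiplicative preprojective algebra\<close>

abbreviation mpa_idem where "mpa_idem Q lt q w \<equiv> mpa_map Q lt q (path_idem w)"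
abbreviation mpa_arrow where "mpa_arrow Q lt q a \<equiv> mpa_map Q lt q (path_arrow a)"
abbreviation mpa_plus where "mpa_plus Q lt q a \<equiv> mpa_map Q lt q (one_plus Q a)"

section \<open>Induction over the path algebra and over its localised quotient\<close>

lemma path_mult_single:
  "Poly_Mapping.single p c \<otimes>\<^bsub>path_algebra G\<^esub> Poly_Mapping.single r d =
    (if path_tail G p = path_head G r then Poly_Mapping.single (path_comp p r) (c * d) else 0)"
  by (auto simp: path_algebra_def)

lemma path_smult_single: "c \<odot>\<^bsub>path_algebra G\<^esub> Poly_Mapping.single p d = Poly_Mapping.single p (c * d)"
  by (intro poly_mapping_eqI) (auto simp: path_algebra_def map.rep_eq when_def lookup_single)

lemma poly_mapping_sum_single:
  "f = (\<Sum>p \<in> Poly_Mapping.keys f. Poly_Mapping.single p (Poly_Mapping.lookup f p))"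
proof (rule poly_mapping_eqI)
  fix k
  have "(\<Sum>p\<in>Poly_Mapping.keys f. Poly_Mapping.lookup (Poly_Mapping.single p (Poly_Mapping.lookup f p)) k)
    = (\<Sum>p\<in>Poly_Mapping.keys f. if p = k then Poly_Mapping.lookup f p else 0)"
    by (rule sum.cong[OF refl]) (simp add: lookup_single when_def)
  also have "\<dots> = Poly_Mapping.lookup f k" by (simp add: sum.delta) (simp add: in_keys_iff)
  finally show "Poly_Mapping.lookup f k =
    Poly_Mapping.lookup (\<Sum>p\<in>Poly_Mapping.keys f. Poly_Mapping.single p (Poly_Mapping.lookup f p)) k"
    by (simp only: lookup_sum)
qed

text \<open>A nontrivial path is a product of arrows, and an element is a finite linear combination
  of paths; \<open>zero\<close> starts the sum over the support.\<close>

lemma path_algebra_induct [consumes 1, case_names idem arrow add mult smult zero]: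
  fixes f :: "('v, 'b) qpath \<Rightarrow>\<^sub>0 'k::field"
  assumes f: "f \<in> carrier (path_algebra G)"
    and idem: "\<And>w. w \<in> verts G \<Longrightarrow> P (Poly_Mapping.single (Trivial w) 1)"
    and arrow: "\<And>a. a \<in> arcs G \<Longrightarrow> P (Poly_Mapping.single (Walk [a]) 1)"
    and add: "\<And>f g. f \<in> carrier (path_algebra G) \<Longrightarrow> g \<in> carrier (path_algebra G) \<Longrightarrow>
      P f \<Longrightarrow> P g \<Longrightarrow> P (f \<oplus>\<^bsub>path_algebra G\<^esub> g)"
    and mult: "\<And>f g. f \<in> carrier (path_algebra G) \<Longrightarrow> g \<in> carrier (path_algebra G) \<Longrightarrow>
      P f \<Longrightarrow> P g \<Longrightarrow> P (f \<otimes>\<^bsub>path_algebra G\<^esub> g)"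
    and smult: "\<And>c f. f \<in> carrier (path_algebra G) \<Longrightarrow> P f \<Longrightarrow> P (c \<odot>\<^bsub>path_algebra G\<^esub> f)"
    and zero: "P 0"
  shows "P f"
proof -
  have walk: "P (Poly_Mapping.single (Walk as) 1)" if "Walk as \<in> qpaths G" for as
    using that
  proof (induction as)
    case (Cons a as)
    show ?case
    proof (cases as)
      case Nil
      then show ?thesis using Cons.prems by (auto simp: qpaths_def intro: arrow)
    next
      case (Cons b bs)
      have q: "Walk [a] \<in> qpaths G" "Walk as \<in> qpaths G" "tail G a = head G b"
        using Cons.prems Cons by (auto simp: qpaths_def)
      have "P (Poly_Mapping.single (Walk [a]) 1 \<otimes>\<^bsub>path_algebra G\<^esub> Poly_Mapping.single (Walk as) 1)"
        by (rule mult) (use q Cons.IH in \<open>auto intro!: path_algebra_single_closed arrow simp: qpaths_def\<close>)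
      then show ?thesis using q(3) Cons by (simp add: path_mult_single)
    qed
  qed (auto simp: qpaths_def)
  have single: "P (Poly_Mapping.single p c)" if "p \<in> qpaths G" for p c
  proof -
    have "P (Poly_Mapping.single p 1)" using that walk by (cases p) (auto simp: qpaths_def intro: idem)
    from smult[OF path_algebra_single_closed[OF that] this, of c] show ?thesis by (simp add: path_smult_single)
  qed
  have "(\<Sum>p\<in>S. Poly_Mapping.single p (Poly_Mapping.lookup f p)) \<in> carrier (path_algebra G) \<and>
      P (\<Sum>p\<in>S. Poly_Mapping.single p (Poly_Mapping.lookup f p))"
    if "finite S" "S \<subseteq> qpaths G" for S
    using that
  proof (induction S rule: finite_induct)
    case (insert p S)
    then have "P (Poly_Mapping.single p (Poly_Mapping.lookup f p) \<oplus>\<^bsub>path_algebra G\<^esub>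
        (\<Sum>p\<in>S. Poly_Mapping.single p (Poly_Mapping.lookup f p)))"
      by (intro add single path_algebra_single_closed) auto
    moreover have "(\<Sum>p\<in>insert p S. Poly_Mapping.single p (Poly_Mapping.lookup f p)) \<in> carrier (path_algebra G)"
      using insert by (intro path_algebra_sum_closed path_algebra_single_closed) auto
    ultimately show ?case using insert by (simp add: path_algebra_simps(2))
  qed (simp add: zero path_algebra_zero_closed)
  from this[of "Poly_Mapping.keys f"] f show ?thesis
    by (simp add: poly_mapping_sum_single[symmetric] path_algebra_simps(1))
qed

context mpa_ctx
begin

text \<open>The elements of the free algebra whose class satisfies the predicate contain the
  generators and are closed under sums, products and scalars. The unit has no case of its own: it is
  the class of the unit of the path algebra.\<close>

lemma mpa_induct [consumes 1, case_names map inv add mult smult]: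
  assumes r: "r \<in> carrier (mpa Q lt q)"
    and map: "\<And>f. f \<in> carrier P \<Longrightarrow> \<Phi> (mpa_map Q lt q f)"
    and inv: "\<And>a. a \<in> arcs (double Q) \<Longrightarrow> \<Phi> (inv\<^bsub>mpa Q lt q\<^esub> (mpa_plus Q lt q a))"
    and add: "\<And>r s. r \<in> carrier (mpa Q lt q) \<Longrightarrow> s \<in> carrier (mpa Q lt q) \<Longrightarrow> \<Phi> r \<Longrightarrow> \<Phi> s \<Longrightarrow> \<Phi> (r \<oplus>\<^bsub>mpa Q lt q\<^esub> s)"
    and mult: "\<And>r s. r \<in> carrier (mpa Q lt q) \<Longrightarrow> s \<in> carrier (mpa Q lt q) \<Longrightarrow> \<Phi> r \<Longrightarrow> \<Phi> s \<Longrightarrow> \<Phi> (r \<otimes>\<^bsub>mpa Q lt q\<^esub> s)"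
    and smult: "\<And>c r. r \<in> carrier (mpa Q lt q) \<Longrightarrow> \<Phi> r \<Longrightarrow> \<Phi> (c \<odot>\<^bsub>mpa Q lt q\<^esub> r)"
  shows "\<Phi> r"
proof -
  define S where "S = {f \<in> carrier A. \<Phi> (qu.pr f)}"
  have c: "qu.pr f \<in> carrier (mpa Q lt q)" if "f \<in> carrier A" for f using that unfolding mpa_eq qu.carrB
      by blast
  have Sadd: "f + g \<in> S" if "f \<in> S" "g \<in> S" for f g
  proof -
    have "qu.pr (f + g) = qu.pr f \<oplus>\<^bsub>mpa Q lt q\<^esub> qu.pr g" using that qu.pr_simps(1)[of f g] by
        (simp add: S_def mpa_eq A_simps(2-5))
    then show ?thesis using that add[of "qu.pr f" "qu.pr g"] c by (auto simp: S_def c_add)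
  qed
  have Smult: "f * g \<in> S" if "f \<in> S" "g \<in> S" for f g
  proof -
    have "qu.pr (f * g) = qu.pr f \<otimes>\<^bsub>mpa Q lt q\<^esub> qu.pr g" using that qu.pr_simps(2)[of f g] by
        (simp add: S_def mpa_eq A_simps(2-5))
    then show ?thesis using that mult[of "qu.pr f" "qu.pr g"] c by (auto simp: S_def c_mult)
  qed
  have "\<Phi> (mpa_map Q lt q \<one>\<^bsub>P\<^esub>)" by (rule map[OF path_algebra_one_closed])
  then have one: "1 \<in> S" by (simp add: S_def c_1 map_eq rel_one)
  have sc: "Poly_Mapping.single 0 d \<in> S" for d
  proof -
    have "qu.pr (Poly_Mapping.single 0 d) = d \<odot>\<^bsub>mpa Q lt q\<^esub> qu.pr 1"
      unfolding mpa_eq using qu.pr_smult[of 1 d] by (simp add: A_simps(6) c_1)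
    then show ?thesis using one smult[of "qu.pr 1" d] c by (simp add: S_def c_k c_1)
  qed
  have gx: "xx f \<in> S" if "f \<in> carrier P" for f using that map[OF that] by (simp add: S_def xc map_eq)
  have gy: "yy a \<in> S" if a: "a \<in> arcs (double Q)" for a
    using inv[OF a] inv_map(2)[OF a] yc[OF a] by (simp add: S_def)
  have g: "free_gen t \<in> S" if "t \<in> mpa_gens Q" for t using that gx gy by (auto simp: mpa_gens_def)
  have w: "Poly_Mapping.single w d \<in> S" if "set (letters w) \<subseteq> mpa_gens Q" for w d
  proof -
    have "prod_list (map free_gen ts) \<in> S" if "set ts \<subseteq> mpa_gens Q" for ts
      using that by (induction ts) (auto intro: one Smult g)
    then show ?thesis using word_prod[of "letters w" d] sc Smult that by simp
  qed
  have "f \<in> S" if f: "f \<in> carrier A" for f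
  proof -
    have fw: "set (letters v) \<subseteq> mpa_gens Q" if "v \<in> Poly_Mapping.keys f" for v
      using f that unfolding A_simps(1) by blast
    have "(\<Sum>v\<in>W. Poly_Mapping.single v (Poly_Mapping.lookup f v)) \<in> S"
      if "finite W" "W \<subseteq> Poly_Mapping.keys f" for W
      using that
    proof (induction W rule: finite_induct)
      case empty show ?case using sc[of 0] by simp
    next
      case (insert v W)
      have "Poly_Mapping.single v (Poly_Mapping.lookup f v) \<in> S" by (rule w, rule fw) (use insert in blast)
      then show ?case unfolding sum.insert[OF insert(1,2)] by (rule Sadd) (use insert in blast)
    qed
    from this[of "Poly_Mapping.keys f"] show ?thesis by (simp add: poly_mapping_sum_single[symmetric])
  qed
  with r show ?thesis unfolding mpa_eq qu.carrB by (auto simp: S_def)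
qed

end

section \<open>Ordered doubles and families of operators\<close>

locale ordered_quiver =
  fixes Q :: "('v, 'a) pre_digraph" and lt :: "'a darrow rel"
  assumes fd: "fin_digraph Q" and lin: "strict_linear_order_on (arcs (double Q)) lt"
begin

abbreviation "D \<equiv> arcs (double Q)"
abbreviation "hh \<equiv> head (double Q)"
abbreviation "tt \<equiv> tail (double Q)"
abbreviation "al \<equiv> arrow_list Q lt"

lemma star_star [simp]: "star (star a) = a" by (cases a) auto
lemma star_D [simp]: "star a \<in> D \<longleftrightarrow> a \<in> D" by (cases a) (auto simp: double_def)
lemma ends_star [simp]: "hh (star a) = tt a" "tt (star a) = hh a" by (cases a; simp add: double_def)+
lemma eps_star [simp]: "eps (star a) = - eps a" by (cases a) auto
lemma eps_cases: "eps a = 1 \<or> eps a = -1" by (cases a) auto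
lemma verts_double [simp]: "verts (double Q) = verts Q" by (simp add: double_def)
lemma finite_verts [simp]: "finite (verts Q)" using fd by (simp add: fin_digraph_def fin_digraph_axioms_def)
lemma ends_verts [simp]: assumes "a \<in> D" shows "hh a \<in> verts Q" "tt a \<in> verts Q"
proof -
  interpret fin_digraph "double Q" by (rule fin_digraph_double[OF fd])
  show "hh a \<in> verts Q" "tt a \<in> verts Q" using assms head_in_verts tail_in_verts by auto
qed
lemmas al_set [simp] = arrow_list_sorted(1)[OF fd lin]
lemmas al_sorted = arrow_list_sorted(2)[OF fd lin]
lemma lt_irrefl: "(a, a) \<notin> lt" using lin by (auto simp: strict_linear_order_on_def irrefl_def)
lemma lt_asym: "(a, b) \<in> lt \<Longrightarrow> (b, a) \<notin> lt"
  using lin by (auto simp: strict_linear_order_on_def irrefl_def trans_def)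

end

text \<open>The operators \<open>E w\<close>, \<open>T a\<close> and \<open>G a\<close> stand for the actions of \<open>e\<^sub>w\<close>, of \<open>a\<close> and of
  \<open>(1 + a a*)\<close> to the power \<open>eps a\<close>.\<close>

locale qrep = ordered_quiver Q lt + kspace M
  for Q :: "('v, 'a) pre_digraph" and lt and q :: "'v \<Rightarrow> 'k::field" and M :: "('k, 'm) module" (structure) +
  fixes E :: "'v \<Rightarrow> 'm \<Rightarrow> 'm" and T G :: "'a darrow \<Rightarrow> 'm \<Rightarrow> 'm"
  assumes E_lin: "w \<in> verts Q \<Longrightarrow> klinear M M (E w)"
    and T_lin: "a \<in> D \<Longrightarrow> klinear M M (T a)"
    and G_lin: "a \<in> D \<Longrightarrow> klinear M M (G a)"
    and E_E: "w \<in> verts Q \<Longrightarrow> u \<in> verts Q \<Longrightarrow> x \<in> carrier M \<Longrightarrow> E w (E u x) = (if w = u then E u x else \<zero>)"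
    and E_faithful: "x \<in> carrier M \<Longrightarrow> (\<And>w. w \<in> verts Q \<Longrightarrow> E w x = \<zero>) \<Longrightarrow> x = \<zero>"
    and E_T: "a \<in> D \<Longrightarrow> x \<in> carrier M \<Longrightarrow> E (hh a) (T a x) = T a x"
    and T_E: "a \<in> D \<Longrightarrow> x \<in> carrier M \<Longrightarrow> T a (E (tt a) x) = T a x"
    and G_pos: "a \<in> D \<Longrightarrow> eps a = 1 \<Longrightarrow> x \<in> carrier M \<Longrightarrow> G a x = x \<oplus> T a (T (star a) x)"
    and G_neg_l: "a \<in> D \<Longrightarrow> eps a = -1 \<Longrightarrow> x \<in> carrier M \<Longrightarrow> G a (x \<oplus> T a (T (star a) x)) = x"
    and G_neg_r: "a \<in> D \<Longrightarrow> eps a = -1 \<Longrightarrow> x \<in> carrier M \<Longrightarrow> G a x \<oplus> T a (T (star a) (G a x)) = x"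
    and G_prod: "w \<in> verts Q \<Longrightarrow> x \<in> carrier M \<Longrightarrow> foldr G al (E w x) = q w \<odot> E w x"

text \<open>The factor of \<open>a\<close> in the defining product, written without integer powers;
  it acts on a module as \<open>G a\<close>.\<close>

definition mpa_factor where
  "mpa_factor Q lt q a = (if eps a = 1 then mpa_plus Q lt q a else inv\<^bsub>mpa Q lt q\<^esub> (mpa_plus Q lt q a))"

lemma path_idem_mult:
  "path_idem w \<otimes>\<^bsub>path_algebra (double Q)\<^esub> path_idem u =
      (if w = u then path_idem u else (0 :: ('v,'a,'k::field) path_elem))"
  "path_idem (head (double Q) a) \<otimes>\<^bsub>path_algebra (double Q)\<^esub> path_arrow a =
      (path_arrow a :: ('v,'a,'k::field) path_elem)"
  "path_arrow a \<otimes>\<^bsub>path_algebra (double Q)\<^esub> path_idem (tail (double Q) a) =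
      (path_arrow a :: ('v,'a,'k::field) path_elem)"
  by (simp_all add: path_idem_def path_arrow_def path_mult_single)

lemma path_idem_closed: "w \<in> verts Q \<Longrightarrow> path_idem w \<in> carrier (path_algebra (double Q))"
  and path_arrow_closed: "a \<in> arcs (double Q) \<Longrightarrow> path_arrow a \<in> carrier (path_algebra (double Q))"
  unfolding path_idem_def path_arrow_def by (auto intro!: path_algebra_single_closed simp: qpaths_def
      double_def)

section \<open>From modules to families of operators\<close>

locale mpa_module = ordered_quiver Q lt + left_module "mpa Q lt q" X
  for Q :: "('v, 'a) pre_digraph" and lt and q :: "'v \<Rightarrow> 'k::field" and X :: "('v, 'a, 'k, 'm) mpa_rep"
begin

abbreviation "L \<equiv> mpa Q lt q"
abbreviation "\<mu> \<equiv> mpa_map Q lt q"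
abbreviation "P \<equiv> path_algebra (double Q) :: ('k, _) module"
abbreviation "U \<equiv> underlying_space L X"

lemma ctx: "mpa_ctx Q lt" using fd lin by (rule mpa_ctx.intro)

lemmas mpa_alg = mpa_ctx.mpa_k_algebra[OF ctx, of q]
lemmas Lsm = k_algebra_smult[OF mpa_alg] k_algebraD(3,4)[OF mpa_alg]
lemma mu_hom: "\<mu> \<in> k_algebra_hom P L" using mpa_ctx.map_hom[OF ctx] .
lemma mu_rhom: "\<mu> \<in> Ring.ring_hom P L" using mu_hom by (simp add: k_algebra_hom_def)
lemma mu_smult: "f \<in> carrier P \<Longrightarrow> \<mu> (c \<odot>\<^bsub>P\<^esub> f) = c \<odot>\<^bsub>L\<^esub> \<mu> f" using mu_hom by (simp add: k_algebra_hom_def)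
lemmas mu_closed = ring_hom_closed[OF mu_rhom]
lemmas mu_add = ring_hom_add[OF mu_rhom]
lemmas mu_mult = ring_hom_mult[OF mu_rhom]
lemmas mu_one = ring_hom_one[OF mu_rhom]
lemma mu_zero: "\<mu> 0 = \<zero>\<^bsub>L\<^esub>"
proof -
  have "\<mu> 0 \<oplus>\<^bsub>L\<^esub> \<mu> 0 = \<mu> 0" using mu_add[of 0 0] by (simp add: path_algebra_simps)
  then show ?thesis using mu_closed[OF path_algebra_zero_closed] R.add.r_cancel_one by blast
qed

lemma U_simps [simp]:
  "carrier U = carrier X" "add U = add X" "zero U = zero X" "c \<odot>\<^bsub>U\<^esub> x = (c \<odot>\<^bsub>L\<^esub> \<one>\<^bsub>L\<^esub>) \<odot>\<^bsub>X\<^esub> x"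
  by (simp_all add: underlying_space_def)

lemma U_minus [simp]: "a_inv U = a_inv X" "a_minus U = a_minus X"
  by (simp_all add: fun_eq_iff a_inv_def a_minus_def m_inv_def)

lemma L_zero: "x \<in> carrier X \<Longrightarrow> \<zero>\<^bsub>L\<^esub> \<odot>\<^bsub>X\<^esub> x = \<zero>\<^bsub>X\<^esub>"
proof -
  assume x: "x \<in> carrier X"
  have "\<zero>\<^bsub>L\<^esub> \<odot>\<^bsub>X\<^esub> x \<oplus>\<^bsub>X\<^esub> \<zero>\<^bsub>L\<^esub> \<odot>\<^bsub>X\<^esub> x = \<zero>\<^bsub>L\<^esub> \<odot>\<^bsub>X\<^esub> x" using smult_l_distr[of "\<zero>\<^bsub>L\<^esub>" "\<zero>\<^bsub>L\<^esub>" x] x by simp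
  then show ?thesis using smult_closed[of "\<zero>\<^bsub>L\<^esub>" x] x M.add.r_cancel_one by simp
qed

lemma sc_l: "r \<in> carrier L \<Longrightarrow> x \<in> carrier X \<Longrightarrow> (c \<odot>\<^bsub>L\<^esub> r) \<odot>\<^bsub>X\<^esub> x = (c \<odot>\<^bsub>L\<^esub> \<one>\<^bsub>L\<^esub>) \<odot>\<^bsub>X\<^esub> (r \<odot>\<^bsub>X\<^esub> x)"
  using smult_assoc1[of "c \<odot>\<^bsub>L\<^esub> \<one>\<^bsub>L\<^esub>" r x] Lsm(6)[of "\<one>\<^bsub>L\<^esub>" r c] Lsm(1)[of "\<one>\<^bsub>L\<^esub>" c] by simp
lemma sc_r: "r \<in> carrier L \<Longrightarrow> x \<in> carrier X \<Longrightarrow> r \<odot>\<^bsub>X\<^esub> ((c \<odot>\<^bsub>L\<^esub> \<one>\<^bsub>L\<^esub>) \<odot>\<^bsub>X\<^esub> x) = (c \<odot>\<^bsub>L\<^esub> \<one>\<^bsub>L\<^esub>) \<odot>\<^bsub>X\<^esub> (r \<odot>\<^bsub>X\<^esub> x)"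
  using smult_assoc1[of r "c \<odot>\<^bsub>L\<^esub> \<one>\<^bsub>L\<^esub>" x] Lsm(7)[of r "\<one>\<^bsub>L\<^esub>" c] Lsm(1)[of "\<one>\<^bsub>L\<^esub>" c] sc_l by simp

lemma kspace_U: "kspace U"
proof -
  have "module class_ring U"
  proof (rule moduleI)
    show "abelian_group U"
    proof (rule abelian_groupI)
      show "\<exists>y\<in>carrier U. y \<oplus>\<^bsub>U\<^esub> x = \<zero>\<^bsub>U\<^esub>" if "x \<in> carrier U" for x
        using that by (intro bexI[of _ "\<ominus>\<^bsub>X\<^esub> x"]) (simp_all add: l_neg)
    qed (simp_all add: M.a_ac)
  qed (auto simp: class_cring smult_closed Lsm smult_l_distr smult_r_distr smult_one sc_l[of "_ \<odot>\<^bsub>L\<^esub> \<one>\<^bsub>L\<^esub>"])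
  then show ?thesis by (rule kspace.intro)
qed

lemma r_lin: "r \<in> carrier L \<Longrightarrow> klinear U U (\<lambda>x. r \<odot>\<^bsub>X\<^esub> x)"
  by (auto simp: klinear_def smult_closed smult_r_distr sc_r)

lemma factor_closed: "a \<in> D \<Longrightarrow> mpa_factor Q lt q a \<in> carrier L"
  using mpa_ctx.inv_map(1)[OF ctx, of a q] by (auto simp: mpa_factor_def)

lemma idem_closed: "w \<in> verts Q \<Longrightarrow> mpa_idem Q lt q w \<in> carrier L"
  and arrow_closed: "a \<in> D \<Longrightarrow> mpa_arrow Q lt q a \<in> carrier L"
  by (auto intro!: mu_closed path_idem_closed path_arrow_closed)

lemma idem_act: "w \<in> verts Q \<Longrightarrow> u \<in> verts Q \<Longrightarrow> x \<in> carrier X \<Longrightarrow>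
  mpa_idem Q lt q w \<odot>\<^bsub>X\<^esub> (mpa_idem Q lt q u \<odot>\<^bsub>X\<^esub> x) = (if w = u then mpa_idem Q lt q u \<odot>\<^bsub>X\<^esub> x else \<zero>\<^bsub>X\<^esub>)"
  using mu_mult[of "path_idem w" "path_idem u", symmetric]
  by (auto simp: path_idem_closed smult_assoc1[symmetric] idem_closed path_idem_mult mu_zero L_zero simp
      del: R.l_null R.r_null)

lemma plus_closed: "a \<in> D \<Longrightarrow> mpa_plus Q lt q a \<in> carrier L"
  using mpa_ctx.inv_map(1)[OF ctx, of a q] by auto

lemma plus_act: "a \<in> D \<Longrightarrow> x \<in> carrier X \<Longrightarrow>
  mpa_plus Q lt q a \<odot>\<^bsub>X\<^esub> x = x \<oplus>\<^bsub>X\<^esub> mpa_arrow Q lt q a \<odot>\<^bsub>X\<^esub> (mpa_arrow Q lt q (star a) \<odot>\<^bsub>X\<^esub> x)"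
  by (simp add: one_plus_def mu_add mu_mult mu_one path_algebra_one_closed path_algebra_mult_closed
      path_arrow_closed
      smult_l_distr smult_assoc1 smult_one arrow_closed)

lemma qrep_of_module:
  "qrep Q lt q U (\<lambda>w x. mpa_idem Q lt q w \<odot>\<^bsub>X\<^esub> x) (\<lambda>a x. mpa_arrow Q lt q a \<odot>\<^bsub>X\<^esub> x)
    (\<lambda>a x. mpa_factor Q lt q a \<odot>\<^bsub>X\<^esub> x)"
proof -
  interpret K: kspace U by (rule kspace_U)
  note un = mpa_ctx.inv_map(1)[OF ctx, of _ q]
  show ?thesis
  proof (unfold_locales, goal_cases)
    case (1 w) then show ?case by (simp add: r_lin idem_closed)
  next
    case (2 a) then show ?case by (simp add: r_lin arrow_closed)
  next
    case (3 a) then show ?case by (simp add: r_lin factor_closed)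
  next
    case (4 w u x)
    then show ?case by (simp add: idem_act)
  next
    case (5 x)
    \<comment> \<open>The unit is the sum of the idempotents, so this sum both kills
      \<open>x\<close> and fixes it. Partial sums serve the induction.\<close>
    have e0: "mpa_idem Q lt q w \<odot>\<^bsub>X\<^esub> x = \<zero>\<^bsub>X\<^esub>" if "w \<in> verts Q" for w using 5(2)[OF that] by simp
    have "\<mu> (\<Sum>w\<in>S. Poly_Mapping.single (Trivial w) 1) \<odot>\<^bsub>X\<^esub> x = \<zero>\<^bsub>X\<^esub>" if "finite S" "S \<subseteq> verts Q" for S
      using that
    proof (induction S rule: finite_induct)
      case (insert w S)
      have "(\<Sum>w\<in>S. Poly_Mapping.single (Trivial w) 1) \<in> carrier P"
        using insert by (intro path_algebra_sum_closed path_algebra_single_closed) (auto simp: qpaths_def)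
      moreover from this have "\<mu> (\<Sum>w\<in>insert w S. Poly_Mapping.single (Trivial w) 1) =
          mpa_idem Q lt q w \<oplus>\<^bsub>L\<^esub> \<mu> (\<Sum>w\<in>S. Poly_Mapping.single (Trivial w) 1)"
        using insert path_idem_closed[of w Q] mu_add[of "path_idem w" "\<Sum>w\<in>S. Poly_Mapping.single (Trivial w) 1"]
        by (simp add: path_algebra_simps(2) path_idem_def)
      ultimately show ?case using insert 5(1) e0 by (simp add: smult_l_distr idem_closed mu_closed)
    qed (use 5(1) in \<open>simp add: mu_zero L_zero\<close>)
    from this[of "verts Q"] have "\<mu> \<one>\<^bsub>P\<^esub> \<odot>\<^bsub>X\<^esub> x = \<zero>\<^bsub>X\<^esub>" by (simp add: path_algebra_simps)
    then show ?case using 5 by (simp add: mu_one smult_one)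
  next
    case (6 a x)
    then show ?case using mu_mult[of "path_idem (hh a)" "path_arrow a"]
      by (simp add: path_idem_closed path_arrow_closed smult_assoc1[symmetric] idem_closed arrow_closed
          path_idem_mult)
  next
    case (7 a x)
    then show ?case using mu_mult[of "path_arrow a" "path_idem (tt a)"]
      by (simp add: path_idem_closed path_arrow_closed smult_assoc1[symmetric] idem_closed arrow_closed
          path_idem_mult)
  next
    case (8 a x) then show ?case by (simp add: mpa_factor_def plus_act)
  next
    case (9 a x)
    then show ?case using un[of a] smult_assoc1[of "mpa_factor Q lt q a" "mpa_plus Q lt q a" x]
      by (simp add: factor_closed plus_act[symmetric] smult_one plus_closed R.Units_l_inv mpa_factor_def)
  next
    case (10 a x)
    then show ?case using un[of a] smult_assoc1[of "mpa_plus Q lt q a" "mpa_factor Q lt q a" x]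
      by (simp add: factor_closed plus_act[symmetric] smult_one smult_closed plus_closed R.Units_r_inv
          mpa_factor_def)
  next
    case (11 w x)
    let ?y = "mpa_idem Q lt q w \<odot>\<^bsub>X\<^esub> x"
    have y: "?y \<in> carrier X" using 11 by (simp add: idem_closed smult_closed)
    have "foldr (\<lambda>a x. (mpa_plus Q lt q a [^]\<^bsub>L\<^esub> eps a) \<otimes>\<^bsub>L\<^esub> x) as \<one>\<^bsub>L\<^esub> \<in> carrier L \<and>
        foldr (\<lambda>a x. (mpa_plus Q lt q a [^]\<^bsub>L\<^esub> eps a) \<otimes>\<^bsub>L\<^esub> x) as \<one>\<^bsub>L\<^esub> \<odot>\<^bsub>X\<^esub> ?y
        = foldr (\<lambda>a x. mpa_factor Q lt q a \<odot>\<^bsub>X\<^esub> x) as ?y" if "set as \<subseteq> D" for as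
      using that
    proof (induction as)
      case (Cons a as)
      have "mpa_plus Q lt q a [^]\<^bsub>L\<^esub> eps a = mpa_factor Q lt q a"
        using Cons by (simp add: mpa_factor_def mpa_ctx.eps_pow[OF ctx R.ring_axioms] plus_closed)
      then show ?case using Cons y by (simp add: smult_assoc1 factor_closed)
    qed (simp add: y smult_one)
    from this[of al] have 1: "foldr (\<lambda>a x. mpa_factor Q lt q a \<odot>\<^bsub>X\<^esub> x) al ?y = \<mu> (weight_elem Q q) \<odot>\<^bsub>X\<^esub> ?y"
      using mpa_ctx.mpa_cond[OF ctx, of q] by (simp add: mpa_condition_def)
    \<comment> \<open>By orthogonality only the summand at \<open>w\<close> of the weight element
      survives on the space at \<open>w\<close>.\<close>
    have "\<mu> (\<Sum>u\<in>S. Poly_Mapping.single (Trivial u) (q u)) \<odot>\<^bsub>X\<^esub> ?y = (if w \<in> S then q w \<odot>\<^bsub>U\<^esub> ?y else \<zero>\<^bsub>X\<^esub>)"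
      if "finite S" "S \<subseteq> verts Q" for S
      using that
    proof (induction S rule: finite_induct)
      case (insert u S)
      let ?s = "\<Sum>u\<in>S. Poly_Mapping.single (Trivial u) (q u)"
      have s: "?s \<in> carrier P" "Poly_Mapping.single (Trivial u) (q u) \<in> carrier P"
        using insert by (auto intro!: path_algebra_sum_closed path_algebra_single_closed simp: qpaths_def)
      have e: "Poly_Mapping.single (Trivial u) (q u) = q u \<odot>\<^bsub>P\<^esub> path_idem u"
        by (simp add: path_idem_def path_smult_single)
      have "\<mu> (\<Sum>u\<in>insert u S. Poly_Mapping.single (Trivial u) (q u)) = q u \<odot>\<^bsub>L\<^esub> mpa_idem Q lt q u \<oplus>\<^bsub>L\<^esub> \<mu> ?s"
        using insert s mu_add[OF s(2,1)]
        by (simp add: path_algebra_simps(2) e mu_smult path_idem_closed)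
      moreover have "mpa_idem Q lt q u \<odot>\<^bsub>X\<^esub> ?y = (if u = w then ?y else \<zero>\<^bsub>X\<^esub>)"
        using insert 11 by (auto simp: idem_act)
      ultimately show ?case using insert y s
        by (auto simp: smult_l_distr mu_closed idem_closed Lsm(1) sc_l[of "mpa_idem Q lt q _"] smult_closed
            K.sc_zero[simplified])
    qed (simp add: mu_zero L_zero y)
    from this[of "verts Q"] 11 1 show ?case by (simp add: weight_elem_def)
  qed
qed

end

text \<open>A linear map that commutes with idempotents and arrows commutes with the whole path
  algebra, hence with each 1 + a a' and with its inverse. All later homomorphisms are checked in
  this way.\<close>

lemma mpa_hom_criterion:
  assumes X: "mpa_module Q lt (q :: 'v \<Rightarrow> 'k::field) (X :: ('v, 'a, 'k, 'm) mpa_rep)"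
    and Z: "mpa_module Q lt q (Z :: ('v, 'a, 'k, 'n) mpa_rep)"
    and f: "klinear (underlying_space (mpa Q lt q) X) (underlying_space (mpa Q lt q) Z) f"
    and f_idem: "\<And>w x. w \<in> verts Q \<Longrightarrow> x \<in> carrier X \<Longrightarrow> f (mpa_idem Q lt q w \<odot>\<^bsub>X\<^esub> x) = mpa_idem Q lt q w \<odot>\<^bsub>Z\<^esub> f x"
    and f_arrow: "\<And>a x. a \<in> arcs (double Q) \<Longrightarrow> x \<in> carrier X \<Longrightarrow> f (mpa_arrow Q lt q a \<odot>\<^bsub>X\<^esub> x) =
        mpa_arrow Q lt q a \<odot>\<^bsub>Z\<^esub> f x"
    and r: "r \<in> carrier (mpa Q lt q)" and x: "x \<in> carrier X"
  shows "f (r \<odot>\<^bsub>X\<^esub> x) = r \<odot>\<^bsub>Z\<^esub> f x"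
proof -
  interpret X: mpa_module Q lt q X by fact
  interpret Z: mpa_module Q lt q Z by fact
  note fd = klinearD[OF f, simplified]
  let ?\<Phi> = "\<lambda>r. \<forall>x \<in> carrier X. f (r \<odot>\<^bsub>X\<^esub> x) = r \<odot>\<^bsub>Z\<^esub> f x"
  have f0: "f \<zero>\<^bsub>X\<^esub> = \<zero>\<^bsub>Z\<^esub>" using klinear_zero_minus(1)[OF X.kspace_U Z.kspace_U f] by simp
  have madd: "?\<Phi> (r \<oplus>\<^bsub>X.L\<^esub> s)" if "r \<in> carrier X.L" "s \<in> carrier X.L" "?\<Phi> r" "?\<Phi> s" for r s
    using that fd by (simp add: X.smult_l_distr Z.smult_l_distr X.smult_closed)
  have mmult: "?\<Phi> (r \<otimes>\<^bsub>X.L\<^esub> s)" if "r \<in> carrier X.L" "s \<in> carrier X.L" "?\<Phi> r" "?\<Phi> s" for r s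
    using that fd by (simp add: X.smult_assoc1 Z.smult_assoc1 X.smult_closed)
  have msm: "?\<Phi> (c \<odot>\<^bsub>X.L\<^esub> r)" if "r \<in> carrier X.L" "?\<Phi> r" for c r
    using that fd by (simp add: X.sc_l[of r] Z.sc_l[of r] X.smult_closed)
  have map: "?\<Phi> (X.\<mu> g)" if "g \<in> carrier X.P" for g
    using that
  proof (induction g rule: path_algebra_induct)
    case (idem w) then show ?case using f_idem by (simp add: path_idem_def)
  next
    case (arrow a) then show ?case using f_arrow by (simp add: path_arrow_def)
  next
    case (add g h) then show ?case using madd[of "X.\<mu> g" "X.\<mu> h"] by (simp add: X.mu_add X.mu_closed)
  next
    case (mult g h) then show ?case using mmult[of "X.\<mu> g" "X.\<mu> h"] by (simp add: X.mu_mult X.mu_closed)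
  next
    case (smult c g) then show ?case using msm[of "X.\<mu> g" c] by (simp add: X.mu_smult X.mu_closed)
  next
    case zero then show ?case using fd f0 by (simp add: X.mu_zero X.L_zero Z.L_zero)
  qed
  interpret C: mpa_ctx Q lt q by (rule X.ctx)
  have "?\<Phi> r"
    using r
  proof (induction r rule: C.mpa_induct)
    case (inv a)
    let ?u = "mpa_plus Q lt q a"
    have u: "?u \<in> Units X.L" using mpa_ctx.inv_map(1)[OF X.ctx inv] .
    have uc: "?u \<in> carrier X.L" "inv\<^bsub>X.L\<^esub> ?u \<in> carrier X.L" using u by auto
    show ?case
    proof
      fix x assume x: "x \<in> carrier X"
      have y: "inv\<^bsub>X.L\<^esub> ?u \<odot>\<^bsub>X\<^esub> x \<in> carrier X" using x uc by (simp add: X.smult_closed)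
      \<comment> \<open>Write \<open>x\<close> as u applied to its preimage, pull \<open>f\<close>
        through u, and then cancel u on the other side.\<close>
      have "f x = f ((?u \<otimes>\<^bsub>X.L\<^esub> inv\<^bsub>X.L\<^esub> ?u) \<odot>\<^bsub>X\<^esub> x)" using u x by (simp add: X.R.Units_r_inv X.smult_one)
      also have "\<dots> = ?u \<odot>\<^bsub>Z\<^esub> f (inv\<^bsub>X.L\<^esub> ?u \<odot>\<^bsub>X\<^esub> x)"
        using map[OF path_algebra_one_plus_closed[OF inv]] x y uc by (simp add: X.smult_assoc1)
      finally have "inv\<^bsub>X.L\<^esub> ?u \<odot>\<^bsub>Z\<^esub> f x = (inv\<^bsub>X.L\<^esub> ?u \<otimes>\<^bsub>X.L\<^esub> ?u) \<odot>\<^bsub>Z\<^esub> f (inv\<^bsub>X.L\<^esub> ?u \<odot>\<^bsub>X\<^esub> x)"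
        using uc y fd by (simp add: Z.smult_assoc1)
      then show "f (inv\<^bsub>X.L\<^esub> ?u \<odot>\<^bsub>X\<^esub> x) = inv\<^bsub>X.L\<^esub> ?u \<odot>\<^bsub>Z\<^esub> f x"
        using u y fd by (simp add: X.R.Units_l_inv Z.smult_one)
    qed
  qed (auto intro!: map[rule_format] madd[rule_format] mmult[rule_format] msm[rule_format])
  with x show ?thesis by blast
qed

section \<open>Modules from operators\<close>

context qrep
begin

lemmas E_closed [simp] = klinearD(1)[OF E_lin] and T_closed [simp] = klinearD(1)[OF T_lin]
  and G_closed [simp] = klinearD(1)[OF G_lin]
lemmas E_add = klinearD(2)[OF E_lin] and T_add = klinearD(2)[OF T_lin] and G_add = klinearD(2)[OF G_lin]
lemmas E_sc = klinearD(3)[OF E_lin] and T_sc = klinearD(3)[OF T_lin] and G_sc = klinearD(3)[OF G_lin]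
lemmas E_zero = klinear_zero_minus(1)[OF kspace_axioms kspace_axioms E_lin]
  and T_zero = klinear_zero_minus(1)[OF kspace_axioms kspace_axioms T_lin]
  and G_zero = klinear_zero_minus(1)[OF kspace_axioms kspace_axioms G_lin]
lemmas E_minus = klinear_zero_minus(3)[OF kspace_axioms kspace_axioms E_lin]
  and T_minus = klinear_zero_minus(3)[OF kspace_axioms kspace_axioms T_lin]
  and G_minus = klinear_zero_minus(3)[OF kspace_axioms kspace_axioms G_lin]
lemmas lin_simps = E_add T_add G_add E_sc T_sc G_sc E_zero T_zero G_zero E_minus T_minus G_minus

lemma faithful_eq: "x \<in> carrier M \<Longrightarrow> y \<in> carrier M \<Longrightarrow> (\<And>w. w \<in> verts Q \<Longrightarrow> E w x = E w y) \<Longrightarrow> x = y"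
  using E_faithful[of "x \<ominus> y"] by (simp add: lin_simps minus_eq_eq)

text \<open>Completeness of the idempotents, which the locale states as faithfulness: both sides
  have the same components.\<close>

lemma E_sum: "x \<in> carrier M \<Longrightarrow> finsum M (\<lambda>w. E w x) (verts Q) = x"
proof (rule faithful_eq)
  fix u assume x: "x \<in> carrier M" and u: "u \<in> verts Q"
  have "E u (finsum M (\<lambda>w. E w x) (verts Q)) = finsum M (\<lambda>w. E u (E w x)) (verts Q)"
    by (rule klinear_finsum[OF kspace_axioms E_lin[OF u]]) (use x in auto)
  also have "\<dots> = finsum M (\<lambda>w. if u = w then E w x else \<zero>) (verts Q)"
    by (rule finsum_cong') (use x u in \<open>auto simp: E_E\<close>)
  also have "\<dots> = E u x" using x u by (intro finsum_singleton) auto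
  finally show "E u (finsum M (\<lambda>w. E w x) (verts Q)) = E u x" .
qed (use finsum_closed in auto)

section \<open>Evaluation of the path algebra on the operators\<close>

fun path_op :: "('v, 'a darrow) qpath \<Rightarrow> 'm \<Rightarrow> 'm" where
  "path_op (Trivial w) = E w"
| "path_op (Walk as) = foldr T as"

lemma foldr_T_lin: "set as \<subseteq> D \<Longrightarrow> klinear M M (foldr T as)"
  by (induction as) (auto simp: klinear_def lin_simps Pi_iff)

lemma path_op_lin: "p \<in> qpaths (double Q) \<Longrightarrow> klinear M M (path_op p)"
  by (cases p) (auto simp: qpaths_def E_lin foldr_T_lin)

lemma path_op_ends:
  assumes p: "p \<in> qpaths (double Q)" and x: "x \<in> carrier M"
  shows "E (path_head (double Q) p) (path_op p x) = path_op p x"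
    "path_op p (E (path_tail (double Q) p) x) = path_op p x"
    "path_head (double Q) p \<in> verts Q" "path_tail (double Q) p \<in> verts Q"
proof -
  consider w where "p = Trivial w" "w \<in> verts Q"
    | a as bs b where "p = Walk (a # as)" "a # as = bs @ [b]" "set (a # as) \<subseteq> D"
  proof (cases p)
    case (Walk as)
    then have as: "as \<noteq> []" "set as \<subseteq> D" using p by (auto simp: qpaths_def)
    then have "as = hd as # tl as" "as = butlast as @ [last as]" by auto
    then show ?thesis using that(2)[of "hd as" "tl as" "butlast as" "last as"] as Walk by metis
  qed (use p that in \<open>auto simp: qpaths_def\<close>)
  then have "E (path_head (double Q) p) (path_op p x) = path_op p x \<and> path_op p
      (E (path_tail (double Q) p) x) = path_op p x
    \<and> path_head (double Q) p \<in> verts Q \<and> path_tail (double Q) p \<in> verts Q"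
  proof cases
    case 2
    have s: "set (a # as) = set (bs @ [b])" using 2(2) by simp
    have d: "set bs \<subseteq> D" "b \<in> D" "a \<in> D" "set as \<subseteq> D" using s 2(3) by auto
    have p2: "p = Walk (bs @ [b])" using 2 by simp
    have "foldr T as x \<in> carrier M" using klinearD(1)[OF foldr_T_lin[OF d(4)] x] .
    then have "E (path_head (double Q) p) (path_op p x) = path_op p x" using d by (simp add: 2(1) E_T)
    moreover have "path_op p (E (path_tail (double Q) p) x) = path_op p x" unfolding p2 using d x by
        (simp add: T_E)
    moreover have "path_head (double Q) p \<in> verts Q" using d by (simp add: 2(1))
    moreover have "path_tail (double Q) p \<in> verts Q" using d by (simp add: p2)
    ultimately show ?thesis by blast
  qed (use x in \<open>auto simp: E_E\<close>)
  then show "E (path_head (double Q) p) (path_op p x) = path_op p x"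
    "path_op p (E (path_tail (double Q) p) x) = path_op p x"
    "path_head (double Q) p \<in> verts Q" "path_tail (double Q) p \<in> verts Q" by auto
qed

text \<open>The idempotents at the tail of \<open>p\<close> and at the head of \<open>r\<close> may
  be inserted between the two operators. If the paths do not compose, orthogonality gives zero, as
  in the path algebra.\<close>

lemma path_op_comp:
  assumes p: "p \<in> qpaths (double Q)" and r: "r \<in> qpaths (double Q)" and x: "x \<in> carrier M"
  shows "path_op p (path_op r x) = (if path_tail (double Q) p = path_head (double Q) r then path_op
      (path_comp p r) x else \<zero>)"
proof -
  note pe = path_op_ends[OF p] and re = path_op_ends[OF r]
  have rx: "path_op r x \<in> carrier M" using klinearD(1)[OF path_op_lin[OF r] x] .
  have "path_op p (path_op r x) = path_op p (E (path_tail (double Q) p)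
      (E (path_head (double Q) r) (path_op r x)))"
    using pe(2)[OF rx] re(1)[OF x] by simp
  also have "\<dots> = (if path_tail (double Q) p = path_head (double Q) r then path_op p (path_op r x) else \<zero>)"
    using E_E[OF pe(4)[OF x] re(3)[OF x] rx] re(1)[OF x]
        klinear_zero_minus(1)[OF kspace_axioms kspace_axioms path_op_lin[OF p]]
    by simp
  also have "\<dots> = (if path_tail (double Q) p = path_head (double Q) r then path_op (path_comp p r) x else \<zero>)"
  proof (rule if_cong[OF refl _ refl])
    assume e: "path_tail (double Q) p = path_head (double Q) r"
    show "path_op p (path_op r x) = path_op (path_comp p r) x"
    proof (cases p)
      case (Trivial w) then show ?thesis using re(1)[OF x] e by simp
    next
      case (Walk as)
      then show ?thesis using pe(2)[OF x] e by (cases r) auto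
    qed
  qed
  finally show ?thesis .
qed

definition path_eval :: "('v, 'a, 'k) path_elem \<Rightarrow> 'm \<Rightarrow> 'm" where
  "path_eval f x = finsum M (\<lambda>p. Poly_Mapping.lookup f p \<odot> path_op p x) (Poly_Mapping.keys f)"

lemma path_op_closed [simp]: "p \<in> qpaths (double Q) \<Longrightarrow> x \<in> carrier M \<Longrightarrow> path_op p x \<in> carrier M"
  using klinearD(1)[OF path_op_lin] .

abbreviation "PA \<equiv> path_algebra (double Q) :: ('k, _) module"

lemma path_eval_sup:
  "finite S \<Longrightarrow> S \<subseteq> qpaths (double Q) \<Longrightarrow> Poly_Mapping.keys f \<subseteq> S \<Longrightarrow> x \<in> carrier M \<Longrightarrow>
    path_eval f x = finsum M (\<lambda>p. Poly_Mapping.lookup f p \<odot> path_op p x) S"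
  unfolding path_eval_def by (rule add.finprod_mono_neutral_cong_left) (auto simp: in_keys_iff subset_iff)

lemma path_eval_closed [simp]: "f \<in> carrier PA \<Longrightarrow> x \<in> carrier M \<Longrightarrow> path_eval f x \<in> carrier M"
  unfolding path_eval_def by (rule finsum_closed) (auto simp: path_algebra_simps(1) subset_iff)

lemma path_eval_0: "path_eval 0 x = \<zero>" by (simp add: path_eval_def)

lemma path_eval_single: "p \<in> qpaths (double Q) \<Longrightarrow> x \<in> carrier M \<Longrightarrow> path_eval (Poly_Mapping.single p c) x =
    c \<odot> path_op p x"
  by (subst path_eval_sup[of "{p}"]) auto

lemma path_eval_plus:
  assumes f: "f \<in> carrier PA" and g: "g \<in> carrier PA" and x: "x \<in> carrier M"
  shows "path_eval (f + g) x = path_eval f x \<oplus> path_eval g x"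
proof -
  let ?S = "Poly_Mapping.keys f \<union> Poly_Mapping.keys g"
  have S: "finite ?S" "?S \<subseteq> qpaths (double Q)" using f g by (auto simp: path_algebra_simps(1))
  have "path_eval (f + g) x = finsum M (\<lambda>p. Poly_Mapping.lookup f p \<odot> path_op p x \<oplus> Poly_Mapping.lookup g p
      \<odot> path_op p x) ?S"
    unfolding path_eval_sup[OF S keys_add x]
    by (rule finsum_cong') (use S x in \<open>auto simp: lookup_add sc_add subset_iff\<close>)
  also have "\<dots> = path_eval f x \<oplus> path_eval g x"
    using S x by (subst finsum_addf) (auto simp: path_eval_sup[OF S] subset_iff)
  finally show ?thesis .
qed

lemma path_eval_add: "f \<in> carrier PA \<Longrightarrow> g \<in> carrier PA \<Longrightarrow> x \<in> carrier M \<Longrightarrow>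
    path_eval (f \<oplus>\<^bsub>PA\<^esub> g) x = path_eval f x \<oplus> path_eval g x"
  by (simp add: path_algebra_simps(2) path_eval_plus)

lemma path_eval_sum:
  "finite S \<Longrightarrow> (\<And>i. i \<in> S \<Longrightarrow> h i \<in> carrier PA) \<Longrightarrow> x \<in> carrier M \<Longrightarrow>
    path_eval (\<Sum>i\<in>S. h i) x = finsum M (\<lambda>i. path_eval (h i) x) S"
proof (induction S rule: finite_induct)
  case (insert i S)
  then show ?case
    using path_eval_plus[of "h i" "\<Sum>i\<in>S. h i" x] path_algebra_sum_closed[of S h "double Q"]
    by (subst finsum_insert) auto
qed (simp add: path_eval_0)

lemma path_eval_lin: "f \<in> carrier PA \<Longrightarrow> klinear M M (path_eval f)"
proof -
  assume f: "f \<in> carrier PA"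
  then have k: "p \<in> qpaths (double Q)" if "p \<in> Poly_Mapping.keys f" for p using that by
      (auto simp: path_algebra_simps(1))
  note l = klinearD(2,3)[OF path_op_lin]
  have "path_eval f (x \<oplus> y) = path_eval f x \<oplus> path_eval f y" if "x \<in> carrier M" "y \<in> carrier M" for x y
  proof -
    have "path_eval f (x \<oplus> y) = finsum M (\<lambda>p. Poly_Mapping.lookup f p \<odot> path_op p x \<oplus> Poly_Mapping.lookup f
        p \<odot> path_op p y) (Poly_Mapping.keys f)"
      unfolding path_eval_def by (rule finsum_cong') (use that k in \<open>auto simp: l sc_distr\<close>)
    then show ?thesis unfolding path_eval_def using that k by (simp add: finsum_addf Pi_iff)
  qed
  moreover have "path_eval f (c \<odot> x) = c \<odot> path_eval f x" if "x \<in> carrier M" for c x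
    unfolding path_eval_def using that k
    by (subst klinear_finsum[OF kspace_axioms, where f = "\<lambda>x. c \<odot> x"])
      (auto intro!: finsum_cong' simp: l sc_sc mult.commute klinear_def sc_distr)
  ultimately show ?thesis using f by (auto simp: klinear_def)
qed

lemma path_eval_mult:
  assumes f: "f \<in> carrier PA" and g: "g \<in> carrier PA" and x: "x \<in> carrier M"
  shows "path_eval (f \<otimes>\<^bsub>PA\<^esub> g) x = path_eval f (path_eval g x)"
proof -
  have fk: "p \<in> qpaths (double Q)" if "p \<in> Poly_Mapping.keys f" for p using f that by
      (auto simp: path_algebra_simps(1))
  have gk: "p \<in> qpaths (double Q)" if "p \<in> Poly_Mapping.keys g" for p using g that by
      (auto simp: path_algebra_simps(1))
  let ?t = "\<lambda>p r. if path_tail (double Q) p = path_head (double Q) r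
        then Poly_Mapping.single (path_comp p r) (Poly_Mapping.lookup f p * Poly_Mapping.lookup g r) else 0"
  have tc: "?t p r \<in> carrier PA" if "p \<in> Poly_Mapping.keys f" "r \<in> Poly_Mapping.keys g" for p r
    using that fk gk by (auto intro!: path_algebra_single_closed path_comp_qpaths path_algebra_zero_closed)
  have te: "path_eval (?t p r) x = Poly_Mapping.lookup f p \<odot>
      (path_op p (Poly_Mapping.lookup g r \<odot> path_op r x))"
    if pr: "p \<in> Poly_Mapping.keys f" "r \<in> Poly_Mapping.keys g" for p r
    using path_op_comp[OF fk[OF pr(1)] gk[OF pr(2)] x] fk[OF pr(1)] gk[OF pr(2)] x
    by (auto simp: path_eval_0 path_eval_single path_comp_qpaths klinearD(3)[OF path_op_lin] sc_sc)
  have "path_eval (f \<otimes>\<^bsub>PA\<^esub> g) x = path_eval (\<Sum>p\<in>Poly_Mapping.keys f. \<Sum>r\<in>Poly_Mapping.keys g. ?t p r) x"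
    by (simp add: path_algebra_def)
  also have "\<dots> = finsum M (\<lambda>p. path_eval (\<Sum>r\<in>Poly_Mapping.keys g. ?t p r) x) (Poly_Mapping.keys f)"
    using tc x by (intro path_eval_sum path_algebra_sum_closed) auto
  also have "\<dots> = finsum M (\<lambda>p. Poly_Mapping.lookup f p \<odot> path_op p (path_eval g x)) (Poly_Mapping.keys f)"
  proof (rule finsum_cong')
    fix p assume p: "p \<in> Poly_Mapping.keys f"
    have l: "klinear M M (\<lambda>y. Poly_Mapping.lookup f p \<odot> path_op p y)"
      using path_op_lin[OF fk[OF p]] by (auto simp: klinear_def sc_distr sc_sc mult.commute Pi_iff)
    have "path_eval (\<Sum>r\<in>Poly_Mapping.keys g. ?t p r) x = finsum M (\<lambda>r. path_eval (?t p r) x)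
        (Poly_Mapping.keys g)"
      using tc p x by (intro path_eval_sum) auto
    also have "\<dots> = finsum M (\<lambda>r. Poly_Mapping.lookup f p \<odot> path_op p
        (Poly_Mapping.lookup g r \<odot> path_op r x)) (Poly_Mapping.keys g)"
      by (rule finsum_cong') (use te p x fk gk in auto)
    also have "\<dots> = Poly_Mapping.lookup f p \<odot> path_op p (path_eval g x)"
      unfolding path_eval_def using x gk by (subst klinear_finsum[OF kspace_axioms l]) auto
    finally show "path_eval (\<Sum>r\<in>Poly_Mapping.keys g. ?t p r) x = Poly_Mapping.lookup f p \<odot> path_op p
        (path_eval g x)" .
  qed (use fk g x in auto)
  finally show ?thesis by (simp add: path_eval_def[of f])
qed

lemma path_eval_one: "x \<in> carrier M \<Longrightarrow> path_eval \<one>\<^bsub>PA\<^esub> x = x"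
proof -
  assume x: "x \<in> carrier M"
  have t: "Trivial w \<in> qpaths (double Q)" if "w \<in> verts Q" for w using that by (auto simp: qpaths_def)
  have "path_eval \<one>\<^bsub>PA\<^esub> x = finsum M (\<lambda>w. path_eval (Poly_Mapping.single (Trivial w) 1) x) (verts Q)"
    unfolding path_algebra_simps(3) verts_double using x t by
        (intro path_eval_sum path_algebra_single_closed) auto
  also have "\<dots> = finsum M (\<lambda>w. E w x) (verts Q)"
    by (rule finsum_cong') (use x t in \<open>auto simp: path_eval_single\<close>)
  finally show ?thesis using x by (simp add: E_sum)
qed

lemma path_eval_smult: "f \<in> carrier PA \<Longrightarrow> x \<in> carrier M \<Longrightarrow> path_eval (c \<odot>\<^bsub>PA\<^esub> f) x = c \<odot> path_eval f x"
proof -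
  assume f: "f \<in> carrier PA" and x: "x \<in> carrier M"
  have k: "p \<in> qpaths (double Q)" if "p \<in> Poly_Mapping.keys f" for p using f that by
      (auto simp: path_algebra_simps(1))
  have "Poly_Mapping.keys (c \<odot>\<^bsub>PA\<^esub> f) \<subseteq> Poly_Mapping.keys f"
    by (auto simp: path_algebra_def in_keys_iff map.rep_eq when_def split: if_splits)
  then have "path_eval (c \<odot>\<^bsub>PA\<^esub> f) x = finsum M (\<lambda>p. Poly_Mapping.lookup (c \<odot>\<^bsub>PA\<^esub> f) p \<odot> path_op p x)
      (Poly_Mapping.keys f)"
    using k x by (intro path_eval_sup) auto
  also have "\<dots> = finsum M (\<lambda>p. c \<odot> (Poly_Mapping.lookup f p \<odot> path_op p x)) (Poly_Mapping.keys f)"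
    by (rule finsum_cong') (use k x in \<open>auto simp: path_algebra_def map.rep_eq when_def sc_sc\<close>)
  also have "\<dots> = c \<odot> path_eval f x"
    unfolding path_eval_def using k x
    by (subst klinear_finsum[OF kspace_axioms, where f = "\<lambda>x. c \<odot> x"])
        (auto simp: klinear_def sc_sc sc_distr mult.commute)
  finally show ?thesis .
qed

text \<open>With a' for \<open>star a\<close>: (1 + a a')^{-1} = 1 - a (1 + a' a)^{-1} a', and the
  inverse on the right is \<open>G (star a)\<close>, because \<open>eps (star a) = -1\<close>. Thus
  1 + a a' is invertible for arrows of either sign.\<close>

lemma one_plus_inverse:
  assumes a: "a \<in> D" "eps a = 1" and x: "x \<in> carrier M"
  defines "h \<equiv> \<lambda>x. x \<ominus> T a (G (star a) (T (star a) x))"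
  shows "h (x \<oplus> T a (T (star a) x)) = x" "h x \<oplus> T a (T (star a) (h x)) = x"
proof -
  have e: "eps (star a) = -1" "star a \<in> D" using a by auto
  have "T a (G (star a) (T (star a) x \<oplus> T (star a) (T a (T (star a) x)))) = T a (T (star a) x)"
    using G_neg_l[OF e(2,1), of "T (star a) x"] a x by simp
  then show "h (x \<oplus> T a (T (star a) x)) = x" using a x by (simp add: h_def lin_simps vec_simps)
  have "T a (G (star a) (T (star a) x) \<oplus> T (star a) (T a (G (star a) (T (star a) x)))) = T a (T (star a) x)"
    using G_neg_r[OF e(2,1), of "T (star a) x"] a x by simp
  then show "h x \<oplus> T a (T (star a) (h x)) = x" using a x by (simp add: h_def lin_simps vec_simps)
qed

lemma agree_on_E:
  assumes "klinear M M f" "klinear M M g" "\<And>w x. w \<in> verts Q \<Longrightarrow> x \<in> carrier M \<Longrightarrow> f (E w x) = g (E w x)"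
    and x: "x \<in> carrier M"
  shows "f x = g x"
proof -
  have "f (finsum M (\<lambda>w. E w x) (verts Q)) = g (finsum M (\<lambda>w. E w x) (verts Q))"
    using x assms(3) klinearD(1)[OF assms(2)]
    by (subst (1 2) klinear_finsum[OF kspace_axioms])
      (auto intro!: finsum_cong' simp: assms(1,2))
  then show ?thesis using x by (simp add: E_sum)
qed

lemma foldr_G_lin: "set as \<subseteq> D \<Longrightarrow> klinear M M (foldr G as)"
  by (induction as) (auto simp: klinear_def lin_simps Pi_iff)

lemma klinear_restrict: "klinear M M f \<Longrightarrow> klinear M M (restrict f (carrier M))"
  by (auto simp: klinear_def)

lemma path_eval_weight:
  assumes w: "w \<in> verts Q" and x: "x \<in> carrier M"
  shows "path_eval (weight_elem Q q) (E w x) = q w \<odot> E w x"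
proof -
  have t: "Trivial w \<in> qpaths (double Q)" if "w \<in> verts Q" for w using that by (auto simp: qpaths_def)
  have "path_eval (weight_elem Q q) (E w x) = finsum M
      (\<lambda>u. path_eval (Poly_Mapping.single (Trivial u) (q u)) (E w x)) (verts Q)"
    unfolding weight_elem_def using x w t by (intro path_eval_sum path_algebra_single_closed) auto
  also have "\<dots> = finsum M (\<lambda>u. if w = u then q u \<odot> E u x else \<zero>) (verts Q)"
    by (rule finsum_cong') (use x w t in \<open>auto simp: path_eval_single E_E\<close>)
  also have "\<dots> = q w \<odot> E w x" using x w by (intro finsum_singleton) auto
  finally show ?thesis .
qed

lemma path_eval_arrow: "a \<in> D \<Longrightarrow> x \<in> carrier M \<Longrightarrow> path_eval (path_arrow a) x = T a x"
  and path_eval_idem: "w \<in> verts Q \<Longrightarrow> x \<in> carrier M \<Longrightarrow> path_eval (path_idem w) x = E w x"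
  unfolding path_arrow_def path_idem_def by (subst path_eval_single; auto simp: qpaths_def)+

lemma path_eval_one_plus: "a \<in> D \<Longrightarrow> x \<in> carrier M \<Longrightarrow> path_eval (one_plus Q a) x = x \<oplus> T a (T (star a) x)"
  by (simp add: one_plus_def path_eval_add path_eval_mult path_eval_one path_eval_arrow path_arrow_closed
      path_algebra_mult_closed path_algebra_one_closed)

text \<open>This is the hypothesis of the universal property with the operators on \<open>M\<close>
  as target. The operator \<open>G a\<close> turns out to be the factor of \<open>a\<close> for both
  signs, so \<open>G_prod\<close> becomes the defining relation.\<close>

lemma mpa_condition_path_eval:
  "mpa_condition Q lt q (end_algebra M) (\<lambda>f. restrict (path_eval f) (carrier M))"
proof -
  let ?R = "end_algebra M" and ?\<phi> = "\<lambda>f. restrict (path_eval f) (carrier M)"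
  interpret EA: ring ?R by (rule k_algebraD(1)[OF end_k_algebra])
  have "?\<phi> \<in> Ring.ring_hom PA ?R"
    by (rule ring_hom_memI)
      (auto simp: end_simps klinear_restrict path_eval_lin path_eval_mult path_eval_add path_eval_one compose_eq
        intro!: extensionalityI[where A="carrier M"])
  then have hom: "?\<phi> \<in> k_algebra_hom PA ?R"
    by (auto simp: k_algebra_hom_def end_simps path_eval_smult intro!: restrict_ext)
  note pow = mpa_ctx.eps_pow[OF mpa_ctx.intro[OF fd lin] EA.ring_axioms]
  have plus: "?\<phi> (one_plus Q a) = (\<lambda>x \<in> carrier M. x \<oplus> T a (T (star a) x))" if "a \<in> D" for a
    using that by (auto intro!: restrict_ext simp: path_eval_one_plus)
  have Gc: "restrict (G a) (carrier M) \<in> carrier ?R" if "a \<in> D" for a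
    using that by (simp add: end_simps klinear_restrict G_lin)
  have pc: "?\<phi> (one_plus Q a) \<in> carrier ?R" if "a \<in> D" for a
    using that by (simp add: end_simps klinear_restrict path_eval_lin path_algebra_one_plus_closed)
  have unit: "?\<phi> (one_plus Q a) \<in> Units ?R \<and> ?\<phi> (one_plus Q a) [^]\<^bsub>?R\<^esub> eps a = restrict (G a) (carrier M)"
      if a: "a \<in> D" for a
  proof (cases "eps a = 1")
    case True
    let ?h = "\<lambda>x \<in> carrier M. x \<ominus> T a (G (star a) (T (star a) x))"
    have h: "?h \<in> carrier ?R" using a by (auto simp: end_simps klinear_def lin_simps vec_simps)
    have "?\<phi> (one_plus Q a) \<otimes>\<^bsub>?R\<^esub> ?h = \<one>\<^bsub>?R\<^esub>" "?h \<otimes>\<^bsub>?R\<^esub> ?\<phi> (one_plus Q a) = \<one>\<^bsub>?R\<^esub>"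
      unfolding plus[OF a] using a True
      by (auto simp: end_simps compose_eq one_plus_inverse intro!: extensionalityI[where A="carrier M"])
    with h pc[OF a] have u: "?\<phi> (one_plus Q a) \<in> Units ?R" by (auto simp: Units_def)
    moreover have "?\<phi> (one_plus Q a) = restrict (G a) (carrier M)"
      unfolding plus[OF a] using a True by (auto intro!: restrict_ext simp: G_pos)
    ultimately show ?thesis using True pow[OF pc[OF a], of a] by simp
  next
    case False
    then have e: "eps a = -1" using eps_cases[of a] by auto
    have i: "?\<phi> (one_plus Q a) \<otimes>\<^bsub>?R\<^esub> restrict (G a) (carrier M) = \<one>\<^bsub>?R\<^esub>" "restrict (G a)
        (carrier M) \<otimes>\<^bsub>?R\<^esub> ?\<phi> (one_plus Q a) = \<one>\<^bsub>?R\<^esub>"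
      unfolding plus[OF a] using a e
      by (auto simp: end_simps compose_eq G_neg_l G_neg_r intro!: extensionalityI[where A="carrier M"])
    with Gc[OF a] pc[OF a] have u: "?\<phi> (one_plus Q a) \<in> Units ?R" by (auto simp: Units_def)
    have "inv\<^bsub>?R\<^esub> (?\<phi> (one_plus Q a)) = restrict (G a) (carrier M)"
      using i Gc[OF a] pc[OF a] by (intro EA.inv_char) auto
    then show ?thesis using u pow[OF pc[OF a], of a] e by simp
  qed
  have fold: "foldr (\<lambda>a x. (?\<phi> (one_plus Q a) [^]\<^bsub>?R\<^esub> eps a) \<otimes>\<^bsub>?R\<^esub> x) as \<one>\<^bsub>?R\<^esub> = restrict (foldr G as)
      (carrier M)"
    if "set as \<subseteq> D" for as
    using that
  proof (induction as)
    case Nil show ?case by (auto simp: end_simps)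
  next
    case (Cons a as)
    then have as: "set as \<subseteq> D" and a: "a \<in> D" by auto
    show ?case
      unfolding foldr.simps comp_apply Cons.IH[OF as] conjunct2[OF unit[OF a]]
      using klinearD(1)[OF foldr_G_lin[OF as]] by (auto simp: end_simps compose_def restrict_def fun_eq_iff)
  qed
  \<comment> \<open>Both sides are linear, so they may be compared on the image of each
    \<open>E w\<close>, where the claim is \<open>G_prod\<close>.\<close>
  have "restrict (foldr G al) (carrier M) = ?\<phi> (weight_elem Q q)"
    by (rule restrict_ext, rule agree_on_E)
      (auto simp: foldr_G_lin path_eval_lin path_algebra_weight_elem_closed path_eval_weight G_prod)
  then show ?thesis using hom unit fold[of al] by (simp add: mpa_condition_def)
qed

text \<open>The scalar multiplication of \<open>X\<close> is the homomorphism into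
  \<open>end_algebra M\<close> that the universal property provides; its values on scalars,
  idempotents and arrows are the prescribed ones.\<close>

theorem module_of_qrep:
  obtains X :: "('v, 'a, 'k, 'm) mpa_rep"
  where "mpa_module Q lt q X" "carrier X = carrier M" "add X = add M" "zero X = zero M"
    "\<And>c x. x \<in> carrier M \<Longrightarrow> (c \<odot>\<^bsub>mpa Q lt q\<^esub> \<one>\<^bsub>mpa Q lt q\<^esub>) \<odot>\<^bsub>X\<^esub> x = c \<odot> x"
    "\<And>w x. w \<in> verts Q \<Longrightarrow> x \<in> carrier M \<Longrightarrow> mpa_idem Q lt q w \<odot>\<^bsub>X\<^esub> x = E w x"
    "\<And>a x. a \<in> D \<Longrightarrow> x \<in> carrier M \<Longrightarrow> mpa_arrow Q lt q a \<odot>\<^bsub>X\<^esub> x = T a x"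
proof -
  interpret C: mpa_ctx Q lt q using fd lin by (rule mpa_ctx.intro)
  interpret L: ring "mpa Q lt q" by (rule k_algebraD(1)[OF C.mpa_k_algebra])
  obtain \<psi> where \<psi>: "\<psi> \<in> k_algebra_hom (mpa Q lt q) (end_algebra M)"
    "\<And>f. f \<in> carrier PA \<Longrightarrow> \<psi> (mpa_map Q lt q f) = restrict (path_eval f) (carrier M)"
    using C.mpa_universal[OF end_k_algebra mpa_condition_path_eval] by blast
  have r: "\<psi> \<in> Ring.ring_hom (mpa Q lt q) (end_algebra M)" using \<psi>(1) by (simp add: k_algebra_hom_def)
  define X :: "('v, 'a, 'k, 'm) mpa_rep" where
    "X = \<lparr>carrier = carrier M, mult = mult M, one = one M, zero = zero M, add = add M, smult = \<psi>\<rparr>"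
  have X [simp]: "carrier X = carrier M" "add X = add M" "zero X = zero M" "smult X = \<psi>" by
      (simp_all add: X_def)
  have l: "klinear M M (\<psi> r)" if "r \<in> carrier (mpa Q lt q)" for r
    using ring_hom_closed[OF r that] by (simp add: end_simps)
  note ld = klinearD[OF l]
  have "left_module (mpa Q lt q) X"
  proof (intro left_module.intro left_module_axioms.intro)
    show "abelian_group X"
    proof (rule abelian_groupI)
      show "\<exists>y\<in>carrier X. y \<oplus>\<^bsub>X\<^esub> x = \<zero>\<^bsub>X\<^esub>" if "x \<in> carrier X" for x
        using that by (intro bexI[of _ "\<ominus> x"]) (simp_all add: l_neg)
    qed (simp_all add: a_ac)
  qed (auto simp: L.ring_axioms ld ring_hom_add[OF r] ring_hom_mult[OF r] ring_hom_one[OF r] end_simps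
      compose_eq)
  then have "mpa_module Q lt q X" by (intro mpa_module.intro ordered_quiver_axioms)
  moreover have "\<psi> (c \<odot>\<^bsub>mpa Q lt q\<^esub> \<one>\<^bsub>mpa Q lt q\<^esub>) x = c \<odot> x" if "x \<in> carrier M" for c x
    using \<psi>(1) that by (simp add: k_algebra_hom_def ring_hom_one[OF r] end_simps)
  ultimately show ?thesis using that[of X] \<psi>(2)
    by (simp add: path_idem_closed path_arrow_closed path_eval_idem path_eval_arrow)
qed

end

section \<open>The reflected representation\<close>

context qrep
begin

lemma E_T_if: "w \<in> verts Q \<Longrightarrow> a \<in> D \<Longrightarrow> x \<in> carrier M \<Longrightarrow> E w (T a x) = (if w = hh a then T a x else \<zero>)"
  using E_E[of w "hh a" "T a x"] by (simp add: E_T)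

lemma T_E_if: "w \<in> verts Q \<Longrightarrow> a \<in> D \<Longrightarrow> x \<in> carrier M \<Longrightarrow> T a (E w x) = (if w = tt a then T a x else \<zero>)"
  using E_E[of "tt a" w x] T_E[of a "E w x"] T_E[of a x] by (cases "w = tt a") (simp_all add: lin_simps)

text \<open>For \<open>eps a = -1\<close> the operator \<open>G a\<close> inverts 1 + a a', which
  commutes with \<open>E w\<close>: write \<open>x\<close> as (1 + a a') applied to
  \<open>G a x\<close>, move \<open>E w\<close> inside and cancel.\<close>

lemma E_G: assumes w: "w \<in> verts Q" and a: "a \<in> D" and x: "x \<in> carrier M" shows "E w (G a x) = G a (E w x)"
proof (cases "eps a = 1")
  case True
  then show ?thesis using w a x by (simp add: G_pos lin_simps E_T_if T_E_if)
next
  case False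
  then have e: "eps a = -1" using eps_cases[of a] by auto
  let ?y = "G a x"
  have "G a (E w x) = G a (E w (?y \<oplus> T a (T (star a) ?y)))" using G_neg_r[OF a e x] by simp
  also have "\<dots> = G a (E w ?y \<oplus> T a (T (star a) (E w ?y)))"
    using w a x by (simp add: lin_simps E_T_if T_E_if)
  finally show ?thesis using w a x G_neg_l[OF a e, of "E w ?y"] by simp
qed

text \<open>On the space at \<open>w\<close> the arrow \<open>star a\<close> vanishes, so 1 + a a'
  and its inverse are the identity there.\<close>

lemma G_away: assumes w: "w \<in> verts Q" and a: "a \<in> D" "w \<noteq> hh a"
    and x: "x \<in> carrier M" shows "G a (E w x) = E w x"
  using eps_cases[of a] G_pos[OF a(1), of "E w x"] G_neg_l[OF a(1), of "E w x"] w a x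
  by (auto simp: T_E_if lin_simps)

section \<open>The maps b, uniform in the sign, and the map \<pi>\<close>

definition B :: "'a darrow \<Rightarrow> 'm \<Rightarrow> 'm" where
  "B a x = (if eps a = 1 then T a x else \<zero> \<ominus> G a (T a x))"

lemma B_lin: "a \<in> D \<Longrightarrow> klinear M M (B a)"
  by (auto simp: B_def klinear_def lin_simps vec_simps)

lemmas B_closed [simp] = klinearD(1)[OF B_lin]
lemmas B_simps = klinearD(2,3)[OF B_lin] klinear_zero_minus(1,3)[OF kspace_axioms kspace_axioms B_lin]

text \<open>For \<open>eps a = -1\<close> this reads (1 + a a')^{-1} = 1 - (1 + a a')^{-1} a a'.
  From here on the two signs are treated alike wherever only b and \<open>star a\<close>
  occur.\<close>

lemma G_B: "a \<in> D \<Longrightarrow> x \<in> carrier M \<Longrightarrow> G a x = x \<oplus> B a (T (star a) x)"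
  using eps_cases[of a] G_pos[of a x] G_neg_l[of a x] by (auto simp: B_def lin_simps vec_simps)

text \<open>The exponent of \<open>star a\<close> is \<open>- eps a\<close>, so
  \<open>G (star a)\<close> inverts the diagonal block 1 + a' b. For \<open>eps a = -1\<close> the
  identity is (1 + a' a)(1 - a' (1 + a a')^{-1} a) = 1.\<close>

lemma Gstar_l: assumes a: "a \<in> D" and x: "x \<in> carrier M" shows "G (star a) (x \<oplus> T (star a) (B a x)) = x"
proof (cases "eps a = 1")
  case True
  then show ?thesis using G_neg_l[of "star a" x] a x by (simp add: B_def)
next
  case False
  then have e: "eps a = -1" using eps_cases[of a] by auto
  have "T (star a) (G a (T a x \<oplus> T a (T (star a) (T a x)))) = T (star a) (T a x)"
    using G_neg_l[OF a e, of "T a x"] a x by simp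
  moreover have "T (star a) (G a (T a x) \<oplus> T a (T (star a) (G a (T a x)))) = T (star a) (T a x)"
    using G_neg_r[OF a e, of "T a x"] a x by simp
  ultimately show ?thesis using a x e G_pos[of "star a"] by (simp add: B_def lin_simps vec_simps)
qed

lemma Gstar_r: assumes a: "a \<in> D" and x: "x \<in> carrier M" shows "G (star a) x \<oplus> T (star a)
    (B a (G (star a) x)) = x"
proof (cases "eps a = 1")
  case True
  then show ?thesis using G_neg_r[of "star a" x] a x by (simp add: B_def)
next
  case False
  then have e: "eps a = -1" using eps_cases[of a] by auto
  have "T (star a) (G a (T a x \<oplus> T a (T (star a) (T a x)))) = T (star a) (T a x)"
    using G_neg_l[OF a e, of "T a x"] a x by simp
  then show ?thesis using a x e G_pos[of "star a"] by (simp add: B_def lin_simps vec_simps)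
qed

lemma E_B_if: "w \<in> verts Q \<Longrightarrow> a \<in> D \<Longrightarrow> x \<in> carrier M \<Longrightarrow> E w (B a x) = (if w = hh a then B a x else \<zero>)"
  by (auto simp: B_def lin_simps E_G E_T_if)

lemma B_E_if: "w \<in> verts Q \<Longrightarrow> a \<in> D \<Longrightarrow> x \<in> carrier M \<Longrightarrow> B a (E w x) = (if w = tt a then B a x else \<zero>)"
  by (auto simp: B_def lin_simps T_E_if)

text \<open>For the increasing list \<open>as\<close> of all arrows with head \<open>v\<close> this is the map \<open>\<pi>\<close> from the sum
  of the \<open>E (tt a) X\<close> to \<open>E v X\<close>, the sum of the \<open>G a\<^sub>1 \<dots> G a\<^sub>i\<^sub>-\<^sub>1 B a\<^sub>i\<close>.\<close>

fun tsum :: "'a darrow list \<Rightarrow> ('a darrow \<Rightarrow> 'm) \<Rightarrow> 'm" where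
  "tsum [] y = \<zero>"
| "tsum (a # as) y = G a (tsum as y) \<oplus> B a (y a)"

lemma tsum_closed [simp]: "set as \<subseteq> D \<Longrightarrow> (\<And>a. a \<in> set as \<Longrightarrow> y a \<in> carrier M) \<Longrightarrow> tsum as y \<in> carrier M"
  by (induction as) auto

lemma tsum_cong: "(\<And>a. a \<in> set as \<Longrightarrow> y a = z a) \<Longrightarrow> tsum as y = tsum as z"
  by (induction as) auto

lemma tsum_add: "set as \<subseteq> D \<Longrightarrow> (\<And>a. a \<in> set as \<Longrightarrow> y a \<in> carrier M \<and> z a \<in> carrier M) \<Longrightarrow>
    tsum as (\<lambda>a. y a \<oplus> z a) = tsum as y \<oplus> tsum as z"
  by (induction as) (auto simp: lin_simps B_simps a_ac)

lemma tsum_sc: "set as \<subseteq> D \<Longrightarrow> (\<And>a. a \<in> set as \<Longrightarrow> y a \<in> carrier M) \<Longrightarrow>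
    tsum as (\<lambda>a. c \<odot> y a) = c \<odot> tsum as y"
  by (induction as) (auto simp: lin_simps B_simps sc_distr)

lemma tsum_zero [simp]: "set as \<subseteq> D \<Longrightarrow> tsum as (\<lambda>a. \<zero>) = \<zero>"
  by (induction as) (auto simp: lin_simps B_simps)

lemma foldr_G_closed [simp]: "set as \<subseteq> D \<Longrightarrow> x \<in> carrier M \<Longrightarrow> foldr G as x \<in> carrier M"
  using klinearD(1)[OF foldr_G_lin] .

lemma tsum_append: "set as \<subseteq> D \<Longrightarrow> set bs \<subseteq> D \<Longrightarrow> (\<And>a. a \<in> set as \<union> set bs \<Longrightarrow> y a \<in> carrier M) \<Longrightarrow>
    tsum (as @ bs) y = foldr G as (tsum bs y) \<oplus> tsum as y"
  by (induction as) (auto simp: lin_simps B_simps a_ac)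

text \<open>The composite \<pi> \<mu> telescopes: b_i a_i' = G_i - 1 by \<open>G_B\<close>, and the
  summands are G_1 ... G_{i-1} (G_i - 1).\<close>

lemma tsum_star: "set as \<subseteq> D \<Longrightarrow> x \<in> carrier M \<Longrightarrow> tsum as (\<lambda>a. T (star a) x) = foldr G as x \<ominus> x"
proof (induction as)
  case (Cons a as)
  then show ?case using G_B[of a x] by (simp add: lin_simps B_simps vec_simps)
qed (simp add: vec_simps)

lemma E_tsum: "set as \<subseteq> D \<Longrightarrow> (\<And>a. a \<in> set as \<Longrightarrow> hh a = w \<and> y a \<in> carrier M) \<Longrightarrow> w \<in> verts Q \<Longrightarrow>
    E w (tsum as y) = tsum as y"
  by (induction as) (auto simp: lin_simps E_G E_B_if)

end

section \<open>Arrows into the reflection vertex and the reflected weight\<close>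

locale refl_quiver = ordered_quiver Q lt for Q :: "('v, 'a) pre_digraph" and lt +
  fixes v :: 'v
  assumes v: "v \<in> verts Q" and loopfree: "loopfree_at Q v"
begin

definition La :: "'a darrow list" where "La = filter (\<lambda>a. hh a = v) al"

lemma set_La: "a \<in> set La \<longleftrightarrow> a \<in> D \<and> hh a = v" by (auto simp: La_def)
lemma La_D: "a \<in> set La \<Longrightarrow> a \<in> D" "set La \<subseteq> D" by (auto simp: set_La)
lemma La_sorted: "sorted_wrt (\<lambda>a b. (a, b) \<in> lt) La" unfolding La_def by (rule sorted_wrt_filter[OF al_sorted])
lemma sorted_distinct: "sorted_wrt (\<lambda>a b. (a, b) \<in> lt) as \<Longrightarrow> distinct as"
  by (induction as) (auto simp: lt_irrefl)
lemma no_loop: "a \<in> D \<Longrightarrow> hh a = v \<Longrightarrow> tt a \<noteq> v" "a \<in> D \<Longrightarrow> tt a = v \<Longrightarrow> hh a \<noteq> v"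
  using loopfree by (cases a; auto simp: double_def loopfree_at_def)+

lemma arrow_list_distinct: "distinct al" using sorted_distinct[OF al_sorted] .

text \<open>The arrows from \<open>v\<close> to \<open>w\<close> in the double are original arrows
  or reverses of arrows from \<open>w\<close> to \<open>v\<close>; the two kinds are counted by the
  two terms of the sum over \<open>arcs Q\<close>.\<close>

lemma sym_form_coord:
  assumes w: "w \<in> verts Q"
  shows "- sym_form Q (coord_vec v) (coord_vec w) =
    int (length (filter (\<lambda>a. hh a = w \<and> tt a = v) al)) - (if w = v then 2 else 0)"
proof -
  interpret fin_digraph Q by (rule fd)
  have 1: "(\<Sum>u\<in>verts Q. coord_vec v u * coord_vec w u) = (if w = v then 1 else 0)"
    using v w by (auto simp: coord_vec_def sum.If_cases if_distrib cong: if_cong)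
  have "length (filter (\<lambda>a. hh a = w \<and> tt a = v) al) = card (set (filter (\<lambda>a. hh a = w \<and> tt a = v) al))"
    by (rule distinct_card[symmetric]) (simp add: arrow_list_distinct)
  also have "set (filter (\<lambda>a. hh a = w \<and> tt a = v) al) =
      Orig ` {a \<in> arcs Q. head Q a = w \<and> tail Q a = v} \<union> Star ` {a \<in> arcs Q. tail Q a = w \<and> head Q a = v}"
    by (auto simp: double_def)
  also have "card \<dots> = card {a \<in> arcs Q. head Q a = w \<and> tail Q a = v} + card {a \<in> arcs Q. tail Q a = w \<and>
      head Q a = v}"
    by (subst card_Un_disjoint) (auto simp: card_image inj_on_def)
  finally have 2: "int (length (filter (\<lambda>a. hh a = w \<and> tt a = v) al)) =
      (\<Sum>a\<in>arcs Q. coord_vec v (head Q a) * coord_vec w (tail Q a) + coord_vec v (tail Q a) * coord_vec w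
          (head Q a))"
  proof -
    have c: "int (card {a \<in> arcs Q. P a \<and> R a}) =
        (\<Sum>a\<in>arcs Q. (if R a then 1 else 0) * (if P a then 1 else 0))" for P R
    proof -
      have "(\<Sum>a\<in>arcs Q. (if R a then 1 else 0) * (if P a then 1 else 0)) =
          (\<Sum>a\<in>arcs Q. if P a \<and> R a then 1 else (0 :: int))"
        by (rule sum.cong) auto
      then show ?thesis by (simp add: sum.If_cases Int_def)
    qed
    assume "length (filter (\<lambda>a. hh a = w \<and> tt a = v) al) = card {a \<in> arcs Q. head Q a = w \<and> tail Q a =
        v} + card {a \<in> arcs Q. tail Q a = w \<and> head Q a = v}"
    then show ?thesis by (simp add: c coord_vec_def sum.distrib)
  qed
  show ?thesis unfolding sym_form_def 1 2[symmetric] by simp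
qed

lemma no_loop_filter: "filter (\<lambda>a. hh a = v \<and> tt a = v) al = []"
  using no_loop by (auto simp: filter_empty_conv)

text \<open>There is no loop at \<open>v\<close>, so the exponent is -2.\<close>

lemma refl_weight_v:
  fixes q :: "'v \<Rightarrow> 'k::field"
  shows "q v \<noteq> 0 \<Longrightarrow> refl_weight Q v q v = inverse (q v)"
  unfolding refl_weight_def sym_form_coord[OF v] no_loop_filter
  by (simp add: power_int_minus field_simps power2_eq_square)

lemma refl_weight_power:
  fixes q :: "'v \<Rightarrow> 'k::field"
  assumes "w \<in> verts Q" "w \<noteq> v"
  shows "refl_weight Q v q w = q v ^ length (filter (\<lambda>a. hh a = w \<and> tt a = v) al) * q w"
  unfolding refl_weight_def sym_form_coord[OF assms(1)] using assms(2) by simp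

lemma refl_weight_ok:
  fixes q :: "'v \<Rightarrow> 'k::field"
  assumes "\<And>w. w \<in> verts Q \<Longrightarrow> q w \<noteq> 0" "q v \<noteq> 1"
  shows "w \<in> verts Q \<Longrightarrow> refl_weight Q v q w \<noteq> 0" "refl_weight Q v q v \<noteq> 1"
  using refl_weight_v[of q] refl_weight_power[of w q] assms v by (cases "w = v"; auto)+

lemma refl_weight_refl_weight:
  fixes q :: "'v \<Rightarrow> 'k::field"
  assumes "q v \<noteq> 0"
  shows "refl_weight Q v (refl_weight Q v q) = q"
proof
  fix w
  show "refl_weight Q v (refl_weight Q v q) w = q w"
    unfolding refl_weight_def[of Q v "refl_weight Q v q"] refl_weight_v[of q, OF assms]
    using assms by (simp add: refl_weight_def power_int_minus power_int_inverse field_simps)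
qed

end

section \<open>The triangular factorisation at the reflection vertex\<close>

locale refl_rep = qrep Q lt q M E T G + refl_quiver Q lt v
  for Q :: "('v, 'a) pre_digraph" and lt and q :: "'v \<Rightarrow> 'k::field" and M :: "('k, 'm) module" (structure)
    and E T G and v +
  assumes q_nz: "\<And>w. w \<in> verts Q \<Longrightarrow> q w \<noteq> 0" and q_v: "q v \<noteq> 1"
begin

abbreviation "s \<equiv> inverse (q v)"
lemma qv_nz [simp]: "q v \<noteq> 0" using q_nz v by blast

text \<open>Factors with another head fix the space at \<open>v\<close>, so the relation at
  \<open>v\<close> involves only the arrows into \<open>v\<close>, in their order.\<close>

lemma foldr_G_v: assumes x: "x \<in> carrier M" "E v x = x" shows "foldr G La x = q v \<odot> x"
proof -
  \<comment> \<open>The second conjunct keeps the partial products in the space at \<open>v\<close>,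
    where \<open>G_away\<close> applies.\<close>
  have "foldr G (filter (\<lambda>a. hh a = v) as) x = foldr G as x \<and> E v (foldr G as x) = foldr G as x"
      if "set as \<subseteq> D" for as
    using that
  proof (induction as)
    case (Cons a as)
    then show ?case using G_away[OF v, of a "foldr G as x"] E_G[OF v, of a "foldr G as x"] x by auto
  qed (use x in simp)
  from this[of al] show ?thesis using G_prod[OF v x(1)] x by (simp add: La_def)
qed

lemma tsum_La_star: "x \<in> carrier M \<Longrightarrow> tsum La (\<lambda>a. T (star a) x) = (q v - 1) \<odot> E v x"
proof -
  assume x: "x \<in> carrier M"
  have "tsum La (\<lambda>a. T (star a) x) = tsum La (\<lambda>a. T (star a) (E v x))"
    by (rule tsum_cong) (use v x in \<open>auto simp: set_La T_E_if\<close>)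
  then show ?thesis using x v La_D by (simp add: tsum_star foldr_G_v E_E vec_simps)
qed

text \<open>The components of the reflected \<open>B a\<close>, i.e. of the column of \<open>a\<close> of \<open>\<pi>' (1 - U)\<close>, where
  \<open>q v (1 + \<pi>') = 1 + \<mu> \<pi>\<close> with \<open>\<mu> = (T (star d))\<close>, and \<open>U\<close> is the strictly upper triangular
  part of the matrix of the \<open>T (star d) (B a)\<close>.\<close>

definition Bc :: "'a darrow \<Rightarrow> 'm \<Rightarrow> 'a darrow \<Rightarrow> 'm" where
  "Bc a x d = (if d \<notin> set La then \<zero> else if (d, a) \<in> lt then T (star d) (B a x)
     else if d = a then s \<odot> (x \<oplus> T (star a) (B a x)) \<ominus> x else s \<odot> T (star d) (B a x))"

lemma Bc_simps:
  assumes a: "a \<in> set La"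
  shows "x \<in> carrier M \<Longrightarrow> Bc a x d \<in> carrier M"
    "x \<in> carrier M \<Longrightarrow> y \<in> carrier M \<Longrightarrow> Bc a (x \<oplus> y) d = Bc a x d \<oplus> Bc a y d"
    "x \<in> carrier M \<Longrightarrow> Bc a (c \<odot> x) d = c \<odot> Bc a x d"
    "Bc a \<zero> d = \<zero>"
  using La_D(1)[OF a] La_D by (auto simp: Bc_def B_simps lin_simps vec_simps set_La mult.commute)

lemma Bc_off: "d \<notin> set La \<Longrightarrow> Bc a x d = \<zero>" by (simp add: Bc_def)

lemma E_Bc: "a \<in> set La \<Longrightarrow> x \<in> carrier M \<Longrightarrow> E (tt a) x = x \<Longrightarrow> d \<in> set La \<Longrightarrow> E (tt d) (Bc a x d) = Bc a x d"
  using La_D by (auto simp: Bc_def lin_simps E_T_if set_La)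

text \<open>The columns of \<pi>' (1 - U) lie in ker \<pi>, the new space at \<open>v\<close>. Let b
  = \<open>B a x\<close>, and let P and R be the products of \<open>G\<close> over the arrows before
  and after \<open>a\<close>. The arrows from \<open>a\<close> on contribute s G_a R b - b, to which
  P is applied; the earlier ones contribute P b - b. The sum is s P G_a R b - b, and P G_a R is
  \<open>q v\<close> on the space at \<open>v\<close>.\<close>

lemma tsum_Bc:
  assumes a: "a \<in> set La" and x: "x \<in> carrier M"
  shows "tsum La (Bc a x) = \<zero>"
proof -
  obtain p r where pr: "La = p @ a # r" using split_list[OF a] by blast
  have aD: "a \<in> D" and pD: "set p \<subseteq> D" and rD: "set r \<subseteq> D" using La_D pr by auto
  have lt_p: "(d, a) \<in> lt" if "d \<in> set p" for d using La_sorted that by (simp add: pr sorted_wrt_append)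
  have lt_r: "(a, d) \<in> lt" if "d \<in> set r" for d using La_sorted that by (simp add: pr sorted_wrt_append)
  let ?b = "B a x"
  have b: "?b \<in> carrier M" "E v ?b = ?b" using aD x a v by (auto simp: E_B_if set_La)
  let ?R = "foldr G r ?b"
  have R: "?R \<in> carrier M" using rD b by simp
  have "tsum r (Bc a x) = tsum r (\<lambda>d. T (star d) (s \<odot> ?b))"
  proof (rule tsum_cong)
    fix d assume d: "d \<in> set r"
    then have "d \<noteq> a" "(d, a) \<notin> lt" "d \<in> set La" "d \<in> D" using lt_r[OF d] lt_irrefl lt_asym pr rD by auto
    then show "Bc a x d = T (star d) (s \<odot> ?b)" using b by (simp add: Bc_def lin_simps)
  qed
  also have "\<dots> = s \<odot> ?R \<ominus> s \<odot> ?b"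
    using rD b klinearD(3)[OF foldr_G_lin[OF rD] b(1)] by (simp add: tsum_star)
  \<comment> \<open>By \<open>G_B\<close> the diagonal entry contributes s G_a b - b, which cancels
    the term - s G_a b left by the later arrows.\<close>
  finally have "tsum (a # r) (Bc a x) = s \<odot> G a ?R \<ominus> ?b"
    using aD x R b a by (simp add: Bc_def lt_irrefl lin_simps B_simps vec_simps G_B[of a ?b])
  moreover have "tsum p (Bc a x) = foldr G p ?b \<ominus> ?b"
  proof -
    have "tsum p (Bc a x) = tsum p (\<lambda>d. T (star d) ?b)"
      by (rule tsum_cong) (use lt_p pr in \<open>auto simp: Bc_def\<close>)
    then show ?thesis using pD b by (simp add: tsum_star)
  qed
  moreover have "tsum La (Bc a x) = foldr G p (tsum (a # r) (Bc a x)) \<oplus> tsum p (Bc a x)"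
    unfolding pr using pD rD aD Bc_simps(1)[OF a x] by (subst tsum_append) auto
  moreover have "foldr G p (s \<odot> G a ?R \<ominus> ?b) = s \<odot> foldr G p (G a ?R) \<ominus> foldr G p ?b"
    using klinear_zero_minus(3)[OF kspace_axioms kspace_axioms foldr_G_lin[OF pD]]
        klinearD(3)[OF foldr_G_lin[OF pD]] R b aD by simp
  moreover have "foldr G p (G a ?R) = q v \<odot> ?b" using foldr_G_v[OF b] by (simp add: pr)
  ultimately show ?thesis using b pD by (simp add: vec_simps)
qed

text \<open>\<open>tz\<close> computes \<open>tsum\<close> of the reflected representation.\<close>

fun tz :: "'a darrow list \<Rightarrow> ('a darrow \<Rightarrow> 'm) \<Rightarrow> 'a darrow \<Rightarrow> 'm" where
  "tz [] x d = \<zero>"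
| "tz (a # as) x d = tz as x d \<oplus> Bc a (tz as x a \<oplus> x a) d"

text \<open>For the whole list this says \<pi>' = s (1 + \<mu> \<pi>) - 1. The recursion runs from
  the end of the list, so the induction is over suffixes; a coordinate whose arrow is still to come
  carries only \<open>T (star d)\<close> of the partial sum, without the scaling and the diagonal
  term.\<close>

lemma tz_eq:
  assumes "La = p @ as" and x: "\<And>a. a \<in> set La \<Longrightarrow> x a \<in> carrier M" and d: "d \<in> set La"
  shows "tz as x d = (if d \<in> set as then s \<odot> (x d \<oplus> T (star d) (tsum as x)) \<ominus> x d else T (star d) (tsum as x))"
  using assms(1) d
proof (induction as arbitrary: p d)
  case Nil
  then show ?case using La_D by (simp add: lin_simps)
next
  case (Cons a as)
  then have p: "La = p @ a # as" by simp
  have aD: "a \<in> set La" "a \<in> D" and asD: "set as \<subseteq> D" "set as \<subseteq> set La" and dD: "d \<in> D"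
      using La_D p Cons.prems by auto
  have suf: "La = (p @ [a]) @ as" using p by simp
  have na: "a \<notin> set as" using sorted_distinct[OF La_sorted] p by simp
  let ?t = "tsum as x" and ?z = "x a \<oplus> T (star a) (tsum as x)"
  have t: "?t \<in> carrier M" using asD x by (intro tsum_closed) auto
  have z: "?z \<in> carrier M" using t x aD by simp
  have tz: "tz as x a \<oplus> x a = ?z" using Cons.IH[OF suf aD(1)] na x[OF aD(1)] t aD by (simp add: a_comm)
  \<comment> \<open>As G_a = 1 + b a', the sum G_a t + b x_a equals t + b z.\<close>
  have tt: "tsum (a # as) x = ?t \<oplus> B a ?z"
    using t aD x[OF aD(1)] by (simp add: G_B[of a ?t] B_simps vec_simps)
  show ?case
  proof (cases "d = a")
    case True
    then show ?thesis using Cons.IH[OF suf aD(1)] na aD t z x[OF aD(1)]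
      unfolding tt by (simp add: tz Bc_def lt_irrefl lin_simps B_simps vec_simps)
  next
    case False
    then consider "d \<in> set as" "(a, d) \<in> lt" "(d, a) \<notin> lt" | "d \<notin> set as" "(d, a) \<in> lt"
      using La_sorted Cons.prems(2) lt_asym by (auto simp: p sorted_wrt_append)
    then show ?thesis
      using Cons.IH[OF suf Cons.prems(2)] aD t z x[OF Cons.prems(2)] x[OF aD(1)] False dD Cons.prems(2)
      unfolding tt by cases (simp_all add: tz Bc_def lin_simps B_simps vec_simps)
  qed
qed

text \<open>The coordinate \<open>None\<close> holds the components at all vertices other than
  \<open>v\<close> at once; the coordinates \<open>Some a\<close> form an element of W in ker \<pi>,
  the new space at \<open>v\<close>. Zeros at all other arrows make these functions finitely
  supported, so that they can be coded.\<close>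

definition Y :: "('a darrow option \<Rightarrow> 'm) set" where
  "Y = {y. y None \<in> carrier M \<and> E v (y None) = \<zero> \<and>
     (\<forall>a \<in> set La. y (Some a) \<in> carrier M \<and> E (tt a) (y (Some a)) = y (Some a)) \<and>
     (\<forall>a. a \<notin> set La \<longrightarrow> y (Some a) = \<zero>) \<and> tsum La (\<lambda>a. y (Some a)) = \<zero>}"

definition YM :: "('k, 'a darrow option \<Rightarrow> 'm) module" where
  "YM = \<lparr>carrier = Y, mult = (\<lambda>y z. y), one = (\<lambda>i. \<zero>), zero = (\<lambda>i. \<zero>), add = (\<lambda>y z i. y i \<oplus> z i), smult =
      (\<lambda>c y i. c \<odot> y i)\<rparr>"

abbreviation pr :: "'m \<Rightarrow> ('a darrow \<Rightarrow> 'm) \<Rightarrow> 'a darrow option \<Rightarrow> 'm" where "pr \<equiv> case_option"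

lemma pr_eq_iff: "pr x f = y \<longleftrightarrow> x = y None \<and> (\<forall>d. f d = y (Some d))" "y = pr x f \<longleftrightarrow> y None = x \<and>
    (\<forall>d. y (Some d) = f d)"
  by (auto simp: fun_eq_iff split: option.splits)

lemma YD: assumes "y \<in> Y"
  shows "y i \<in> carrier M" "E v (y None) = \<zero>" "a \<in> set La \<Longrightarrow> E (tt a) (y (Some a)) = y (Some a)"
    "a \<notin> set La \<Longrightarrow> y (Some a) = \<zero>" "tsum La (\<lambda>a. y (Some a)) = \<zero>"
proof -
  show "y i \<in> carrier M"
  proof (cases i)
    case (Some a) then show ?thesis using assms by (cases "a \<in> set La") (simp_all add: Y_def)
  qed (use assms in \<open>simp add: Y_def\<close>)
qed (use assms in \<open>simp_all add: Y_def\<close>)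

lemma YM_simps [simp]: "carrier YM = Y" "y \<oplus>\<^bsub>YM\<^esub> z = (\<lambda>i. y i \<oplus> z i)" "\<zero>\<^bsub>YM\<^esub> = (\<lambda>i. \<zero>)" "c \<odot>\<^bsub>YM\<^esub> y =
    (\<lambda>i. c \<odot> y i)"
  by (simp_all add: YM_def)

lemma Y_I: "y None \<in> carrier M \<Longrightarrow> E v (y None) = \<zero> \<Longrightarrow> (\<And>a. a \<in> set La \<Longrightarrow> y (Some a) \<in> carrier M) \<Longrightarrow>
    (\<And>a. a \<in> set La \<Longrightarrow> E (tt a) (y (Some a)) = y (Some a)) \<Longrightarrow> (\<And>a. a \<notin> set La \<Longrightarrow> y (Some a) = \<zero>) \<Longrightarrow>
    tsum La (\<lambda>a. y (Some a)) = \<zero> \<Longrightarrow> y \<in> Y"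
  by (simp add: Y_def)

lemma Y_add: "y \<in> Y \<Longrightarrow> z \<in> Y \<Longrightarrow> (\<lambda>i. y i \<oplus> z i) \<in> Y"
  by (rule Y_I) (simp_all add: YD lin_simps tsum_add La_D v)
lemma Y_sc: "y \<in> Y \<Longrightarrow> (\<lambda>i. c \<odot> y i) \<in> Y"
  by (rule Y_I) (simp_all add: YD lin_simps tsum_sc La_D v)
lemma Y_zero: "(\<lambda>i. \<zero>) \<in> Y"
  by (rule Y_I) (simp_all add: lin_simps La_D v)
lemma Y_nz: "x \<in> carrier M \<Longrightarrow> E v x = \<zero> \<Longrightarrow> pr x (\<lambda>a. \<zero>) \<in> Y"
  by (rule Y_I) (simp_all add: lin_simps La_D v)
lemma Y_upd: "y \<in> Y \<Longrightarrow> x \<in> carrier M \<Longrightarrow> E v x = \<zero> \<Longrightarrow> y(None := x) \<in> Y"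
  by (rule Y_I) (simp_all add: YD)
lemma Y_Bc: "a \<in> set La \<Longrightarrow> x \<in> carrier M \<Longrightarrow> E (tt a) x = x \<Longrightarrow> pr \<zero> (Bc a x) \<in> Y"
  by (rule Y_I) (simp_all add: lin_simps Bc_simps E_Bc Bc_off tsum_Bc v)

lemma kspace_YM: "kspace YM"
proof (intro kspace.intro moduleI)
  show "abelian_group YM"
  proof (rule abelian_groupI)
    fix y assume y: "y \<in> carrier YM"
    then have "(\<lambda>i. (-1) \<odot> y i) \<in> carrier YM" by (simp add: Y_sc)
    moreover have "(\<lambda>i. (-1) \<odot> y i) \<oplus>\<^bsub>YM\<^esub> y = \<zero>\<^bsub>YM\<^esub>"
      using y YD(1)[of y] by (auto simp: sc_uminus l_neg)
    ultimately show "\<exists>z\<in>carrier YM. z \<oplus>\<^bsub>YM\<^esub> y = \<zero>\<^bsub>YM\<^esub>" by blast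
  qed (auto simp: Y_add Y_zero YD(1) a_ac)
qed (auto simp: class_cring Y_sc YD(1) sc_add sc_distr sc_sc)

lemma minus_YM: "y \<in> Y \<Longrightarrow> z \<in> Y \<Longrightarrow> y \<ominus>\<^bsub>YM\<^esub> z = (\<lambda>i. y i \<ominus> z i)"
proof -
  assume yz: "y \<in> Y" "z \<in> Y"
  interpret Y: kspace YM by (rule kspace_YM)
  have "(\<lambda>i. y i \<ominus> z i) = (\<lambda>i. y i \<oplus> (-1) \<odot> z i)" using yz by (auto simp: YD(1) sc_uminus a_minus_def)
  then have "(\<lambda>i. y i \<ominus> z i) \<in> Y" using Y_add[OF yz(1) Y_sc[OF yz(2), of "-1"]] by simp
  then show ?thesis using yz by (subst Y.minus_eq_eq) (simp_all add: fun_eq_iff YD(1) vec_simps)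
qed

section \<open>The operators of the reflection\<close>

definition Ey :: "'v \<Rightarrow> ('a darrow option \<Rightarrow> 'm) \<Rightarrow> 'a darrow option \<Rightarrow> 'm" where
  "Ey w y = (if w = v then y(None := \<zero>) else pr (E w (y None)) (\<lambda>a. \<zero>))"

text \<open>At head \<open>v\<close> this is 1 + b a' for the new b, whose coordinates are
  \<open>Bc a\<close>, and the new a', which reads off the coordinate \<open>Some a\<close>. At tail
  \<open>v\<close> the factor is the inverse of a diagonal block that has been divided by
  \<open>q v\<close>, hence the factor \<open>q v\<close> on the space at the head of
  \<open>a\<close>.\<close>

definition Gy :: "'a darrow \<Rightarrow> ('a darrow option \<Rightarrow> 'm) \<Rightarrow> 'a darrow option \<Rightarrow> 'm" where
  "Gy a y = (if hh a = v then pr (y None) (\<lambda>d. y (Some d) \<oplus> Bc a (y (Some a)) d)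
     else if tt a = v then y(None := (y None \<ominus> E (hh a) (y None)) \<oplus> q v \<odot> G a (E (hh a) (y None)))
     else y(None := G a (y None)))"

text \<open>Arrows out of \<open>v\<close> are coordinates, since the new \<mu> is an inclusion. For
  arrows into \<open>v\<close> with \<open>eps a = -1\<close> the equation b = - G_a a has to be
  undone: a = - b (1 + a' b)^{-1}, and the inverse of the new block is \<open>q v\<close> times
  \<open>G (star a)\<close>.\<close>

definition Ty :: "'a darrow \<Rightarrow> ('a darrow option \<Rightarrow> 'm) \<Rightarrow> 'a darrow option \<Rightarrow> 'm" where
  "Ty a y = (if hh a = v then
       (if eps a = 1 then pr \<zero> (Bc a (E (tt a) (y None)))
        else pr \<zero> (\<lambda>d. (-1) \<odot> Bc a (q v \<odot> G (star a) (E (tt a) (y None))) d))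
     else if tt a = v then pr (y (Some (star a))) (\<lambda>a. \<zero>)
     else pr (T a (y None)) (\<lambda>a. \<zero>))"

lemma klinear_YM_I:
  assumes "\<And>y. y \<in> Y \<Longrightarrow> f y \<in> Y"
    and "\<And>y z i. y \<in> Y \<Longrightarrow> z \<in> Y \<Longrightarrow> f (\<lambda>i. y i \<oplus> z i) i = f y i \<oplus> f z i"
    and "\<And>c y i. y \<in> Y \<Longrightarrow> f (\<lambda>i. c \<odot> y i) i = c \<odot> f y i"
  shows "klinear YM YM f"
  using assms by (auto simp: klinear_def)

lemma Ey_lin: assumes w: "w \<in> verts Q" shows "klinear YM YM (Ey w)"
proof -
  have "Ey w y \<in> Y" if "y \<in> Y" for y
    using that w v YD[OF that] by (auto simp: Ey_def Y_nz Y_upd lin_simps E_E)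
  then show ?thesis using w v by (auto simp: klinear_def Ey_def lin_simps fun_eq_iff YD(1) split: option.splits)
qed

lemma E_star: "a \<in> D \<Longrightarrow> hh a \<noteq> v \<Longrightarrow> tt a = v \<Longrightarrow> y \<in> Y \<Longrightarrow> E (hh a) (y (Some (star a))) = y (Some (star a))"
  using YD(3)[of y "star a"] by (simp add: set_La)

lemma Ty_lin: assumes a: "a \<in> D" shows "klinear YM YM (Ty a)"
proof -
  have cl: "Ty a y \<in> Y" if y: "y \<in> Y" for y
  proof -
    note yd = YD[OF y]
    consider "hh a = v" "eps a = 1" | "hh a = v" "eps a \<noteq> 1" | "hh a \<noteq> v" "tt a = v" | "hh a \<noteq> v" "tt a \<noteq> v"
        by blast
    then show ?thesis
    proof cases
      case 1
      then have "pr \<zero> (Bc a (E (tt a) (y None))) \<in> Y" using a yd(1) by (intro Y_Bc) (simp_all add: set_La E_E)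
      with 1 show ?thesis by (simp add: Ty_def)
    next
      case 2
      then have "pr \<zero> (Bc a (q v \<odot> G (star a) (E (tt a) (y None)))) \<in> Y"
        using a yd by (intro Y_Bc) (auto simp: set_La E_E E_G lin_simps)
      from Y_sc[OF this, of "-1"]
      have "(\<lambda>i. (-1) \<odot> pr \<zero> (Bc a (q v \<odot> G (star a) (E (tt a) (y None)))) i) \<in> Y" .
      moreover have "(\<lambda>i. (-1) \<odot> pr \<zero> (Bc a (q v \<odot> G (star a) (E (tt a) (y None)))) i) = Ty a y"
        using 2 by (simp add: Ty_def pr_eq_iff)
      ultimately show ?thesis by simp
    next
      case 3
      have "E v (y (Some (star a))) = E v (E (hh a) (y (Some (star a))))" using 3 a y by (simp add: E_star)
      then show ?thesis using 3 a v yd by (simp add: Ty_def Y_nz E_E)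
    next
      case 4 then show ?thesis using a v yd by (simp add: Ty_def Y_nz E_T_if)
    qed
  qed
  have La: "hh a = v \<Longrightarrow> a \<in> set La" using a by (simp add: set_La)
  show ?thesis
  proof (rule klinear_YM_I)
    fix y z i assume "y \<in> Y" "z \<in> Y"
    then show "Ty a (\<lambda>i. y i \<oplus> z i) i = Ty a y i \<oplus> Ty a z i"
      using a v La by (cases i) (simp_all add: Ty_def lin_simps Bc_simps YD(1) sc_distr)
  next
    fix c y i assume "y \<in> Y"
    then show "Ty a (\<lambda>i. c \<odot> y i) i = c \<odot> Ty a y i"
      using a v La by (cases i) (simp_all add: Ty_def lin_simps Bc_simps YD(1) sc_sc mult.commute)
  qed (rule cl)
qed

lemma Gy_lin: assumes a: "a \<in> D" shows "klinear YM YM (Gy a)"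
proof -
  have La: "hh a = v \<Longrightarrow> a \<in> set La" using a by (simp add: set_La)
  have cl: "Gy a y \<in> Y" if y: "y \<in> Y" for y
  proof -
    note yd = YD[OF y]
    consider "hh a = v" | "hh a \<noteq> v" "tt a = v" | "hh a \<noteq> v" "tt a \<noteq> v" by blast
    then show ?thesis
    proof cases
      case 1
      have "(\<lambda>i. y i \<oplus> pr \<zero> (Bc a (y (Some a))) i) \<in> Y"
        using La[OF 1] yd y by (intro Y_add Y_Bc) auto
      moreover have "(\<lambda>i. y i \<oplus> pr \<zero> (Bc a (y (Some a))) i) = Gy a y"
        using 1 yd by (auto simp: Gy_def fun_eq_iff split: option.splits)
      ultimately show ?thesis by simp
    next
      case 2
      have "y(None := (y None \<ominus> E (hh a) (y None)) \<oplus> q v \<odot> G a (E (hh a) (y None))) \<in> Y"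
        using a v yd(1,2) y 2 by (intro Y_upd) (simp_all add: lin_simps E_E E_G vec_simps)
      with 2 show ?thesis by (simp add: Gy_def)
    next
      case 3 then show ?thesis using a v y yd by (auto simp: Gy_def lin_simps E_G intro!: Y_upd)
    qed
  qed
  show ?thesis
  proof (rule klinear_YM_I)
    fix y z i assume "y \<in> Y" "z \<in> Y"
    then show "Gy a (\<lambda>i. y i \<oplus> z i) i = Gy a y i \<oplus> Gy a z i"
      using a v La by (cases i) (simp_all add: Gy_def lin_simps Bc_simps YD(1) vec_simps)
  next
    fix c y i assume "y \<in> Y"
    then show "Gy a (\<lambda>i. c \<odot> y i) i = c \<odot> Gy a y i"
      using a v La by (cases i) (simp_all add: Gy_def lin_simps Bc_simps YD(1) vec_simps mult.commute)
  qed (rule cl)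
qed

section \<open>The relations of the reflection\<close>

lemma Bc_diag: "a \<in> set La \<Longrightarrow> Bc a x a = s \<odot> (x \<oplus> T (star a) (B a x)) \<ominus> x"
  by (simp add: Bc_def lt_irrefl)

text \<open>The new diagonal block is s (1 + a' b), so its inverse is \<open>q v\<close> times
  \<open>G (star a)\<close>.\<close>

lemma Gstar_diag:
  assumes "a \<in> set La" "x \<in> carrier M"
  shows "Bc a (q v \<odot> G (star a) x) a = x \<ominus> q v \<odot> G (star a) x"
proof -
  have a: "a \<in> D" using assms La_D by blast
  let ?g = "G (star a) x"
  have "s \<odot> (q v \<odot> ?g \<oplus> T (star a) (B a (q v \<odot> ?g))) = ?g \<oplus> T (star a) (B a ?g)"
    using a assms by (simp add: B_simps lin_simps vec_simps)
  then show ?thesis using assms a by (simp add: Bc_diag Gstar_r)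
qed

lemma Gy_star: "a \<in> D \<Longrightarrow> hh a \<noteq> v \<Longrightarrow> tt a = v \<Longrightarrow> y \<in> Y \<Longrightarrow>
   E (hh a) (Gy a y None) = q v \<odot> G a (E (hh a) (y None))"
  by (simp add: Gy_def lin_simps YD(1) E_E E_G vec_simps)

text \<open>For head \<open>v\<close> both sides agree by the definitions; for tail \<open>v\<close>
  the claim is \<open>Gstar_diag\<close> for \<open>star a\<close>; elsewhere it is the old
  relation.\<close>

lemma qrep_Gy_pos:
  assumes a: "a \<in> D" "eps a = 1" and y: "y \<in> Y"
  shows "Gy a y = (\<lambda>i. y i \<oplus> Ty a (Ty (star a) y) i)"
proof -
  note yd = YD[OF y]
  consider "hh a = v" | "hh a \<noteq> v" "tt a = v" | "hh a \<noteq> v" "tt a \<noteq> v" by blast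
  then show ?thesis
  proof cases
    case 1
    then have "a \<in> set La" "tt a \<noteq> v" using a no_loop by (simp_all add: set_La)
    then show ?thesis using 1 a yd(1,3) by (simp add: Gy_def Ty_def pr_eq_iff)
  next
    case 2
    have L: "star a \<in> set La" using a 2 by (simp add: set_La)
    have "Ty (star a) y (Some (star a)) = (-1) \<odot> Bc (star a) (q v \<odot> G a (E (hh a) (y None))) (star a)"
      using 2 a by (simp add: Ty_def)
    also have "\<dots> = q v \<odot> G a (E (hh a) (y None)) \<ominus> E (hh a) (y None)"
      using Gstar_diag[OF L, of "E (hh a) (y None)"] a yd(1) by (simp add: vec_simps)
    finally show ?thesis using 2 a yd(1)
      by (simp add: Gy_def Ty_def[of a] fun_eq_iff vec_simps split: option.splits)
  next
    case 3
    then show ?thesis using a yd(1) by (auto simp: Gy_def Ty_def G_pos fun_eq_iff split: option.splits)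
  qed
qed

lemma qrep_Gy_neg_l:
  assumes a: "a \<in> D" "eps a = -1" and y: "y \<in> Y"
  shows "Gy a (\<lambda>i. y i \<oplus> Ty a (Ty (star a) y) i) = y"
proof -
  note yd = YD[OF y]
  consider "hh a = v" | "hh a \<noteq> v" "tt a = v" | "hh a \<noteq> v" "tt a \<noteq> v" by blast
  then show ?thesis
  proof cases
    case 1
    then have L: "a \<in> set La" "tt a \<noteq> v" using a no_loop by (simp_all add: set_La)
    let ?z = "q v \<odot> G (star a) (y (Some a))"
    have z: "?z \<in> carrier M" using a yd(1) by simp
    have TT: "Ty a (Ty (star a) y) = pr \<zero> (\<lambda>d. (-1) \<odot> Bc a ?z d)"
      using 1 L a yd(1,3) by (simp add: Ty_def)
    \<comment> \<open>By \<open>Gstar_diag\<close> the corrected coordinate at \<open>a\<close> is z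
      itself, so \<open>Gy\<close> adds back exactly the \<open>Bc a\<close> z that was
      subtracted.\<close>
    have h: "y (Some a) \<oplus> (-1) \<odot> Bc a ?z a = ?z"
      using Gstar_diag[OF L(1) yd(1)[of "Some a"]] yd(1) z by (simp add: vec_simps)
    have "y (Some d) \<oplus> (-1) \<odot> Bc a ?z d \<oplus> Bc a ?z d = y (Some d)" for d
      using Bc_simps(1)[OF L(1) z] yd(1) by (simp add: vec_simps)
    then show ?thesis using 1 yd(1) unfolding TT by (simp add: Gy_def pr_eq_iff h)
  next
    case 2
    have L: "star a \<in> set La" using a 2 by (simp add: set_La)
    let ?e = "E (hh a) (y None)" and ?u = "E (hh a) (y None) \<oplus> T a (B (star a) (E (hh a) (y None)))"
    have u: "?u \<in> carrier M" "E (hh a) ?u = ?u" using a yd(1) by (simp_all add: lin_simps E_E E_T_if)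
    have TT: "Ty a (Ty (star a) y) = pr (s \<odot> ?u \<ominus> ?e) (\<lambda>a. \<zero>)"
      using 2 a L by (simp add: Ty_def Bc_diag)
    \<comment> \<open>The vector \<open>?u\<close> is the old diagonal block of
      \<open>star a\<close> applied to \<open>?e\<close>, and \<open>G a\<close> inverts it.\<close>
    have G: "G a ?u = ?e" using Gstar_l[of "star a" ?e] a yd(1) by simp
    let ?x = "y None \<oplus> (s \<odot> ?u \<ominus> ?e)"
    have "E (hh a) ?x = ?e \<oplus> (s \<odot> ?u \<ominus> ?e)"
      using u a yd(1) E_sc[of "hh a" ?u s] by (simp add: E_add E_minus E_E)
    then have Ex: "E (hh a) ?x = s \<odot> ?u" using u(1) a yd(1) by (simp add: vec_simps)
    have "?x \<ominus> s \<odot> ?u \<oplus> q v \<odot> G a (s \<odot> ?u) = y None"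
      using u(1) a yd(1) by (simp add: G_sc G sc_sc) (simp add: vec_simps)
    then show ?thesis using 2 yd(1) unfolding TT
      by (simp add: Gy_def fun_eq_iff Ex split: option.splits)
  next
    case 3
    then show ?thesis using a yd(1) by (auto simp: Gy_def Ty_def G_neg_l fun_eq_iff split: option.splits)
  qed
qed

lemma qrep_Gy_neg_r:
  assumes a: "a \<in> D" "eps a = -1" and y: "y \<in> Y"
  shows "(\<lambda>i. Gy a y i \<oplus> Ty a (Ty (star a) (Gy a y)) i) = y"
proof -
  note yd = YD[OF y]
  have gY: "Gy a y \<in> Y" using klinearD(1)[OF Gy_lin[OF a(1)]] y by simp
  consider "hh a = v" | "hh a \<noteq> v" "tt a = v" | "hh a \<noteq> v" "tt a \<noteq> v" by blast
  then show ?thesis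
  proof cases
    case 1
    then have L: "a \<in> set La" "tt a \<noteq> v" using a no_loop by (simp_all add: set_La)
    let ?x = "y (Some a)"
    have g: "Gy a y (Some a) = s \<odot> (?x \<oplus> T (star a) (B a ?x))"
      using 1 L a yd(1) by (simp add: Gy_def Bc_diag vec_simps)
    \<comment> \<open>The coordinate at \<open>a\<close> has been multiplied by the new diagonal
      block, which is inverted here.\<close>
    have "q v \<odot> G (star a) (Gy a y (Some a)) = ?x"
      unfolding g using Gstar_l[of a ?x] a yd(1) by (simp add: G_sc sc_sc)
    then have TT: "Ty a (Ty (star a) (Gy a y)) = pr \<zero> (\<lambda>d. (-1) \<odot> Bc a ?x d)"
      using 1 L a YD(3)[OF gY L(1)] by (simp add: Ty_def)
    show ?thesis using 1 L yd(1) unfolding TT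
      by (simp add: Gy_def fun_eq_iff Bc_simps vec_simps split: option.splits)
  next
    case 2
    have L: "star a \<in> set La" using a 2 by (simp add: set_La)
    let ?e = "E (hh a) (y None)"
    let ?x = "q v \<odot> G a ?e"
    have x: "?x \<in> carrier M" using a yd(1) by simp
    have "Ty a (Ty (star a) (Gy a y)) = pr (Bc (star a) ?x (star a)) (\<lambda>a. \<zero>)"
      using 2 a L Gy_star[OF a(1) 2 y] by (simp add: Ty_def)
    also have "Bc (star a) ?x (star a) = ?e \<ominus> ?x" using Gstar_diag[OF L, of ?e] a yd(1) by simp
    finally have TT: "Ty a (Ty (star a) (Gy a y)) = pr (?e \<ominus> ?x) (\<lambda>a. \<zero>)" .
    show ?thesis using 2 a yd(1) x unfolding TT
      by (simp add: Gy_def fun_eq_iff vec_simps split: option.splits)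
  next
    case 3
    then show ?thesis using a yd(1) by (auto simp: Gy_def Ty_def G_neg_r fun_eq_iff split: option.splits)
  qed
qed

text \<open>Factors with another head change only the coordinate \<open>None\<close>, which is zero
  here. The others build up y + \<pi>' y = s (1 + \<mu> \<pi>) y, and \<pi> y = 0.\<close>

lemma foldr_Gy_v:
  assumes y: "y \<in> Y"
  shows "foldr Gy al (y(None := \<zero>)) = (\<lambda>i. s \<odot> (y(None := \<zero>)) i)"
proof -
  note yd = YD[OF y]
  let ?y = "y(None := \<zero>)"
  let ?z = "\<lambda>as. pr \<zero> (\<lambda>d. y (Some d) \<oplus> tz as (\<lambda>a. y (Some a)) d)"
  have *: "foldr Gy as ?y = ?z (filter (\<lambda>a. hh a = v) as)" if "set as \<subseteq> D" for as
    using that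
  proof (induction as)
    case Nil
    show ?case using yd(1) by (auto simp: fun_eq_iff split: option.splits)
  next
    case (Cons a as)
    let ?f = "filter (\<lambda>a. hh a = v) as"
    have tzc: "tz as x d \<in> carrier M" if "set as \<subseteq> set La" "\<And>a. x a \<in> carrier M" for as x d
      using that by (induction as arbitrary: d) (auto simp: Bc_simps)
    have f: "set ?f \<subseteq> set La" using Cons.prems by (simp add: subset_iff set_La)
    show ?case
    proof (cases "hh a = v")
      case True
      then show ?thesis using Cons tzc[OF f, of "\<lambda>a. y (Some a)"] yd(1) Bc_simps(1)[of a]
        by (auto simp: Gy_def pr_eq_iff set_La a_ac)
    next
      case False
      then show ?thesis using Cons by (auto simp: Gy_def fun_eq_iff lin_simps split: option.splits)
    qed
  qed
  have "tz La (\<lambda>a. y (Some a)) d = (if d \<in> set La then s \<odot> y (Some d) \<ominus> y (Some d) else \<zero>)" for d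
  proof (cases "d \<in> set La")
    case True
    then show ?thesis using tz_eq[of "[]" La "\<lambda>a. y (Some a)" d] yd La_D(1)[OF True] by (simp add: lin_simps)
  next
    case False
    have "tz as x d = \<zero>" for as x by (induction as) (use False in \<open>simp_all add: Bc_off\<close>)
    with False show ?thesis by simp
  qed
  then show ?thesis using *[of al] yd(1,4) by
      (auto simp: La_def[symmetric] fun_eq_iff vec_simps split: option.splits)
qed

text \<open>Each arrow of the double from \<open>v\<close> to \<open>w\<close> contributes one
  factor \<open>q v\<close>; the other arrows act on the space at \<open>w\<close> as before. With
  \<open>refl_weight_power\<close> this yields the reflected weight at \<open>w\<close>.\<close>

lemma foldr_Gy_away:
  assumes w: "w \<in> verts Q" "w \<noteq> v" and x: "x \<in> carrier M" and as: "set as \<subseteq> D"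
  shows "foldr Gy as (pr (E w x) (\<lambda>a. \<zero>)) =
    pr (q v ^ length (filter (\<lambda>a. hh a = w \<and> tt a = v) as) \<odot> foldr G as (E w x)) (\<lambda>a. \<zero>)"
  using as
proof (induction as)
  case Nil show ?case using w x by (simp add: pr_eq_iff)
next
  case (Cons a as)
  let ?g = "foldr G as (E w x)" and ?n = "length (filter (\<lambda>a. hh a = w \<and> tt a = v) as)"
  have g: "?g \<in> carrier M" "E w ?g = ?g"
  proof -
    show "?g \<in> carrier M" using Cons w x by simp
    show "E w ?g = ?g" using Cons.prems by (induction as) (use w x in \<open>auto simp: E_G E_E\<close>)
  qed
  have aD: "a \<in> D" using Cons by simp
  have away: "G a ?g = ?g" if "hh a \<noteq> w" using G_away[OF w(1) aD _ g(1)] g(2) that by simp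
  have Eh: "E (hh a) ?g = (if hh a = w then ?g else \<zero>)" using E_E[of "hh a" w ?g] g aD w by simp
  show ?case
  proof (cases "hh a = v")
    case True
    then have "a \<in> set La" using aD by (simp add: set_La)
    then show ?thesis using True Cons w away by (simp add: Gy_def pr_eq_iff Bc_simps)
  next
    case False
    then show ?thesis
      using Cons w g away aD Eh by (cases "tt a = v"; cases "hh a = w")
          (auto simp: Gy_def fun_eq_iff lin_simps vec_simps mult.commute split: option.splits)
  qed
qed

theorem qrep_reflection: "qrep Q lt (refl_weight Q v q) YM Ey Ty Gy"
proof -
  interpret K: kspace YM by (rule kspace_YM)
  show ?thesis
  proof (unfold_locales, goal_cases)
    case (1 w) then show ?case by (rule Ey_lin)
  next
    case (2 a) then show ?case by (rule Ty_lin)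
  next
    case (3 a) then show ?case by (rule Gy_lin)
  next
    case (4 w u y)
    then show ?case by (auto simp: Ey_def E_E YD lin_simps fun_eq_iff split: option.splits)
  next
    case (5 y)
    then have y: "y \<in> Y" by simp
    have "y None = \<zero>"
    proof (rule E_faithful)
      fix w assume "w \<in> verts Q"
      then show "E w (y None) = \<zero>" using 5(2)[of w] YD(2)[OF y] by (cases "w = v")
          (auto simp: Ey_def dest!: fun_cong[of _ _ None])
    qed (use y in \<open>simp add: YD\<close>)
    moreover have "y (Some d) = \<zero>" for d using fun_cong[OF 5(2)[OF v], of "Some d"] by (simp add: Ey_def)
    ultimately show ?case by (auto simp: fun_eq_iff) (metis option.exhaust)
  next
    case (6 a y)
    then have y: "y \<in> Y" and a: "a \<in> D" by simp_all
    then show ?case using no_loop(2)[OF a] E_star[OF a _ _ y] YD[OF y] by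
        (simp add: Ty_def Ey_def fun_eq_iff E_T split: option.splits)
  next
    case (7 a y)
    then have y: "y \<in> Y" and a: "a \<in> D" by simp_all
    then show ?case using no_loop(1)[OF a] YD[OF y] by
        (simp add: Ty_def Ey_def fun_eq_iff T_E E_E split: option.splits)
  next
    case (8 a y) then show ?case by (simp add: qrep_Gy_pos)
  next
    case (9 a y) then show ?case by (simp add: qrep_Gy_neg_l)
  next
    case (10 a y) then show ?case by (simp add: qrep_Gy_neg_r)
  next
    case (11 w y)
    then have y: "y \<in> Y" and w: "w \<in> verts Q" by simp_all
    show ?case
    proof (cases "w = v")
      case True
      then show ?thesis using foldr_Gy_v[OF y] by (simp add: Ey_def refl_weight_v)
    next
      case False
      then show ?thesis using foldr_Gy_away[OF w False YD(1)[OF y, of None], of al]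
          G_prod[OF w YD(1)[OF y, of None]] YD(1)[OF y] w
        by (auto simp: Ey_def refl_weight_power[OF w False] fun_eq_iff sc_sc split: option.splits)
    qed
  qed
qed

end

section \<open>The reflection functor\<close>

locale refl_hom = R1: refl_rep Q lt q M E T G v + R2: refl_rep Q lt q N E' T' G' v
  for Q :: "('v, 'a) pre_digraph" and lt and q :: "'v \<Rightarrow> 'k::field" and M :: "('k, 'm) module" and E T G v
    and N :: "('k, 'n) module" and E' T' G' +
  fixes f :: "'m \<Rightarrow> 'n"
  assumes f_lin: "klinear M N f"
    and f_E: "\<And>w x. w \<in> verts Q \<Longrightarrow> x \<in> carrier M \<Longrightarrow> f (E w x) = E' w (f x)"
    and f_T: "\<And>a x. a \<in> R1.D \<Longrightarrow> x \<in> carrier M \<Longrightarrow> f (T a x) = T' a (f x)"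
begin

lemmas f_simps = klinearD[OF f_lin] klinear_zero_minus(1,3)[OF R1.kspace_axioms R2.kspace_axioms f_lin]

text \<open>For \<open>eps a = -1\<close> apply \<open>f\<close> to \<open>x\<close> = (1 + a a')
  \<open>G a x\<close> and cancel. Hence everything built from \<open>E\<close>, \<open>T\<close>
  and \<open>G\<close> is preserved.\<close>

lemma f_G: assumes a: "a \<in> R1.D" and x: "x \<in> carrier M" shows "f (G a x) = G' a (f x)"
proof (cases "eps a = 1")
  case True
  then show ?thesis using a x by (simp add: R1.G_pos R2.G_pos f_simps f_T)
next
  case False
  then have e: "eps a = -1" using R1.eps_cases[of a] by auto
  have "f x = f (G a x \<oplus>\<^bsub>M\<^esub> T a (T (star a) (G a x)))" using R1.G_neg_r[OF a e x] by simp
  also have "\<dots> = f (G a x) \<oplus>\<^bsub>N\<^esub> T' a (T' (star a) (f (G a x)))" using a x by (simp add: f_simps f_T)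
  finally show ?thesis using R2.G_neg_l[OF a e, of "f (G a x)"] a x by (simp add: f_simps)
qed

lemma f_B: "a \<in> R1.D \<Longrightarrow> x \<in> carrier M \<Longrightarrow> f (R1.B a x) = R2.B a (f x)"
  by (simp add: R1.B_def R2.B_def f_simps f_T f_G)

lemma f_Bc: "a \<in> set R1.La \<Longrightarrow> x \<in> carrier M \<Longrightarrow> f (R1.Bc a x d) = R2.Bc a (f x) d"
  using R1.La_D(1)[of a] R1.La_D(1)[of d] by (simp add: R1.Bc_def R2.Bc_def f_simps f_T f_B)

lemma f_tsum: "set as \<subseteq> R1.D \<Longrightarrow> (\<And>a. a \<in> set as \<Longrightarrow> y a \<in> carrier M) \<Longrightarrow> f (R1.tsum as y) = R2.tsum as (\<lambda>a. f (y a))"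
  by (induction as) (simp_all add: f_simps f_G f_B)

text \<open>The reflection acts on morphisms coordinatewise: \<open>f\<close> intertwines the two
  maps \<pi> and so preserves their kernels.\<close>

lemma f_Y: "y \<in> R1.Y \<Longrightarrow> (\<lambda>i. f (y i)) \<in> R2.Y"
proof (rule R2.Y_I)
  assume y: "y \<in> R1.Y"
  note yd = R1.YD[OF y]
  show "R2.tsum R1.La (\<lambda>a. f (y (Some a))) = \<zero>\<^bsub>N\<^esub>"
    using yd(1,5) R1.La_D(2) by (simp add: f_simps flip: f_tsum)
  show "E' v (f (y None)) = \<zero>\<^bsub>N\<^esub>" using yd(1,2) R1.v by (simp add: f_simps flip: f_E)
  show "E' (R1.tt a) (f (y (Some a))) = f (y (Some a))" if "a \<in> set R1.La" for a
    using yd(1) yd(3)[OF that] R1.La_D(1)[OF that] by (simp flip: f_E)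
qed (simp_all add: R1.YD f_simps)

lemma f_Ey: "w \<in> verts Q \<Longrightarrow> y \<in> R1.Y \<Longrightarrow> (\<lambda>i. f (R1.Ey w y i)) = R2.Ey w (\<lambda>i. f (y i))"
  by (auto simp: R1.Ey_def R2.Ey_def f_simps f_E R1.YD fun_eq_iff split: option.splits)

lemma f_Ty: "a \<in> R1.D \<Longrightarrow> y \<in> R1.Y \<Longrightarrow> (\<lambda>i. f (R1.Ty a y i)) = R2.Ty a (\<lambda>i. f (y i))"
proof
  fix i assume a: "a \<in> R1.D" and y: "y \<in> R1.Y"
  note yd = R1.YD[OF y]
  show "f (R1.Ty a y i) = R2.Ty a (\<lambda>i. f (y i)) i"
  proof (cases "R1.hh a = v")
    case True
    then have L: "a \<in> set R1.La" using a by (simp add: R1.set_La)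
    have e: "E (R1.tt a) (y None) \<in> carrier M" "f (E (R1.tt a) (y None)) = E' (R1.tt a) (f (y None))"
      using a yd(1) by (simp_all add: f_E)
    show ?thesis using True a e yd(1) L
      by (cases i) (simp_all add: R1.Ty_def R2.Ty_def f_simps f_G f_Bc R1.Bc_simps R2.Bc_simps)
  next
    case False
    then show ?thesis using a yd(1) by (cases i) (simp_all add: R1.Ty_def R2.Ty_def f_simps f_T)
  qed
qed

end

text \<open>An infinite type is in bijection with its square, so coordinates can be absorbed one at
  a time.\<close>

lemma inj_finite_support:
  assumes "infinite (UNIV :: 'm set)" "finite S"
  shows "\<exists>c :: ('i \<Rightarrow> 'm) \<Rightarrow> 'm. inj_on c {y. \<forall>i. i \<notin> S \<longrightarrow> y i = z}"
  using assms(2)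
proof (induction S rule: finite_induct)
  case empty
  show ?case by (intro exI[of _ "\<lambda>y. z"]) (auto simp: inj_on_def fun_eq_iff)
next
  case (insert j S)
  then obtain c :: "('i \<Rightarrow> 'm) \<Rightarrow> 'm" where c: "inj_on c {y. \<forall>i. i \<notin> S \<longrightarrow> y i = z}" by blast
  obtain p :: "'m \<times> 'm \<Rightarrow> 'm" where p: "bij_betw p (UNIV \<times> UNIV) UNIV"
    using card_of_Times_same_infinite[OF assms(1)] unfolding card_of_ordIso[symmetric] by blast
  then have p: "inj p" by (simp add: bij_betw_def)
  \<comment> \<open>Resetting the coordinate \<open>j\<close> to the default \<open>z\<close> brings
    the function into the domain of the smaller code.\<close>
  have "inj_on (\<lambda>y. p (y j, c (y(j := z)))) {y. \<forall>i. i \<notin> insert j S \<longrightarrow> y i = z}"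
  proof (rule inj_onI)
    fix x y assume xy: "x \<in> {y. \<forall>i. i \<notin> insert j S \<longrightarrow> y i = z}" "y \<in> {y. \<forall>i. i \<notin> insert j S \<longrightarrow> y i = z}"
      and eq: "p (x j, c (x(j := z))) = p (y j, c (y(j := z)))"
    then have e: "x j = y j" "c (x(j := z)) = c (y(j := z))" using injD[OF p eq] by auto
    have "x(j := z) = y(j := z)" by (rule inj_onD[OF c]) (use e(2) xy in auto)
    then show "x = y" using e(1) by (metis fun_upd_triv fun_upd_upd)
  qed
  then show ?case by blast
qed

section \<open>Copies inside the universe\<close>

definition transport_module :: "('m \<Rightarrow> 'n) \<Rightarrow> ('r, 'm) module \<Rightarrow> ('r, 'n) module" where
  "transport_module c X = \<lparr>carrier = c ` carrier X, mult = (\<lambda>x y. x), one = c \<zero>\<^bsub>X\<^esub>, zero = c \<zero>\<^bsub>X\<^esub>,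
     add = (\<lambda>x y. c (inv_into (carrier X) c x \<oplus>\<^bsub>X\<^esub> inv_into (carrier X) c y)),
     smult = (\<lambda>r x. c (r \<odot>\<^bsub>X\<^esub> inv_into (carrier X) c x))\<rparr>"

lemma transport_module_simps:
  "carrier (transport_module c X) = c ` carrier X" "\<zero>\<^bsub>transport_module c X\<^esub> = c \<zero>\<^bsub>X\<^esub>"
  "inj_on c (carrier X) \<Longrightarrow> x \<in> carrier X \<Longrightarrow> y \<in> carrier X \<Longrightarrow> c x \<oplus>\<^bsub>transport_module c X\<^esub> c y = c (x \<oplus>\<^bsub>X\<^esub> y)"
  "inj_on c (carrier X) \<Longrightarrow> x \<in> carrier X \<Longrightarrow> r \<odot>\<^bsub>transport_module c X\<^esub> c x = c (r \<odot>\<^bsub>X\<^esub> x)"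
  by (simp_all add: transport_module_def)

lemma left_module_transport:
  assumes X: "left_module R X" and c: "inj_on c (carrier X)"
  shows "left_module R (transport_module c X)"
proof -
  interpret left_module R X by fact
  note t = transport_module_simps(1,2) transport_module_simps(3,4)[OF c]
  show ?thesis
  proof (intro left_module.intro left_module_axioms.intro)
    show "abelian_group (transport_module c X)"
    proof (rule abelian_groupI)
      fix x assume "x \<in> carrier (transport_module c X)"
      then obtain y where "y \<in> carrier X" "x = c y" by (auto simp: t)
      then show "\<exists>z \<in> carrier (transport_module c X). z \<oplus>\<^bsub>transport_module c X\<^esub> x = \<zero>\<^bsub>transport_module c X\<^esub>"
        by (intro bexI[of _ "c (\<ominus>\<^bsub>X\<^esub> y)"]) (auto simp: t M.l_neg)
    qed (auto simp: t M.a_ac)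
  qed (auto simp: t R.ring_axioms smult_closed smult_l_distr smult_r_distr smult_assoc1 smult_one)
qed

abbreviation mpa_E where "mpa_E Q lt q X \<equiv> \<lambda>w x. mpa_idem Q lt q w \<odot>\<^bsub>X\<^esub> x"
abbreviation mpa_T where "mpa_T Q lt q X \<equiv> \<lambda>a x. mpa_arrow Q lt q a \<odot>\<^bsub>X\<^esub> x"
abbreviation mpa_G where "mpa_G Q lt q X \<equiv> \<lambda>a x. mpa_factor Q lt q a \<odot>\<^bsub>X\<^esub> x"
abbreviation mpa_space where "mpa_space Q lt q X \<equiv> underlying_space (mpa Q lt q) X"

text \<open>Stated for the bare record \<open>X\<close>, so that the functor can be defined on all
  records without the assumptions of a locale.\<close>

definition refl_raw where
  "refl_raw Q lt v q X = refl_rep.Y Q lt (mpa_space Q lt q X) (mpa_E Q lt q X) (mpa_T Q lt q X)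
      (mpa_G Q lt q X) v"
definition refl_E where
  "refl_E Q lt v q X = refl_rep.Ey (mpa_space Q lt q X) (mpa_E Q lt q X) v"
definition refl_T where
  "refl_T Q lt v q X = refl_rep.Ty Q lt q (mpa_space Q lt q X) (mpa_E Q lt q X) (mpa_T Q lt q X)
      (mpa_G Q lt q X) v"
text \<open>\<open>Z\<close> is a copy inside the universe of the reflection of \<open>X\<close>, along the injection \<open>c\<close>.\<close>

definition reflects ::
  "('v, 'a) pre_digraph \<Rightarrow> 'a darrow rel \<Rightarrow> 'v \<Rightarrow> ('v \<Rightarrow> 'k::field) \<Rightarrow> ('v, 'a, 'k, 'm) mpa_rep \<Rightarrow>
    (('a darrow option \<Rightarrow> 'm) \<Rightarrow> 'm) \<Rightarrow> ('v, 'a, 'k, 'm) mpa_rep \<Rightarrow> bool" where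
  "reflects Q lt v q X c Z \<longleftrightarrow> (let q' = refl_weight Q v q; Y = refl_raw Q lt v q X in
     inj_on c Y \<and> mpa_module Q lt q' Z \<and> carrier Z = c ` Y \<and>
     (\<forall>y \<in> Y. \<forall>z \<in> Y. c y \<oplus>\<^bsub>Z\<^esub> c z = c (\<lambda>i. y i \<oplus>\<^bsub>X\<^esub> z i)) \<and> \<zero>\<^bsub>Z\<^esub> = c (\<lambda>i. \<zero>\<^bsub>X\<^esub>) \<and>
     (\<forall>k. \<forall>y \<in> Y. k \<odot>\<^bsub>mpa_space Q lt q' Z\<^esub> c y = c (\<lambda>i. k \<odot>\<^bsub>mpa_space Q lt q X\<^esub> y i)) \<and>
     (\<forall>w \<in> verts Q. \<forall>y \<in> Y. mpa_E Q lt q' Z w (c y) = c (refl_E Q lt v q X w y)) \<and>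
     (\<forall>a \<in> arcs (double Q). \<forall>y \<in> Y. mpa_T Q lt q' Z a (c y) = c (refl_T Q lt v q X a y)))"

locale refl_module = mpa_module Q lt q X + refl_quiver Q lt v
  for Q :: "('v, 'a) pre_digraph" and lt and q :: "'v \<Rightarrow> 'k::field" and X :: "('v, 'a, 'k, 'm) mpa_rep" and v +
  assumes q_nz: "\<And>w. w \<in> verts Q \<Longrightarrow> q w \<noteq> 0" and q_v: "q v \<noteq> 1"
begin

sublocale rr: refl_rep Q lt q U "mpa_E Q lt q X" "mpa_T Q lt q X" "mpa_G Q lt q X" v
  by (intro refl_rep.intro refl_rep_axioms.intro qrep_of_module refl_quiver_axioms q_nz q_v)

lemma raw_simps:
  "refl_raw Q lt v q X = rr.Y" "refl_E Q lt v q X = rr.Ey" "refl_T Q lt v q X = rr.Ty"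
  by (simp_all add: refl_raw_def refl_E_def refl_T_def)

lemma reflects_exists:
  assumes "infinite (UNIV :: 'm set)"
  shows "\<exists>c Z. reflects Q lt v q X c Z"
proof -
  let ?q = "refl_weight Q v q"
  \<comment> \<open>Elements of \<open>Y\<close> vanish outside \<open>None\<close> and the finitely
    many arrows into \<open>v\<close>.\<close>
  obtain c :: "('a darrow option \<Rightarrow> 'm) \<Rightarrow> 'm" where
    "inj_on c {y. \<forall>i. i \<notin> insert None (Some ` set La) \<longrightarrow> y i = \<zero>\<^bsub>X\<^esub>}"
    using inj_finite_support[OF assms, of "insert None (Some ` set La)"] by blast
  then have c: "inj_on c rr.Y"
  proof (rule inj_on_subset, intro subsetI CollectI allI impI)
    fix y i assume y: "y \<in> rr.Y" and i: "i \<notin> insert None (Some ` set La)"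
    then obtain a where "i = Some a" "a \<notin> set La" by (cases i) auto
    then show "y i = \<zero>\<^bsub>X\<^esub>" using rr.YD(4)[OF y] by simp
  qed
  interpret q: qrep Q lt ?q rr.YM rr.Ey rr.Ty rr.Gy by (rule rr.qrep_reflection)
  obtain Z :: "('v, 'a, 'k, 'a darrow option \<Rightarrow> 'm) mpa_rep"
      where Z: "mpa_module Q lt ?q Z" "carrier Z = carrier rr.YM"
    "add Z = add rr.YM" "zero Z = zero rr.YM"
    "\<And>k y. y \<in> carrier rr.YM \<Longrightarrow> (k \<odot>\<^bsub>mpa Q lt ?q\<^esub> \<one>\<^bsub>mpa Q lt ?q\<^esub>) \<odot>\<^bsub>Z\<^esub> y = k \<odot>\<^bsub>rr.YM\<^esub> y"
    "\<And>w y. w \<in> verts Q \<Longrightarrow> y \<in> carrier rr.YM \<Longrightarrow> mpa_idem Q lt ?q w \<odot>\<^bsub>Z\<^esub> y = rr.Ey w y"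
    "\<And>a y. a \<in> D \<Longrightarrow> y \<in> carrier rr.YM \<Longrightarrow> mpa_arrow Q lt ?q a \<odot>\<^bsub>Z\<^esub> y = rr.Ty a y"
    by (rule q.module_of_qrep) (rule that)
  note Z = Z[unfolded rr.YM_simps(1)]
  have c': "inj_on c (carrier Z)" using c Z(2) by simp
  interpret Z: mpa_module Q lt ?q Z by (rule Z(1))
  interpret T: mpa_module Q lt ?q "transport_module c Z"
    by (intro mpa_module.intro ordered_quiver_axioms left_module_transport[OF Z.left_module_axioms c'])
  have "reflects Q lt v q X c (transport_module c Z)"
    unfolding reflects_def Let_def raw_simps using Z c T.mpa_module_axioms
    by (simp add: transport_module_simps T.U_simps(4) del: U_simps(4))
  then show ?thesis by blast
qed

end

text \<open>The code is chosen together with the copy, because the functor decodes at the source and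
  recodes at the target to act on morphisms.\<close>

definition refl_choice where
  "refl_choice Q lt v q X = (SOME (c, Z). reflects Q lt v q X c Z)"

definition refl_functor where
  "refl_functor Q lt v q = \<lparr>on_obj = (\<lambda>X. snd (refl_choice Q lt v q X)),
     on_hom = (\<lambda>X Z f. \<lambda>u \<in> carrier (snd (refl_choice Q lt v q X)).
       fst (refl_choice Q lt v q Z)
         (\<lambda>i. f (inv_into (refl_raw Q lt v q X) (fst (refl_choice Q lt v q X)) u i)))\<rparr>"

locale refl_copy = refl_module Q lt q X v
  for Q :: "('v, 'a) pre_digraph" and lt and q :: "'v \<Rightarrow> 'k::field" and X :: "('v, 'a, 'k, 'm) mpa_rep" and v +
  fixes c Z
  assumes ref: "reflects Q lt v q X c Z"
begin

abbreviation "q' \<equiv> refl_weight Q v q"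

lemma inj_c: "inj_on c rr.Y" and carrier_Z: "carrier Z = c ` rr.Y"
  and Z_module: "mpa_module Q lt q' Z"
  and c_add: "y \<in> rr.Y \<Longrightarrow> z \<in> rr.Y \<Longrightarrow> c y \<oplus>\<^bsub>Z\<^esub> c z = c (\<lambda>i. y i \<oplus>\<^bsub>X\<^esub> z i)"
  and c_sc: "y \<in> rr.Y \<Longrightarrow> (k \<odot>\<^bsub>mpa Q lt q'\<^esub> \<one>\<^bsub>mpa Q lt q'\<^esub>) \<odot>\<^bsub>Z\<^esub> c y = c (\<lambda>i. k \<odot>\<^bsub>U\<^esub> y i)"
  and c_E: "w \<in> verts Q \<Longrightarrow> y \<in> rr.Y \<Longrightarrow> mpa_E Q lt q' Z w (c y) = c (rr.Ey w y)"
  and c_T: "a \<in> D \<Longrightarrow> y \<in> rr.Y \<Longrightarrow> mpa_T Q lt q' Z a (c y) = c (rr.Ty a y)"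
  using ref unfolding reflects_def Let_def raw_simps by (auto simp: underlying_space_def)

lemma c_closed [simp]: "y \<in> rr.Y \<Longrightarrow> c y \<in> carrier Z" by (simp add: carrier_Z)

sublocale ZZ: refl_module Q lt q' Z v
  by (intro refl_module.intro refl_module_axioms.intro Z_module refl_quiver_axioms refl_weight_ok q_nz q_v)

lemma c_lin: "klinear rr.YM (mpa_space Q lt q' Z) c"
  by (auto simp: klinear_def c_add c_sc ZZ.U_simps(4) simp del: U_simps(4))

definition "d \<equiv> inv_into rr.Y c"
lemma d_c [simp]: "y \<in> rr.Y \<Longrightarrow> d (c y) = y" using inj_c by (simp add: d_def)

end

lemma refl_copy_choice:
  assumes "refl_module Q lt q (X :: ('v, 'a, 'k::field, 'm) mpa_rep) v" "infinite (UNIV :: 'm set)"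
  shows "refl_copy Q lt q X v (fst (refl_choice Q lt v q X)) (snd (refl_choice Q lt v q X))"
proof -
  interpret refl_module Q lt q X v by fact
  have "\<exists>p. case p of (c, Z) \<Rightarrow> reflects Q lt v q X c Z" using reflects_exists[OF assms(2)] by auto
  from someI_ex[OF this] show ?thesis
    by (intro refl_copy.intro refl_copy_axioms.intro assms(1)) (simp add: refl_choice_def split: prod.splits)
qed

locale refl_copy_hom = A1: refl_copy Q lt q X v c Z + A2: refl_copy Q lt q X' v c' Z'
  for Q :: "('v, 'a) pre_digraph" and lt and q :: "'v \<Rightarrow> 'k::field" and X :: "('v, 'a, 'k, 'm) mpa_rep" and v c Z
    and X' :: "('v, 'a, 'k, 'm) mpa_rep" and c' Z' +
  fixes f :: "'m \<Rightarrow> 'm"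
  assumes hom: "f \<in> left_module_hom (mpa Q lt q) X X'"
begin

sublocale refl_hom Q lt q A1.U "mpa_E Q lt q X" "mpa_T Q lt q X" "mpa_G Q lt q X" v
  A2.U "mpa_E Q lt q X'" "mpa_T Q lt q X'" "mpa_G Q lt q X'" f
proof (intro refl_hom.intro refl_hom_axioms.intro A1.rr.refl_rep_axioms A2.rr.refl_rep_axioms)
  show "klinear A1.U A2.U f"
    using hom A1.Lsm(1)[of "\<one>\<^bsub>mpa Q lt q\<^esub>"] by (auto simp: klinear_def left_module_hom_def)
qed (use hom A1.idem_closed A1.arrow_closed in \<open>auto simp: left_module_hom_def\<close>)

definition "Ff = (\<lambda>u \<in> carrier Z. c' (\<lambda>i. f (A1.d u i)))"

lemma Ff_c: "y \<in> A1.rr.Y \<Longrightarrow> Ff (c y) = c' (\<lambda>i. f (y i))" by (simp add: Ff_def)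

lemma Ff_hom: "Ff \<in> left_module_hom (mpa Q lt (refl_weight Q v q)) Z Z'"
proof -
  let ?q = "refl_weight Q v q"
  have ex: "\<exists>y \<in> A1.rr.Y. u = c y" if "u \<in> carrier Z" for u using that by (auto simp: A1.carrier_Z)
  have lin: "klinear (mpa_space Q lt ?q Z) (mpa_space Q lt ?q Z') Ff"
  proof -
    have "Ff (u \<oplus>\<^bsub>Z\<^esub> w) = Ff u \<oplus>\<^bsub>Z'\<^esub> Ff w" if "u \<in> carrier Z" "w \<in> carrier Z" for u w
      using ex[OF that(1)] ex[OF that(2)] A1.rr.Y_add A1.rr.YD(1) f_simps(2)
      by (auto simp: A1.c_add A2.c_add Ff_c f_Y)
    moreover have "Ff ((k \<odot>\<^bsub>mpa Q lt ?q\<^esub> \<one>\<^bsub>mpa Q lt ?q\<^esub>) \<odot>\<^bsub>Z\<^esub> u) =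
        (k \<odot>\<^bsub>mpa Q lt ?q\<^esub> \<one>\<^bsub>mpa Q lt ?q\<^esub>) \<odot>\<^bsub>Z'\<^esub> Ff u" if "u \<in> carrier Z" for k u
      using ex[OF that] A1.rr.Y_sc[of _ k] f_simps(3) A1.rr.YD(1)
      by (auto simp: A1.c_sc A2.c_sc Ff_c f_Y)
    moreover have "Ff u \<in> carrier Z'" if "u \<in> carrier Z" for u
      using ex[OF that] by (auto simp: Ff_c f_Y)
    ultimately show ?thesis by (auto simp: klinear_def A1.ZZ.U_simps A2.ZZ.U_simps)
  qed
  have E: "Ff (mpa_E Q lt ?q Z w u) = mpa_E Q lt ?q Z' w (Ff u)" if "w \<in> verts Q" "u \<in> carrier Z" for w u
    using ex[OF that(2)] that(1) klinearD(1)[OF A1.rr.Ey_lin[OF that(1)]]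
    by (auto simp: A1.c_E A2.c_E Ff_c f_Y f_Ey)
  have T: "Ff (mpa_T Q lt ?q Z a u) = mpa_T Q lt ?q Z' a (Ff u)" if "a \<in> arcs (double Q)" "u \<in> carrier Z"
      for a u
    using ex[OF that(2)] that(1) klinearD(1)[OF A1.rr.Ty_lin[OF that(1)]]
    by (auto simp: A1.c_T A2.c_T Ff_c f_Y f_Ty)
  have "Ff (r \<odot>\<^bsub>Z\<^esub> u) = r \<odot>\<^bsub>Z'\<^esub> Ff u" if "r \<in> carrier (mpa Q lt ?q)" "u \<in> carrier Z" for r u
    by (rule mpa_hom_criterion[OF A1.Z_module A2.Z_module lin E T that])
  then show ?thesis using klinearD(1,2)[OF lin] by (auto simp: left_module_hom_def Ff_def)
qed

end

theorem refl_functor_is_functor: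
  fixes Q :: "('v, 'a) pre_digraph" and lt v and q :: "'v \<Rightarrow> 'k::field"
  assumes inf: "infinite (UNIV :: 'm set)"
    and ok: "\<And>X :: ('v, 'a, 'k, 'm) mpa_rep. left_module (mpa Q lt q) X \<Longrightarrow> refl_module Q lt q X v"
  shows "is_functor (module_category (mpa Q lt q) :: (('v, 'a, 'k, 'm) mpa_rep, _) category)
    (module_category (mpa Q lt (refl_weight Q v q))) (refl_functor Q lt v q)"
proof -
  let ?c = "\<lambda>X. fst (refl_choice Q lt v q X)"
      and ?Z = "\<lambda>X :: ('v, 'a, 'k, 'm) mpa_rep. snd (refl_choice Q lt v q X)"
  have copy: "refl_copy Q lt q X v (?c X) (?Z X)" if "left_module (mpa Q lt q) X"
      for X :: "('v, 'a, 'k, 'm) mpa_rep"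
    by (rule refl_copy_choice[OF ok[OF that] inf])
  have lm: "left_module (mpa Q lt (refl_weight Q v q)) (?Z X)" if "left_module (mpa Q lt q) X"
      for X :: "('v, 'a, 'k, 'm) mpa_rep"
    using refl_copy.Z_module[OF copy[OF that]] by (simp add: mpa_module_def)
  have ch: "refl_copy_hom Q lt q X v (?c X) (?Z X) X' (?c X') (?Z X') f"
    if "left_module (mpa Q lt q) X" "left_module (mpa Q lt q) X'" "f \<in> left_module_hom (mpa Q lt q) X X'"
        for X X' :: "('v, 'a, 'k, 'm) mpa_rep" and f
    using copy that by (intro refl_copy_hom.intro refl_copy_hom_axioms.intro)
  have on_hom: "on_hom (refl_functor Q lt v q) X X' f = refl_copy_hom.Ff Q lt q X v (?c X) (?Z X) (?c X') f"
    if "left_module (mpa Q lt q) X" "left_module (mpa Q lt q) X'" "f \<in> left_module_hom (mpa Q lt q) X X'"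
        for X X' :: "('v, 'a, 'k, 'm) mpa_rep" and f
  proof -
    interpret refl_copy_hom Q lt q X v "?c X" "?Z X" X' "?c X'" "?Z X'" f using that by (rule ch)
    show ?thesis by (simp add: Ff_def refl_functor_def A1.d_def A1.raw_simps)
  qed
  have on_obj: "on_obj (refl_functor Q lt v q) X = ?Z X" for X by (simp add: refl_functor_def)
  show ?thesis
    unfolding is_functor_def module_category_def category.simps on_obj
  proof (intro conjI ballI)
    fix X :: "('v, 'a, 'k, 'm) mpa_rep" assume X: "X \<in> {X. left_module (mpa Q lt q) X}"
    then show "?Z X \<in> {X. left_module (mpa Q lt (refl_weight Q v q)) X}" using lm by simp
  next
    fix X X' :: "('v, 'a, 'k, 'm) mpa_rep" and f assume "X \<in> {X :: ('v, 'a, 'k, 'm) mpa_rep. left_module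
        (mpa Q lt q) X}" "X' \<in> {X. left_module (mpa Q lt q) X}"
      and f: "f \<in> left_module_hom (mpa Q lt q) X X'"
    then have X: "left_module (mpa Q lt q) X" "left_module (mpa Q lt q) X'" by simp_all
    show "on_hom (refl_functor Q lt v q) X X' f \<in> left_module_hom (mpa Q lt (refl_weight Q v q)) (?Z X) (?Z X')"
      unfolding on_hom[OF X f] by (rule refl_copy_hom.Ff_hom[OF ch[OF X f]])
  next
    fix X :: "('v, 'a, 'k, 'm) mpa_rep" assume "X \<in> {X. left_module (mpa Q lt q) X}"
    then have X: "left_module (mpa Q lt q) X" by simp
    let ?f = "\<lambda>x \<in> carrier X. x"
    interpret X: left_module "mpa Q lt q" X by (rule X)
    have f: "?f \<in> left_module_hom (mpa Q lt q) X X" by (auto simp: left_module_hom_def X.smult_closed)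
    interpret refl_copy_hom Q lt q X v "?c X" "?Z X" X "?c X" "?Z X" ?f by (rule ch[OF X X f])
    have "Ff = (\<lambda>u \<in> carrier (?Z X). u)"
    proof (rule extensionalityI[of _ "carrier (?Z X)"])
      fix u assume "u \<in> carrier (?Z X)"
      then obtain y where y: "y \<in> A1.rr.Y" "u = ?c X y" by (auto simp: A1.carrier_Z)
      then have "(\<lambda>i. ?f (y i)) = y" using A1.rr.YD(1)[OF y(1)] by auto
      then show "Ff u = (\<lambda>u \<in> carrier (?Z X). u) u" using y by (simp add: Ff_c)
    qed (simp_all add: Ff_def)
    then show "on_hom (refl_functor Q lt v q) X X ?f = (\<lambda>u \<in> carrier (?Z X). u)" unfolding on_hom[OF X X f] .
  next
    fix X X' X'' :: "('v, 'a, 'k, 'm) mpa_rep"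
        and f g assume "X \<in> {X :: ('v, 'a, 'k, 'm) mpa_rep. left_module (mpa Q lt q) X}"
        "X' \<in> {X. left_module (mpa Q lt q) X}"
      "X'' \<in> {X. left_module (mpa Q lt q) X}"
      and f: "f \<in> left_module_hom (mpa Q lt q) X X'" and g: "g \<in> left_module_hom (mpa Q lt q) X' X''"
    then have X: "left_module (mpa Q lt q) X" "left_module (mpa Q lt q) X'" "left_module (mpa Q lt q) X''"
        by simp_all
    let ?h = "compose (carrier X) g f"
    interpret X: left_module "mpa Q lt q" X by (rule X)
    have h: "?h \<in> left_module_hom (mpa Q lt q) X X''"
      using f g by (auto simp: left_module_hom_def compose_eq X.smult_closed PiE_iff Pi_iff)
    interpret f: refl_copy_hom Q lt q X v "?c X" "?Z X" X' "?c X'" "?Z X'" f by (rule ch[OF X(1,2) f])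
    interpret g: refl_copy_hom Q lt q X' v "?c X'" "?Z X'" X'' "?c X''" "?Z X''" g by (rule ch[OF X(2,3) g])
    interpret h: refl_copy_hom Q lt q X v "?c X" "?Z X" X'' "?c X''" "?Z X''" ?h by (rule ch[OF X(1,3) h])
    have "h.Ff = compose (carrier (?Z X)) g.Ff f.Ff"
    proof (rule extensionalityI[of _ "carrier (?Z X)"])
      fix u assume u: "u \<in> carrier (?Z X)"
      then obtain y where y: "y \<in> f.A1.rr.Y" "u = ?c X y" by (auto simp: f.A1.carrier_Z)
      then have "(\<lambda>i. ?h (y i)) = (\<lambda>i. g (f (y i)))" using f.A1.rr.YD(1)[OF y(1)] by (auto simp: compose_eq)
      then show "h.Ff u = compose (carrier (?Z X)) g.Ff f.Ff u"
        using y u by (simp add: h.Ff_c f.Ff_c g.Ff_c f.f_Y compose_eq)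
    qed (simp_all add: h.Ff_def)
    then show "on_hom (refl_functor Q lt v q) X X'' ?h =
        compose (carrier (?Z X)) (on_hom (refl_functor Q lt v q) X' X'' g)
            (on_hom (refl_functor Q lt v q) X X' f)"
      unfolding on_hom[OF X(1,3) h] on_hom[OF X(2,3) g] on_hom[OF X(1,2) f] .
  qed
qed

section \<open>Reflecting twice\<close>

lemma (in kspace) diff_zero [simp]: "x \<in> carrier M \<Longrightarrow> x \<ominus> \<zero> = x"
  by (simp add: a_minus_def)

text \<open>\<open>N\<close> is any copy of the reflection of \<open>M\<close>, along
  \<open>c\<close>. Its own reflection \<open>N.YM\<close> is what gets compared with
  \<open>M\<close>.\<close>

locale refl_twice = refl_rep Q lt q M E T G v + N: refl_rep Q lt "refl_weight Q v q" N E2 T2 G2 v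
  for Q :: "('v, 'a) pre_digraph" and lt and q :: "'v \<Rightarrow> 'k::field" and M :: "('k, 'm) module" (structure)
    and E T G v and N :: "('k, 'n) module" and E2 T2 G2 +
  fixes c :: "('a darrow option \<Rightarrow> 'm) \<Rightarrow> 'n"
  assumes inj_c: "inj_on c Y" and carrier_N: "carrier N = c ` Y" and c_lin: "klinear YM N c"
    and c_E: "\<And>w y. w \<in> verts Q \<Longrightarrow> y \<in> Y \<Longrightarrow> c (Ey w y) = E2 w (c y)"
    and c_T: "\<And>a y. a \<in> D \<Longrightarrow> y \<in> Y \<Longrightarrow> c (Ty a y) = T2 a (c y)"
begin

sublocale yy: refl_rep Q lt "refl_weight Q v q" YM Ey Ty Gy v
  by (intro refl_rep.intro refl_rep_axioms.intro qrep_reflection refl_quiver_axioms N.q_nz N.q_v)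

sublocale cc: refl_hom Q lt "refl_weight Q v q" YM Ey Ty Gy v N E2 T2 G2 c
  by (intro refl_hom.intro refl_hom_axioms.intro yy.refl_rep_axioms N.refl_rep_axioms c_lin)
      (simp_all add: c_E c_T)

sublocale yN: qrep Q lt "refl_weight Q v (refl_weight Q v q)" N.YM N.Ey N.Ty N.Gy
  by (rule N.qrep_reflection)

lemma c_simps:
  "y \<in> Y \<Longrightarrow> c y \<in> carrier N" "c (\<lambda>i. \<zero>) = \<zero>\<^bsub>N\<^esub>"
  "y \<in> Y \<Longrightarrow> z \<in> Y \<Longrightarrow> c (\<lambda>i. y i \<oplus> z i) = c y \<oplus>\<^bsub>N\<^esub> c z"
  "y \<in> Y \<Longrightarrow> c (\<lambda>i. k \<odot> y i) = k \<odot>\<^bsub>N\<^esub> c y"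
  using cc.f_simps(1-4) by simp_all

lemma c_eq_iff: "y \<in> Y \<Longrightarrow> z \<in> Y \<Longrightarrow> c y = c z \<longleftrightarrow> y = z" using inj_onD[OF inj_c] by blast

end

section \<open>The second reflection in terms of the columns \<open>Bc\<close>\<close>

context refl_rep
begin

text \<open>The new b is \<open>Bc a\<close> for both signs. For \<open>eps a = -1\<close> let e be
  the component at the tail and z = \<open>q v\<close> \<open>G (star a)\<close> e. The new arrow
  gives - \<open>Bc a\<close> z, whose coordinate at \<open>a\<close> is z - e, so \<open>Gy\<close>
  turns it into - \<open>Bc a\<close> z + \<open>Bc a\<close> (z - e) = - \<open>Bc a\<close>
  e.\<close>

lemma B_refl:
  assumes a: "a \<in> set La" and y: "y \<in> Y"
  shows "qrep.B YM Ty Gy a y = pr \<zero> (Bc a (E (tt a) (y None)))"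
proof -
  interpret R: qrep Q lt "refl_weight Q v q" YM Ey Ty Gy by (rule qrep_reflection)
  note yd = YD[OF y] La_D(1)[OF a]
  have hv: "hh a = v" using a by (simp add: set_La)
  show ?thesis
  proof (cases "eps a = 1")
    case True
    then show ?thesis using hv by (simp add: R.B_def Ty_def)
  next
    case False
    let ?e = "E (tt a) (y None)" and ?z = "q v \<odot> G (star a) (E (tt a) (y None))"
    have e: "?e \<in> carrier M" "?z \<in> carrier M" using yd by simp_all
    have T: "Ty a y = pr \<zero> (\<lambda>d. (-1) \<odot> Bc a ?z d)" using False hv by (simp add: Ty_def)
    have TY: "Ty a y \<in> Y" "Gy a (Ty a y) \<in> Y"
      using R.T_closed[OF yd(6), of y] R.G_closed[OF yd(6), of "Ty a y"] y by simp_all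
    have "(-1) \<odot> Bc a ?z a = ?z \<oplus> (-1) \<odot> ?e" using Gstar_diag[OF a e(1)] e by (simp add: vec_simps)
    then have "Gy a (Ty a y) = pr \<zero> (\<lambda>d. (-1) \<odot> Bc a ?z d \<oplus> Bc a (?z \<oplus> (-1) \<odot> ?e) d)"
      using hv by (simp add: Gy_def T)
    also have "\<dots> = pr \<zero> (\<lambda>d. (-1) \<odot> Bc a ?e d)"
      using e Bc_simps(1)[OF a] by (simp add: pr_eq_iff Bc_simps[OF a]) (simp add: Bc_simps(1)[OF a] vec_simps)
    finally have G: "Gy a (Ty a y) = pr \<zero> (\<lambda>d. (-1) \<odot> Bc a ?e d)" .
    have "R.B a y = (\<lambda>i. \<zero> \<ominus> Gy a (Ty a y) i)"
      using False minus_YM[OF Y_zero TY(2)] by (simp add: R.B_def)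
    then show ?thesis using e Bc_simps(1)[OF a] by (auto simp: G fun_eq_iff vec_simps split: option.splits)
  qed
qed

text \<open>The map \<pi> of the reflection is \<open>tz\<close>: \<open>Gy a\<close> adds
  \<open>Bc a\<close> of the coordinate at \<open>a\<close> and the new b adds \<open>Bc a\<close>
  of \<open>x a\<close>, which together are the recursion.\<close>

lemma tsum_refl:
  assumes x: "\<And>a. a \<in> set La \<Longrightarrow> x a \<in> carrier M \<and> E (tt a) (x a) = x a" and "set as \<subseteq> set La"
  shows "qrep.tsum YM Ty Gy as (\<lambda>a. pr (x a) (\<lambda>d. \<zero>)) = pr \<zero> (tz as x)"
  using assms(2)
proof (induction as)
  interpret R: qrep Q lt "refl_weight Q v q" YM Ey Ty Gy by (rule qrep_reflection)
  case Nil
  show ?case by (auto simp: fun_eq_iff split: option.splits)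
next
  interpret R: qrep Q lt "refl_weight Q v q" YM Ey Ty Gy by (rule qrep_reflection)
  case (Cons a as)
  have a: "a \<in> set La" "hh a = v" "a \<in> D" using Cons.prems by (simp_all add: set_La)
  have tzc: "tz as x d \<in> carrier M" if "set as \<subseteq> set La" for as d
    using that x by (induction as arbitrary: d) (simp_all add: Bc_simps)
  have "E v (x a) = \<zero>" using x[OF a(1)] E_E[OF v, of "tt a" "x a"] no_loop(1)[OF a(3,2)] a by simp
  then have "R.B a (pr (x a) (\<lambda>d. \<zero>)) = pr \<zero> (Bc a (x a))"
    using B_refl[OF a(1), of "pr (x a) (\<lambda>d. \<zero>)"] x[OF a(1)] by (simp add: Y_nz)
  moreover have as: "set as \<subseteq> set La" using Cons.prems by simp
  ultimately have "R.tsum (a # as) (\<lambda>a. pr (x a) (\<lambda>d. \<zero>)) = (\<lambda>i. Gy a (pr \<zero> (tz as x)) i \<oplus> pr \<zero> (Bc a (x a)) i)"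
    using Cons.IH by simp
  also have "\<dots> = pr \<zero> (tz (a # as) x)"
    using a x[OF a(1)] tzc[OF as]
    by (auto simp: Gy_def fun_eq_iff Bc_simps(1,2)[OF a(1)] a_assoc split: option.splits)
  finally show ?case .
qed

end

section \<open>Comparison with the double reflection\<close>

context refl_twice
begin

text \<open>The space at \<open>v\<close> after two reflections is ker \<pi>', which is the image of
  \<mu>. The map identifies the old space at \<open>v\<close> with it by \<mu> and keeps everything
  away from \<open>v\<close>. The vectors sit in the slot \<open>None\<close> of \<open>Y\<close>,
  since the tails of the arrows into \<open>v\<close> differ from \<open>v\<close>.\<close>

definition theta :: "'m \<Rightarrow> 'a darrow option \<Rightarrow> 'n" where
  "theta x = case_option (c (pr (x \<ominus> E v x) (\<lambda>a. \<zero>)))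
     (\<lambda>d. if d \<in> set La then c (pr (T (star d) x) (\<lambda>a. \<zero>)) else c (\<lambda>i. \<zero>))"

lemma nz_Y:
  "x \<in> carrier M \<Longrightarrow> pr (x \<ominus> E v x) (\<lambda>a. \<zero>) \<in> Y"
  "d \<in> set La \<Longrightarrow> x \<in> carrier M \<Longrightarrow> pr (T (star d) x) (\<lambda>a. \<zero>) \<in> Y"
proof -
  show "x \<in> carrier M \<Longrightarrow> pr (x \<ominus> E v x) (\<lambda>a. \<zero>) \<in> Y"
    using v by (intro Y_nz) (simp_all add: lin_simps E_E vec_simps)
  show "d \<in> set La \<Longrightarrow> x \<in> carrier M \<Longrightarrow> pr (T (star d) x) (\<lambda>a. \<zero>) \<in> Y"
    using v no_loop(1)[of d] E_T_if[OF v, of "star d" x] by (intro Y_nz) (simp_all add: set_La)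
qed

lemma tsum_N:
  assumes x: "\<And>a. a \<in> set La \<Longrightarrow> x a \<in> carrier M \<and> E (tt a) (x a) = x a"
  shows "N.tsum La (\<lambda>a. c (pr (x a) (\<lambda>d. \<zero>))) = c (pr \<zero> (tz La x))" "pr \<zero> (tz La x) \<in> Y"
proof -
  have "pr (x a) (\<lambda>d. \<zero>) \<in> Y" if "a \<in> set La" for a
    using x[OF that] E_E[OF v, of "tt a" "x a"] that no_loop[of a] La_D(1)[OF that] by (intro Y_nz)
        (auto simp: set_La)
  then show "N.tsum La (\<lambda>a. c (pr (x a) (\<lambda>d. \<zero>))) = c (pr \<zero> (tz La x))" "pr \<zero> (tz La x) \<in> Y"
    using cc.f_tsum[of La "\<lambda>a. pr (x a) (\<lambda>d. \<zero>)"] yy.tsum_closed[of La "\<lambda>a. pr (x a) (\<lambda>d. \<zero>)"]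
        tsum_refl[OF x, of La] La_D(2) by simp_all
qed

lemma tz_off: "d \<notin> set La \<Longrightarrow> tz as x d = \<zero>"
  by (induction as) (simp_all add: Bc_off)

lemma theta_Y: assumes x: "x \<in> carrier M" shows "theta x \<in> N.Y"
proof (rule N.Y_I)
  show "theta x None \<in> carrier N" using nz_Y(1)[OF x] by (simp add: theta_def c_simps)
  show "E2 v (theta x None) = \<zero>\<^bsub>N\<^esub>"
    using nz_Y(1)[OF x] v x by (simp add: theta_def c_E[symmetric] Ey_def pr_eq_iff fun_upd_def
        option.case_eq_if c_simps(2)[symmetric])
      (rule arg_cong[of _ _ c], auto simp: fun_eq_iff split: option.splits)
  show "theta x (Some a) \<in> carrier N" if "a \<in> set La" for a using nz_Y(2)[OF that x] that by
      (simp add: theta_def c_simps)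
  show "E2 (tt a) (theta x (Some a)) = theta x (Some a)" if a: "a \<in> set La" for a
    using nz_Y(2)[OF that x] that x La_D(1)[OF a] no_loop(1)[OF La_D(1)[OF a]] E_T[of "star a" x]
    by (simp add: theta_def c_E[symmetric] Ey_def set_La)
  show "theta x (Some a) = \<zero>\<^bsub>N\<^esub>" if "a \<notin> set La" for a using that by (simp add: theta_def c_simps)
  let ?x = "\<lambda>a. T (star a) x"
  have x': "?x a \<in> carrier M \<and> E (tt a) (?x a) = ?x a" if "a \<in> set La" for a
    using La_D(1)[OF that] x E_T[of "star a" x] by simp
  have "N.tsum La (\<lambda>a. theta x (Some a)) = N.tsum La (\<lambda>a. c (pr (?x a) (\<lambda>d. \<zero>)))"
    by (rule N.tsum_cong) (simp add: theta_def)
  also have "\<dots> = c (pr \<zero> (tz La ?x))" by (rule tsum_N(1)) (rule x')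
  \<comment> \<open>This is \<pi>' \<mu> = s (\<mu> + \<mu> \<pi> \<mu>) - \<mu> = s (1 +
    (\<open>q v\<close> - 1)) \<mu> - \<mu> = 0.\<close>
  also have "tz La ?x d = \<zero>" for d
  proof (cases "d \<in> set La")
    case True
    have "T (star d) (E v x) = T (star d) x" using True x T_E[of "star d" x] by (simp add: set_La)
    then show ?thesis using True tz_eq[of "[]" La ?x d] x x' La_D(1)[OF True] v
      by (simp add: tsum_La_star lin_simps vec_simps)
  qed (simp add: tz_off)
  then have "pr \<zero> (tz La ?x) = (\<lambda>i. \<zero>)" by (simp add: pr_eq_iff)
  finally show "N.tsum La (\<lambda>a. theta x (Some a)) = \<zero>\<^bsub>N\<^esub>" by (simp add: c_simps)
qed

lemma theta_lin: "klinear M N.YM theta"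
proof -
  have add: "theta (x \<oplus> y) i = theta x i \<oplus>\<^bsub>N\<^esub> theta y i" if "x \<in> carrier M" "y \<in> carrier M" for x y i
  proof -
    have "c (pr (x \<oplus> y \<ominus> E v (x \<oplus> y)) (\<lambda>a. \<zero>)) = c (\<lambda>i. pr (x \<ominus> E v x) (\<lambda>a. \<zero>) i \<oplus> pr (y \<ominus> E v y) (\<lambda>a. \<zero>) i)"
      using that v by (intro arg_cong[of _ _ c]) (simp add: pr_eq_iff lin_simps vec_simps)
    moreover have "c (pr (T (star d) (x \<oplus> y)) (\<lambda>a. \<zero>)) = c (\<lambda>i. pr (T (star d) x) (\<lambda>a. \<zero>) i \<oplus> pr
        (T (star d) y) (\<lambda>a. \<zero>) i)" if "d \<in> set La" for d
      using \<open>x \<in> carrier M\<close> \<open>y \<in> carrier M\<close> that La_D(1)[OF that] by (intro arg_cong[of _ _ c])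
          (simp add: pr_eq_iff lin_simps)
    ultimately show ?thesis using that nz_Y by (cases i) (simp_all add: theta_def c_simps)
  qed
  have sc: "theta (k \<odot> x) i = k \<odot>\<^bsub>N\<^esub> theta x i" if "x \<in> carrier M" for x k i
  proof -
    have "c (pr (k \<odot> x \<ominus> E v (k \<odot> x)) (\<lambda>a. \<zero>)) = c (\<lambda>i. k \<odot> pr (x \<ominus> E v x) (\<lambda>a. \<zero>) i)"
      using that v by (intro arg_cong[of _ _ c]) (simp add: pr_eq_iff lin_simps vec_simps)
    moreover have "c (pr (T (star d) (k \<odot> x)) (\<lambda>a. \<zero>)) = c (\<lambda>i. k \<odot> pr (T (star d) x) (\<lambda>a. \<zero>) i)"
        if "d \<in> set La" for d
      using \<open>x \<in> carrier M\<close> that La_D(1)[OF that] by (intro arg_cong[of _ _ c]) (simp add: pr_eq_iff lin_simps)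
    ultimately show ?thesis using that nz_Y by (cases i) (simp_all add: theta_def c_simps)
  qed
  show ?thesis using add sc theta_Y by (auto simp: klinear_def)
qed

lemmas theta_simps = klinearD[OF theta_lin] klinear_zero_minus(1,3)[OF kspace_axioms N.kspace_YM theta_lin]

lemma theta_E: assumes w: "w \<in> verts Q" and x: "x \<in> carrier M" shows "theta (E w x) = N.Ey w (theta x)"
proof (cases "w = v")
  case True
  have "T (star d) (E v x) = T (star d) x" if "d \<in> set La" for d using that x T_E[of "star d" x] by
      (simp add: set_La)
  then show ?thesis using True x w
    by (auto simp: theta_def N.Ey_def E_E fun_eq_iff lin_simps vec_simps c_simps(2)[symmetric] intro!:
        arg_cong[of _ _ c] split: option.splits)
next
  case False
  have "T (star d) (E w x) = \<zero>" if "d \<in> set La" for d using that x w False T_E_if[of w "star d" x] by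
      (simp add: set_La)
  moreover have "E2 w (c (pr (x \<ominus> E v x) (\<lambda>a. \<zero>))) = c (pr (E w x \<ominus> E v (E w x)) (\<lambda>a. \<zero>))"
    using False w v x nz_Y(1)[OF x] by (simp add: c_E[symmetric] Ey_def lin_simps E_E)
  moreover have "c (pr \<zero> (\<lambda>a. \<zero>)) = \<zero>\<^bsub>N\<^esub>" unfolding c_simps(2)[symmetric] by (rule arg_cong[of _ _ c])
      (simp add: pr_eq_iff)
  ultimately show ?thesis using False
    by (auto simp: theta_def N.Ey_def fun_eq_iff c_simps(2) split: option.splits)
qed

lemma theta_away:
  assumes "x \<in> carrier M" "E v x = \<zero>"
  shows "theta x = case_option (c (pr x (\<lambda>a. \<zero>))) (\<lambda>d. \<zero>\<^bsub>N\<^esub>)"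
proof -
  have "T (star d) x = \<zero>" if "d \<in> set La" for d using that assms T_E[of "star d" x] by
      (simp add: set_La lin_simps)
  moreover have "c (pr \<zero> (\<lambda>a. \<zero>)) = \<zero>\<^bsub>N\<^esub>" unfolding c_simps(2)[symmetric] by (rule arg_cong[of _ _ c])
      (simp add: pr_eq_iff)
  ultimately show ?thesis using assms by (auto simp: theta_def fun_eq_iff c_simps(2) vec_simps split:
      option.splits)
qed

lemma theta_T_tail:
  assumes a: "a \<in> D" "tt a = v" and x: "x \<in> carrier M"
  shows "theta (T a x) = N.Ty a (theta x)"
proof -
  have h: "hh a \<noteq> v" using a no_loop by blast
  then have "E v (T a x) = \<zero>" using a x v by (simp add: E_T_if)
  then show ?thesis using a x h theta_away[of "T a x"] by (simp add: N.Ty_def theta_def set_La)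
qed

lemma theta_T_away:
  assumes a: "a \<in> D" "tt a \<noteq> v" "hh a \<noteq> v" and x: "x \<in> carrier M"
  shows "theta (T a x) = N.Ty a (theta x)"
proof -
  have "E v (T a x) = \<zero>" "T a (E v x) = \<zero>" using a x v by (simp_all add: E_T_if T_E_if)
  moreover from this have "T2 a (theta x None) = c (pr (T a x) (\<lambda>a. \<zero>))"
    using a v x nz_Y(1)[OF x] by (simp add: theta_def c_T[symmetric] Ty_def lin_simps vec_simps)
  ultimately show ?thesis using a x theta_away[of "T a x"] by (simp add: N.Ty_def)
qed

text \<open>The second reflection rescales by \<open>q v\<close> where the first did by its inverse.
  So each of the three cases of \<open>Bc\<close> is undone, and the column of \<open>a\<close> is
  again that of the products of \<open>T (star d)\<close> and \<open>B a\<close>, which is \<mu> of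
  \<open>B a x\<close>.\<close>

lemma theta_B:
  assumes a: "a \<in> set La" and x: "x \<in> carrier M"
  shows "theta (B a x) = yN.B a (theta x)"
proof -
  have aD: "a \<in> D" "hh a = v" using a by (simp_all add: set_La)
  have tv: "tt a \<noteq> v" using no_loop aD by blast
  let ?e = "E (tt a) x"
  have e: "?e \<in> carrier M" "E v ?e = \<zero>" "E (tt a) ?e = ?e" "B a ?e = B a x" using aD x v tv by
      (simp_all add: E_E B_E_if)
  have eY: "pr ?e (\<lambda>a. \<zero>) \<in> Y" using e by (simp add: Y_nz)
  let ?n = "c (pr ?e (\<lambda>a. \<zero>))"
  have "E2 (tt a) (theta x None) = ?n"
    using tv aD v x nz_Y(1)[OF x] by (simp add: theta_def c_E[symmetric] Ey_def lin_simps E_E vec_simps)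
  then have 1: "yN.B a (theta x) = case_option \<zero>\<^bsub>N\<^esub> (N.Bc a ?n)"
    using N.B_refl[OF a theta_Y[OF x]] by simp
  have BY: "pr \<zero> (Bc a ?e) \<in> Y" using Y_Bc[OF a e(1,3)] .
  have B2: "N.B a ?n = c (pr \<zero> (Bc a ?e))"
    using cc.f_B[OF aD(1), of "pr ?e (\<lambda>a. \<zero>)"] B_refl[OF a eY] eY e(3) by simp
  have T2: "T2 (star d) (N.B a ?n) = c (pr (Bc a ?e d) (\<lambda>a. \<zero>))" if d: "d \<in> set La" for d
    unfolding B2 using d BY no_loop(1)[of d] by (simp add: c_T[symmetric] Ty_def set_La)
  have YB: "pr (Bc a ?e d) (\<lambda>a. \<zero>) \<in> Y" if d: "d \<in> set La" for d
    using d e E_Bc[OF a e(1,3) d] E_E[OF v, of "tt d" "Bc a ?e d"] no_loop[of d] Bc_simps(1)[OF a e(1)]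
    by (intro Y_nz) (auto simp: set_La)
  have key: "N.Bc a ?n d = c (pr (T (star d) (B a x)) (\<lambda>a. \<zero>))" if d: "d \<in> set La" for d
  proof -
    have dD: "d \<in> D" using d La_D by blast
    have bx: "B a x \<in> carrier M" using aD x by simp
    have s': "inverse (refl_weight Q v q v) = q v" by (simp add: refl_weight_v)
    have TY: "pr (T (star d) (B a x)) (\<lambda>a. \<zero>) \<in> Y" using nz_Y(2)[OF d bx] .
    consider "(d, a) \<in> lt" | "d = a" | "(d, a) \<notin> lt" "d \<noteq> a" by blast
    then show ?thesis
    proof cases
      case 1
      then show ?thesis using d T2[OF d] e(4) by (simp add: N.Bc_def Bc_def)
    next
      case 2
      \<comment> \<open>On the diagonal: q (e + (s (e + a' b e) - e)) - e = a' b e, where q s =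
        1.\<close>
      let ?w = "\<lambda>i. q v \<odot> (pr ?e (\<lambda>a. \<zero>) i \<oplus> pr (Bc a ?e a) (\<lambda>a. \<zero>) i)"
      have wY: "(\<lambda>i. pr ?e (\<lambda>a. \<zero>) i \<oplus> pr (Bc a ?e a) (\<lambda>a. \<zero>) i) \<in> Y" using Y_add[OF eY YB[OF a]] .
      have "N.Bc a ?n d = q v \<odot>\<^bsub>N\<^esub> (?n \<oplus>\<^bsub>N\<^esub> c (pr (Bc a ?e a) (\<lambda>a. \<zero>))) \<ominus>\<^bsub>N\<^esub> ?n"
        using 2 T2[OF a] a by (simp add: N.Bc_diag s')
      also have "\<dots> = c ?w \<ominus>\<^bsub>N\<^esub> ?n"
        using c_simps(4)[OF wY, of "q v"] c_simps(3)[OF eY YB[OF a]] by simp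
      also have "\<dots> = c (\<lambda>i. ?w i \<ominus> pr ?e (\<lambda>a. \<zero>) i)"
        using cc.f_simps(5)[of ?w "pr ?e (\<lambda>a. \<zero>)"] Y_sc[OF wY, of "q v"] eY
            minus_YM[OF Y_sc[OF wY, of "q v"] eY] by simp
      also have "(\<lambda>i. ?w i \<ominus> pr ?e (\<lambda>a. \<zero>) i) = pr (T (star d) (B a x)) (\<lambda>a. \<zero>)"
        using 2 a e aD bx by (simp add: Bc_diag pr_eq_iff vec_simps)
      finally show ?thesis .
    next
      case 3
      have "N.Bc a ?n d = q v \<odot>\<^bsub>N\<^esub> c (pr (Bc a ?e d) (\<lambda>a. \<zero>))"
        using 3 d T2[OF d] by (simp add: N.Bc_def s')
      also have "\<dots> = c (\<lambda>i. q v \<odot> pr (Bc a ?e d) (\<lambda>a. \<zero>) i)" using c_simps(4)[OF YB[OF d]] by simp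
      also have "(\<lambda>i. q v \<odot> pr (Bc a ?e d) (\<lambda>a. \<zero>) i) = pr (T (star d) (B a x)) (\<lambda>a. \<zero>)"
        using 3 d e bx dD by (simp add: Bc_def pr_eq_iff vec_simps)
      finally show ?thesis .
    qed
  qed
  have "E v (B a x) = B a x" using aD x v by (simp add: E_B_if)
  then have "theta (B a x) = case_option \<zero>\<^bsub>N\<^esub>
      (\<lambda>d. if d \<in> set La then c (pr (T (star d) (B a x)) (\<lambda>a. \<zero>)) else \<zero>\<^bsub>N\<^esub>)"
    using aD x by (auto simp: theta_def fun_eq_iff vec_simps c_simps(2)[symmetric] intro!:
        arg_cong[of _ _ c] split: option.splits)
  then show ?thesis unfolding 1 using key by (auto simp: fun_eq_iff N.Bc_off split: option.splits)
qed

text \<open>For an arrow into \<open>v\<close> with \<open>eps a = -1\<close>, \<open>theta\<close>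
  commutes with b and with \<open>star a\<close>, hence with G_a = 1 + b a'. The arrow is then
  determined by G_a a = - b, because G_a is invertible.\<close>

lemma theta_T:
  assumes a: "a \<in> D" and x: "x \<in> carrier M"
  shows "theta (T a x) = N.Ty a (theta x)"
proof (cases "hh a = v")
  case True
  then have L: "a \<in> set La" using a by (simp add: set_La)
  show ?thesis
  proof (cases "eps a = 1")
    case True
    then show ?thesis using theta_B[OF L x] by (simp add: B_def yN.B_def)
  next
    case False
    have st: "theta (T (star a) z) = N.Ty (star a) (theta z)" if "z \<in> carrier M" for z
      using theta_T_tail[of "star a" z] a True that by simp
    have G: "theta (G a z) = N.Gy a (theta z)" if z: "z \<in> carrier M" for z
      using a z theta_B[OF L, of "T (star a) z"] theta_Y st by (simp add: G_B yN.G_B theta_simps)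
    have t: "theta (T a x) \<in> N.Y" "N.Ty a (theta x) \<in> N.Y" using a x theta_Y yN.T_closed[OF a, of "theta x"]
        by simp_all
    have "N.Gy a (theta (T a x)) = theta (G a (T a x))" using G a x by simp
    also have "G a (T a x) = \<zero> \<ominus> B a x" using False a x by (simp add: B_def vec_simps)
    also have "theta (\<zero> \<ominus> B a x) = \<zero>\<^bsub>N.YM\<^esub> \<ominus>\<^bsub>N.YM\<^esub> yN.B a (theta x)" using a x theta_B[OF L x] by
        (simp add: theta_simps)
    also have "\<dots> = N.Gy a (N.Ty a (theta x))"
    proof -
      have "\<zero>\<^bsub>N.YM\<^esub> \<ominus>\<^bsub>N.YM\<^esub> (\<zero>\<^bsub>N.YM\<^esub> \<ominus>\<^bsub>N.YM\<^esub> w) = w" if "w \<in> carrier N.YM" for w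
        using that by (simp add: yN.vec_simps del: N.YM_simps)
      then show ?thesis using False yN.G_closed[OF a, of "N.Ty a (theta x)"] t(2) by
          (simp add: yN.B_def del: N.YM_simps(2-4))
    qed
    finally have eq: "N.Gy a (theta (T a x)) = N.Gy a (N.Ty a (theta x))" .
    have e: "eps a = -1" using False eps_cases[of a] by auto
    show ?thesis using yN.G_neg_r[OF a e, of "theta (T a x)"] yN.G_neg_r[OF a e, of "N.Ty a (theta x)"] t eq
        by simp
  qed
next
  case False
  then show ?thesis using theta_T_tail[OF a _ x] theta_T_away[OF a _ _ x] by blast
qed

text \<open>Applying \<pi> to \<mu> x returns (\<open>q v\<close> - 1) \<open>E v x\<close>, and
  \<open>q v\<close> is not 1.\<close>

lemma theta_inj: "inj_on theta (carrier M)"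
proof (rule inj_onI)
  fix x y assume xy: "x \<in> carrier M" "y \<in> carrier M" and eq: "theta x = theta y"
  have n: "c (pr (x \<ominus> E v x) (\<lambda>a. \<zero>)) = c (pr (y \<ominus> E v y) (\<lambda>a. \<zero>))" using fun_cong[OF eq, of None] by
      (simp add: theta_def)
  have "pr (x \<ominus> E v x) (\<lambda>a. \<zero>) = pr (y \<ominus> E v y) (\<lambda>a. \<zero>)" using n nz_Y(1) xy by (simp add: c_eq_iff)
  from fun_cong[OF this, of None] have 1: "x \<ominus> E v x = y \<ominus> E v y" by simp
  have "T (star d) x = T (star d) y" if d: "d \<in> set La" for d
  proof -
    have "c (pr (T (star d) x) (\<lambda>a. \<zero>)) = c (pr (T (star d) y) (\<lambda>a. \<zero>))"
        using fun_cong[OF eq, of "Some d"] d by (simp add: theta_def)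
    then have "pr (T (star d) x) (\<lambda>a. \<zero>) = pr (T (star d) y) (\<lambda>a. \<zero>)" using nz_Y(2)[OF d] xy by
        (simp add: c_eq_iff)
    from fun_cong[OF this, of None] show ?thesis by simp
  qed
  then have "tsum La (\<lambda>d. T (star d) x) = tsum La (\<lambda>d. T (star d) y)" by (intro tsum_cong)
  then have "(q v - 1) \<odot> E v x = (q v - 1) \<odot> E v y" using xy by (simp add: tsum_La_star)
  then have "inverse (q v - 1) \<odot> ((q v - 1) \<odot> E v x) = inverse (q v - 1) \<odot> ((q v - 1) \<odot> E v y)" by simp
  then have "E v x = E v y" using xy v q_v by (simp add: sc_sc)
  with 1 xy v show "x = y" by (simp add: minus_eq_eq vec_simps)
qed

text \<open>The condition \<pi>' x = 0 reads s (x + \<mu> \<pi> x) = x, that is \<mu> (\<pi> x) =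
  (\<open>q v\<close> - 1) x. So x is \<mu> of the vector \<pi> x / (\<open>q v\<close> - 1), which
  is the component at \<open>v\<close> of the preimage.\<close>

lemma theta_surj: "theta ` carrier M = N.Y"
proof
  show "theta ` carrier M \<subseteq> N.Y" using theta_Y by blast
  show "N.Y \<subseteq> theta ` carrier M"
  proof
    fix y assume y: "y \<in> N.Y"
    note yd = N.YD[OF y]
    obtain z where z: "\<And>i. z i \<in> Y" "\<And>i. y i = c (z i)" using yd(1) unfolding carrier_N image_iff by metis
    define x0 where "x0 = z None None"
    have x0: "x0 \<in> carrier M" "E v x0 = \<zero>" using YD(1,2)[OF z(1)] by (simp_all add: x0_def)
    have "c (Ey v (z None)) = c (\<lambda>i. \<zero>)" using yd(2) v z by (simp add: c_E c_simps)
    moreover have "Ey v (z None) \<in> Y" using klinearD(1)[OF Ey_lin[OF v]] z(1) by simp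
    ultimately have "Ey v (z None) = (\<lambda>i. \<zero>)" using Y_zero by (simp add: c_eq_iff)
    from fun_cong[OF this] have "z None (Some d) = \<zero>" for d by (metis Ey_def fun_upd_apply option.distinct(1))
    then have z0: "z None = pr x0 (\<lambda>a. \<zero>)" by (simp add: pr_eq_iff x0_def)
    define x where "x a = z (Some a) None" for a
    have x: "x a \<in> carrier M" "E (tt a) (x a) = x a" "z (Some a) = pr (x a) (\<lambda>d. \<zero>)" if a: "a \<in> set La" for a
    proof -
      have tv: "tt a \<noteq> v" "tt a \<in> verts Q" using no_loop a by (auto simp: set_La)
      have "c (Ey (tt a) (z (Some a))) = c (z (Some a))" using yd(3)[OF a] tv z by (simp add: c_E)
      moreover have "Ey (tt a) (z (Some a)) \<in> Y" using klinearD(1)[OF Ey_lin[OF tv(2)]] z(1) by simp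
      ultimately have "Ey (tt a) (z (Some a)) = z (Some a)" using z(1) by (simp add: c_eq_iff)
      then have "pr (E (tt a) (x a)) (\<lambda>d. \<zero>) = z (Some a)" using tv by (simp add: Ey_def x_def)
      then show "E (tt a) (x a) = x a" "z (Some a) = pr (x a) (\<lambda>d. \<zero>)" by (auto simp: pr_eq_iff x_def)
      show "x a \<in> carrier M" using YD(1)[OF z(1)] by (simp add: x_def)
    qed
    have "N.tsum La (\<lambda>a. y (Some a)) = N.tsum La (\<lambda>a. c (pr (x a) (\<lambda>d. \<zero>)))"
      by (rule N.tsum_cong) (simp add: z(2) x(3))
    then have "c (pr \<zero> (tz La x)) = c (\<lambda>i. \<zero>)" using yd(5) tsum_N(1)[of x] x by (simp add: c_simps)
    then have tz0: "pr \<zero> (tz La x) = (\<lambda>i. \<zero>)" using tsum_N(2)[of x] x Y_zero by (simp add: c_eq_iff)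
    let ?t = "tsum La x"
    have t: "?t \<in> carrier M" "E v ?t = ?t"
      using x La_D v by (auto intro!: tsum_closed E_tsum simp: set_La)
    have tx: "T (star d) ?t = (q v - 1) \<odot> x d" if d: "d \<in> set La" for d
    proof -
      have "\<zero> = s \<odot> (x d \<oplus> T (star d) ?t) \<ominus> x d"
        using fun_cong[OF tz0, of "Some d"] tz_eq[of "[]" La x d] x d by simp
      then have "q v \<odot> (s \<odot> (x d \<oplus> T (star d) ?t)) = q v \<odot> x d"
        using x(1)[OF d] t La_D(1)[OF d] by (simp add: eq_minus_eq)
      then have "x d \<oplus> T (star d) ?t = q v \<odot> x d" using x(1)[OF d] t La_D(1)[OF d] by (simp add: sc_sc)
      then show ?thesis using x(1)[OF d] t La_D(1)[OF d] by (simp add: vec_simps)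
    qed
    let ?x = "x0 \<oplus> inverse (q v - 1) \<odot> ?t"
    have xc: "?x \<in> carrier M" using x0 t by simp
    have "theta ?x i = y i" for i
    proof (cases i)
      case None
      have "?x \<ominus> E v ?x = x0" using x0 t v by (simp add: lin_simps vec_simps)
      then show ?thesis using None by (simp add: theta_def z(2) z0)
    next
      case (Some d)
      show ?thesis
      proof (cases "d \<in> set La")
        case True
        have "T (star d) x0 = \<zero>" using True x0 T_E[of "star d" x0] by (simp add: set_La lin_simps)
        then have "T (star d) ?x = x d" using True La_D(1)[OF True] x0 t x(1)[OF True] q_v by
            (simp add: lin_simps tx sc_sc)
        then show ?thesis using Some True by (simp add: theta_def z(2) x(3))
      next
        case False
        then show ?thesis using Some yd(4) by (simp add: theta_def c_simps)
      qed
    qed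
    then have "theta ?x = y" by (rule ext)
    then show "y \<in> theta ` carrier M" using xc by blast
  qed
qed

end

section \<open>The inverse equivalence\<close>

lemma (in refl_copy) refl_twice_copy:
  "refl_twice Q lt q U (mpa_E Q lt q X) (mpa_T Q lt q X) (mpa_G Q lt q X) v
     ZZ.U (mpa_E Q lt q' Z) (mpa_T Q lt q' Z) (mpa_G Q lt q' Z) c"
  by (intro refl_twice.intro refl_twice_axioms.intro rr.refl_rep_axioms ZZ.rr.refl_rep_axioms inj_c c_lin)
    (simp_all add: carrier_Z c_E c_T)

lemma (in refl_copy) d_raw: "d = inv_into (refl_raw Q lt v q X) c"
  by (simp add: d_def raw_simps)

lemma left_module_hom_inverse:
  assumes X: "left_module R X" and f: "f \<in> left_module_hom R X Z" and bij: "bij_betw f (carrier X) (carrier Z)"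
  shows "(\<lambda>z \<in> carrier Z. inv_into (carrier X) f z) \<in> left_module_hom R Z X"
proof -
  interpret left_module R X by (rule X)
  let ?g = "inv_into (carrier X) f"
  have g: "?g z \<in> carrier X" "f (?g z) = z" if "z \<in> carrier Z" for z
    using bij that by (auto simp: bij_betw_def inv_into_into f_inv_into_f)
  have fc: "f x \<in> carrier Z" if "x \<in> carrier X" for x using f that by (auto simp: left_module_hom_def)
  have gf: "?g (f x) = x" if "x \<in> carrier X" for x using bij that by (simp add: bij_betw_def)
  have "?g (z \<oplus>\<^bsub>Z\<^esub> w) = ?g z \<oplus>\<^bsub>X\<^esub> ?g w" "z \<oplus>\<^bsub>Z\<^esub> w \<in> carrier Z" if "z \<in> carrier Z" "w \<in> carrier Z" for z w
  proof -
    have *: "z \<oplus>\<^bsub>Z\<^esub> w = f (?g z \<oplus>\<^bsub>X\<^esub> ?g w)" using f g that by (simp add: left_module_hom_def)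
    show "?g (z \<oplus>\<^bsub>Z\<^esub> w) = ?g z \<oplus>\<^bsub>X\<^esub> ?g w" unfolding * using g that by (simp add: gf)
    show "z \<oplus>\<^bsub>Z\<^esub> w \<in> carrier Z" unfolding * by (rule fc) (use g that in simp)
  qed
  moreover have "?g (r \<odot>\<^bsub>Z\<^esub> z) = r \<odot>\<^bsub>X\<^esub> ?g z" "r \<odot>\<^bsub>Z\<^esub> z \<in> carrier Z" if "r \<in> carrier R" "z \<in> carrier Z" for r z
  proof -
    have *: "r \<odot>\<^bsub>Z\<^esub> z = f (r \<odot>\<^bsub>X\<^esub> ?g z)" using f g that by (simp add: left_module_hom_def)
    show "?g (r \<odot>\<^bsub>Z\<^esub> z) = r \<odot>\<^bsub>X\<^esub> ?g z" unfolding * using g that by (simp add: gf smult_closed)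
    show "r \<odot>\<^bsub>Z\<^esub> z \<in> carrier Z" unfolding * by (rule fc) (use g that in \<open>simp add: smult_closed\<close>)
  qed
  ultimately show ?thesis using g by (simp add: left_module_hom_def)
qed

locale refl_copy_twice = A: refl_copy Q lt q X v c Z + C: refl_copy Q lt "refl_weight Q v q" Z v c2 ZZ
  for Q :: "('v, 'a) pre_digraph" and lt and q :: "'v \<Rightarrow> 'k::field" and X :: "('v, 'a, 'k, 'm) mpa_rep" and v c
    and Z :: "('v, 'a, 'k, 'm) mpa_rep" and c2 and ZZ :: "('v, 'a, 'k, 'm) mpa_rep"
begin

sublocale t: refl_twice Q lt q A.U "mpa_E Q lt q X" "mpa_T Q lt q X" "mpa_G Q lt q X" v
    A.ZZ.U "mpa_E Q lt (refl_weight Q v q) Z" "mpa_T Q lt (refl_weight Q v q) Z"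
        "mpa_G Q lt (refl_weight Q v q) Z" c
  by (rule A.refl_twice_copy)

definition "Theta = (\<lambda>x \<in> carrier X. c2 (t.theta x))"

lemmas rw = A.refl_weight_refl_weight[of q, OF A.rr.qv_nz]

lemma theta_raw: "x \<in> carrier X \<Longrightarrow> t.theta x \<in> A.ZZ.rr.Y" using t.theta_Y[of x] by simp

lemma Theta_bij: "bij_betw Theta (carrier X) (carrier ZZ)"
proof -
  have "bij_betw (c2 \<circ> t.theta) (carrier X) (carrier ZZ)"
    by (rule bij_betw_trans[of _ _ A.ZZ.rr.Y])
      (use t.theta_inj t.theta_surj C.inj_c C.carrier_Z in \<open>auto simp: bij_betw_def\<close>)
  then show ?thesis by (subst bij_betw_cong[of _ _ "c2 \<circ> t.theta"]) (simp_all add: Theta_def)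
qed

lemma Theta_hom: "Theta \<in> left_module_hom (mpa Q lt q) X ZZ"
proof -
  have ZZ: "mpa_module Q lt q ZZ" using C.Z_module by (simp only: rw)
  have lin: "klinear A.U (mpa_space Q lt q ZZ) Theta"
  proof -
    have "klinear A.U (mpa_space Q lt q ZZ) (c2 \<circ> t.theta)"
      using t.theta_lin C.c_lin unfolding rw klinear_def by
          (auto simp: Pi_iff simp del: A.U_simps(4) A.ZZ.rr.YM_simps(2,4))
    then show ?thesis using A.rr.M.add.m_closed A.rr.sc_closed unfolding klinear_def Theta_def
      by (auto simp del: A.U_simps(4))
  qed
  have E: "Theta (mpa_E Q lt q X w x) = mpa_E Q lt q ZZ w (Theta x)" if "w \<in> verts Q" "x \<in> carrier X" for w x
    using that theta_raw[OF that(2)] t.theta_E[OF that(1), of x] C.c_E[OF that(1), of "t.theta x"]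
        A.rr.E_closed[OF that(1), of x]
    by (simp add: Theta_def rw)
  have T: "Theta (mpa_T Q lt q X a x) = mpa_T Q lt q ZZ a (Theta x)"
      if "a \<in> arcs (double Q)" "x \<in> carrier X" for a x
    using that theta_raw[OF that(2)] t.theta_T[OF that(1), of x] C.c_T[OF that(1), of "t.theta x"]
        A.rr.T_closed[OF that(1), of x]
    by (simp add: Theta_def rw)
  have "Theta (r \<odot>\<^bsub>X\<^esub> x) = r \<odot>\<^bsub>ZZ\<^esub> Theta x" if "r \<in> carrier (mpa Q lt q)" "x \<in> carrier X" for r x
    by (rule mpa_hom_criterion[OF A.mpa_module_axioms ZZ lin E T that])
  then show ?thesis using klinearD(1,2)[OF lin] unfolding left_module_hom_def by
      (auto simp: underlying_space_def Theta_def)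
qed

end

text \<open>\<open>theta\<close> is assembled from \<open>E v\<close> and the arrows out of
  \<open>v\<close>, and \<open>f\<close> commutes with both.\<close>

lemma Theta_natural:
  assumes t: "refl_copy_twice Q lt q X v c Z c2 ZZ" "refl_copy_twice Q lt q X' v c' Z' c2' ZZ'"
    and f: "refl_copy_hom Q lt q X v c Z X' c' Z' f"
    and Ff: "refl_copy_hom Q lt (refl_weight Q v q) Z v c2 ZZ Z' c2' ZZ' (refl_copy_hom.Ff Q lt q X v c Z c' f)"
    and x: "x \<in> carrier X"
  shows "refl_copy_hom.Ff Q lt (refl_weight Q v q) Z v c2 ZZ c2' (refl_copy_hom.Ff Q lt q X v c Z c' f)
      (refl_copy_twice.Theta Q lt q X v c c2 x) =
    refl_copy_twice.Theta Q lt q X' v c' c2' (f x)"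
proof -
  interpret t: refl_copy_twice Q lt q X v c Z c2 ZZ by (rule t(1))
  interpret t': refl_copy_twice Q lt q X' v c' Z' c2' ZZ' by (rule t(2))
  interpret f: refl_copy_hom Q lt q X v c Z X' c' Z' f by (rule f)
  interpret g: refl_copy_hom Q lt "refl_weight Q v q" Z v c2 ZZ Z' c2' ZZ' f.Ff by (rule Ff)
  have fx: "f x \<in> carrier X'" using f.f_simps(1)[of x] x by simp
  have n: "f.Ff (c (case_option z (\<lambda>a. \<zero>\<^bsub>X\<^esub>))) = c' (case_option (f z) (\<lambda>a. \<zero>\<^bsub>X'\<^esub>))"
      if "case_option z (\<lambda>a. \<zero>\<^bsub>X\<^esub>) \<in> t.A.rr.Y" for z
    using that f.f_simps(4) by (auto simp: f.Ff_c fun_eq_iff intro!: arg_cong[of _ _ c'] split: option.splits)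
  have "f.Ff (t.t.theta x i) = t'.t.theta (f x) i" for i
  proof (cases i)
    case None
    have "f (x \<ominus>\<^bsub>X\<^esub> mpa_E Q lt q X v x) = f x \<ominus>\<^bsub>X'\<^esub> mpa_E Q lt q X' v (f x)"
      using f.f_simps(5)[of x "mpa_E Q lt q X v x"] f.f_E[OF t.A.v, of x] t.A.rr.E_closed[OF t.A.v, of x] x
          by simp
    then show ?thesis using None n t.t.nz_Y(1)[of x] x by (simp add: t.t.theta_def t'.t.theta_def)
  next
    case (Some d)
    show ?thesis
    proof (cases "d \<in> set t.A.La")
      case True
      have "f (mpa_T Q lt q X (star d) x) = mpa_T Q lt q X' (star d) (f x)"
        using f.f_T[of "star d" x] t.A.La_D(1)[OF True] x by simp
      then show ?thesis using Some True n t.t.nz_Y(2)[OF True, of x] x by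
          (simp add: t.t.theta_def t'.t.theta_def)
    next
      case False
      have "f.Ff (c (\<lambda>i. \<zero>\<^bsub>X\<^esub>)) = c' (\<lambda>i. \<zero>\<^bsub>X'\<^esub>)"
        using f.Ff_c[of "\<lambda>i. \<zero>\<^bsub>X\<^esub>"] f.f_simps(4) t.A.rr.Y_zero by simp
      then show ?thesis using Some False by (simp add: t.t.theta_def t'.t.theta_def)
    qed
  qed
  then have "(\<lambda>i. f.Ff (t.t.theta x i)) = t'.t.theta (f x)" by (rule ext)
  then show ?thesis using x fx t.theta_raw[OF x] by (simp add: t.Theta_def t'.Theta_def g.Ff_c)
qed

theorem refl_functor_inverse:
  fixes Q :: "('v, 'a) pre_digraph" and lt v and q :: "'v \<Rightarrow> 'k::field"
  assumes inf: "infinite (UNIV :: 'm set)"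
    and ok: "\<And>q (X :: ('v, 'a, 'k, 'm) mpa_rep). \<forall>w \<in> verts Q. q w \<noteq> 0 \<Longrightarrow> q v \<noteq> 1 \<Longrightarrow> left_module
        (mpa Q lt q) X \<Longrightarrow> refl_module Q lt q X v"
    and q: "\<forall>w \<in> verts Q. q w \<noteq> 0" "q v \<noteq> 1"
  shows "naturally_isomorphic (module_category (mpa Q lt q) :: (('v, 'a, 'k, 'm) mpa_rep, _) category)
    (module_category (mpa Q lt q))
    (comp_functor (refl_functor Q lt v (refl_weight Q v q)) (refl_functor Q lt v q)) id_functor"
proof -
  let ?q = "refl_weight Q v q"
  let ?c = "\<lambda>X. fst (refl_choice Q lt v q X)"
      and ?Z = "\<lambda>X :: ('v, 'a, 'k, 'm) mpa_rep. snd (refl_choice Q lt v q X)"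
  let ?c2 = "\<lambda>X. fst (refl_choice Q lt v ?q (?Z X))"
      and ?ZZ = "\<lambda>X :: ('v, 'a, 'k, 'm) mpa_rep. snd (refl_choice Q lt v ?q (?Z X))"
  let ?F = "refl_functor Q lt v q" and ?G = "refl_functor Q lt v ?q"
  have copy: "refl_copy Q lt q X v (?c X) (?Z X)" if "left_module (mpa Q lt q) X"
      for X :: "('v, 'a, 'k, 'm) mpa_rep"
    by (rule refl_copy_choice[OF ok[OF q that] inf])
  have tw: "refl_copy_twice Q lt q X v (?c X) (?Z X) (?c2 X) (?ZZ X)" if X: "left_module (mpa Q lt q) X"
      for X :: "('v, 'a, 'k, 'm) mpa_rep"
  proof -
    interpret refl_copy Q lt q X v "?c X" "?Z X" by (rule copy[OF X])
    show ?thesis by (intro refl_copy_twice.intro copy X refl_copy_choice[OF ZZ.refl_module_axioms inf])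
  qed
  let ?Th = "\<lambda>X. refl_copy_twice.Theta Q lt q X v (?c X) (?c2 X)"
  \<comment> \<open>The required transformation goes from the composite to the identity, hence the
    inverse of \<open>Theta\<close>.\<close>
  let ?eta = "\<lambda>X. \<lambda>u \<in> carrier (?ZZ X). inv_into (carrier X) (?Th X) u"
  note Th = refl_copy_twice.Theta_hom[OF tw] refl_copy_twice.Theta_bij[OF tw]
  have rw: "refl_weight Q v ?q = q" if "left_module (mpa Q lt q) X" for X :: "('v, 'a, 'k, 'm) mpa_rep"
    by (rule refl_copy_twice.rw[OF tw[OF that]])
  have lm: "left_module (mpa Q lt ?q) (?Z X)" if "left_module (mpa Q lt q) X"
      for X :: "('v, 'a, 'k, 'm) mpa_rep"
    using refl_copy.Z_module[OF copy[OF that]] by (simp add: mpa_module_def)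
  have obj: "on_obj (comp_functor ?G ?F) X = ?ZZ X" for X by (simp add: comp_functor_def refl_functor_def)
  have nat: "on_hom (comp_functor ?G ?F) X X' f (?Th X x) = ?Th X' (f x) \<and> on_hom
      (comp_functor ?G ?F) X X' f (?Th X x) \<in> carrier (?ZZ X')"
    if X: "left_module (mpa Q lt q) X" "left_module (mpa Q lt q) X'"
        and f: "f \<in> left_module_hom (mpa Q lt q) X X'" and x: "x \<in> carrier X"
    for X X' :: "('v, 'a, 'k, 'm) mpa_rep" and f x
  proof -
    interpret f: refl_copy_hom Q lt q X v "?c X" "?Z X" X' "?c X'" "?Z X'" f
      by (intro refl_copy_hom.intro refl_copy_hom_axioms.intro copy X f)
    interpret t: refl_copy_twice Q lt q X v "?c X" "?Z X" "?c2 X" "?ZZ X" by (rule tw[OF X(1)])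
    interpret t': refl_copy_twice Q lt q X' v "?c X'" "?Z X'" "?c2 X'" "?ZZ X'" by (rule tw[OF X(2)])
    interpret g: refl_copy_hom Q lt ?q "?Z X" v "?c2 X" "?ZZ X" "?Z X'" "?c2 X'" "?ZZ X'" f.Ff
      by (intro refl_copy_hom.intro refl_copy_hom_axioms.intro t.C.refl_copy_axioms t'.C.refl_copy_axioms
          f.Ff_hom)
    have "on_hom ?F X X' f = f.Ff" by (simp add: refl_functor_def f.Ff_def f.A1.d_raw)
    moreover have "on_hom ?G (?Z X) (?Z X') f.Ff = g.Ff" unfolding g.Ff_def t.C.d_raw by
        (simp add: refl_functor_def)
    moreover have "on_obj ?F X = ?Z X" "on_obj ?F X' = ?Z X'" by (simp_all add: refl_functor_def)
    ultimately have "on_hom (comp_functor ?G ?F) X X' f = g.Ff" by (simp add: comp_functor_def)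
    moreover have "g.Ff (?Th X x) = ?Th X' (f x)"
      by (rule Theta_natural[OF tw[OF X(1)] tw[OF X(2)] f.refl_copy_hom_axioms g.refl_copy_hom_axioms x])
    moreover have "f x \<in> carrier X'" using f x by (auto simp: left_module_hom_def)
    then have "?Th X' (f x) \<in> carrier (?ZZ X')" using Th(2)[OF X(2)] by (auto simp: bij_betw_def)
    ultimately show ?thesis by simp
  qed
  show ?thesis
    unfolding naturally_isomorphic_def
  proof (intro exI[of _ ?eta] conjI ballI)
    fix X assume "X \<in> Obj (module_category (mpa Q lt q) :: (('v, 'a, 'k, 'm) mpa_rep, _) category)"
    then have X: "left_module (mpa Q lt q) X" by (simp add: module_category_def)
    note h = Th(1)[OF X] and b = Th(2)[OF X]
    have i: "?eta X \<in> left_module_hom (mpa Q lt q) (?ZZ X) X"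
      by (rule left_module_hom_inverse[OF X h b])
    have "compose (carrier (?ZZ X)) (?Th X) (?eta X) = (\<lambda>u \<in> carrier (?ZZ X). u)"
      "compose (carrier X) (?eta X) (?Th X) = (\<lambda>x \<in> carrier X. x)"
      using b by (auto simp: compose_def bij_betw_def f_inv_into_f intro!: restrict_ext)
    then have "\<exists>g \<in> Hom (module_category (mpa Q lt q)) X (?ZZ X).
        Comp (module_category (mpa Q lt q)) (?ZZ X) X (?ZZ X) g (?eta X) = Ident
            (module_category (mpa Q lt q)) (?ZZ X) \<and>
        Comp (module_category (mpa Q lt q)) X (?ZZ X) X (?eta X) g = Ident (module_category (mpa Q lt q)) X"
      using h by (intro bexI[of _ "?Th X"]) (simp_all add: module_category_def)
    then show "?eta X \<in> cat_iso (module_category (mpa Q lt q)) (on_obj (comp_functor ?G ?F) X)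
        (on_obj id_functor X)"
      using i by (simp add: cat_iso_def obj id_functor_def module_category_def)
  next
    fix X X' f assume "X \<in> Obj (module_category (mpa Q lt q) :: (('v, 'a, 'k, 'm) mpa_rep, _) category)"
      "X' \<in> Obj (module_category (mpa Q lt q) :: (('v, 'a, 'k, 'm) mpa_rep, _) category)"
      and "f \<in> Hom (module_category (mpa Q lt q)) X X'"
    then have X: "left_module (mpa Q lt q) X" "left_module (mpa Q lt q) X'"
        and f: "f \<in> left_module_hom (mpa Q lt q) X X'"
      by (simp_all add: module_category_def)
    note b = Th(2)[OF X(1)] and b' = Th(2)[OF X(2)]
    have "compose (carrier (?ZZ X)) (?eta X') (on_hom (comp_functor ?G ?F) X X' f) = compose
        (carrier (?ZZ X)) f (?eta X)"
    proof (rule extensionalityI[of _ "carrier (?ZZ X)"])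
      fix u assume u: "u \<in> carrier (?ZZ X)"
      then obtain x where x: "x \<in> carrier X" "u = ?Th X x" using b by (auto simp: bij_betw_def)
      have fx: "f x \<in> carrier X'" using f x by (auto simp: left_module_hom_def)
      have 1: "?eta X u = x" using b x u by (simp add: bij_betw_def)
      have 2: "on_hom (comp_functor ?G ?F) X X' f u = ?Th X' (f x)" using nat[OF X f x(1)] unfolding x(2) by
          (rule conjunct1)
      have 3: "?eta X' (?Th X' (f x)) = f x" using b' fx by (auto simp: bij_betw_def)
      show "compose (carrier (?ZZ X)) (?eta X') (on_hom (comp_functor ?G ?F) X X' f) u = compose
          (carrier (?ZZ X)) f (?eta X) u"
        unfolding compose_eq[OF u] 1 2 3 ..
    qed (simp_all add: compose_def)
    then show "Comp (module_category (mpa Q lt q)) (on_obj (comp_functor ?G ?F) X)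
        (on_obj (comp_functor ?G ?F) X') (on_obj id_functor X')
        (?eta X') (on_hom (comp_functor ?G ?F) X X' f) =
      Comp (module_category (mpa Q lt q)) (on_obj (comp_functor ?G ?F) X) (on_obj id_functor X)
          (on_obj id_functor X')
        (on_hom id_functor X X' f) (?eta X)"
      by (simp only: obj id_functor_def functor_data.simps) (simp add: module_category_def)
  qed
qed

section \<open>Dimensions\<close>

abbreviation fdim :: "('k::field, 'm) module \<Rightarrow> bool" where "fdim \<equiv> vectorspace.fin_dim class_ring"
abbreviation kdim :: "('k::field, 'm) module \<Rightarrow> nat" where "kdim \<equiv> vectorspace.dim class_ring"
abbreviation subsp :: "('k, 'm) module \<Rightarrow> 'm set \<Rightarrow> ('k::field, 'm) module" where "subsp M S \<equiv> M\<lparr>carrier := S\<rparr>"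

lemma (in kspace) vectorspace_M: "vectorspace class_ring M"
  by (intro vectorspace.intro module_axioms class_field)

definition is_sub :: "('k::field, 'm) module \<Rightarrow> 'm set \<Rightarrow> bool" where
  "is_sub M S \<longleftrightarrow> S \<subseteq> carrier M \<and> \<zero>\<^bsub>M\<^esub> \<in> S \<and> (\<forall>x \<in> S. \<forall>y \<in> S. x \<oplus>\<^bsub>M\<^esub> y \<in> S) \<and> (\<forall>c. \<forall>x \<in> S. c \<odot>\<^bsub>M\<^esub> x \<in> S)"

lemma (in kspace) submodule_iff: "submodule class_ring S M \<longleftrightarrow> is_sub M S"
  unfolding submodule_def is_sub_def using module_axioms by auto

lemma (in kspace) kspace_sub: "is_sub M S \<Longrightarrow> kspace (subsp M S)"
  by (intro kspace.intro submodule_is_module) (simp add: submodule_iff)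

lemma (in kspace) is_sub_kernel: "kspace N \<Longrightarrow> klinear M N f \<Longrightarrow> is_sub M {x \<in> carrier M. f x = \<zero>\<^bsub>N\<^esub>}"
proof -
  assume N: "kspace N" and f: "klinear M N f"
  interpret N: kspace N by (rule N)
  show ?thesis using klinearD[OF f] klinear_zero_minus(1)[OF kspace_axioms N f] by (auto simp: is_sub_def)
qed

lemma (in kspace) is_sub_image: "kspace N \<Longrightarrow> klinear N M f \<Longrightarrow> is_sub M (f ` carrier N)"
proof -
  assume N: "kspace N" and f: "klinear N M f"
  interpret N: kspace N by (rule N)
  have "f \<zero>\<^bsub>N\<^esub> = \<zero>" by (rule klinear_zero_minus(1)[OF N kspace_axioms f])
  then have "\<zero> \<in> f ` carrier N" by (metis N.zero_closed imageI)
  moreover have "f x \<oplus> f y \<in> f ` carrier N" if "x \<in> carrier N" "y \<in> carrier N" for x y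
    using klinearD(2)[OF f that] that by (metis N.add.m_closed imageI)
  moreover have "c \<odot> f x \<in> f ` carrier N" if "x \<in> carrier N" for c x
    using klinearD(3)[OF f that, of c] that by (metis N.sc_closed imageI)
  ultimately show ?thesis using klinearD(1)[OF f] by (auto simp: is_sub_def)
qed

text \<open>Generation is expressed by the subspaces that contain the set rather than by linear
  combinations, so it can be moved between a space and its subspaces.\<close>

lemma (in kspace) fdimI:
  assumes "finite A" "A \<subseteq> carrier M" "\<And>S. is_sub M S \<Longrightarrow> A \<subseteq> S \<Longrightarrow> carrier M \<subseteq> S"
  shows "fdim M"
proof -
  interpret vectorspace class_ring M by (rule vectorspace_M)
  have "is_sub M (span A)" using span_is_submodule[OF assms(2)] by (simp add: submodule_iff)
  then have "carrier M \<subseteq> span A" using assms(3) in_own_span[OF assms(2)] by blast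
  then have "span A = carrier M" using span_is_subset2[OF assms(2)] by blast
  then show ?thesis using assms(1,2) by (auto simp: fin_dim_def)
qed

lemma (in kspace) fdimE:
  assumes "fdim M"
  obtains A where "finite A" "A \<subseteq> carrier M" "\<And>S. is_sub M S \<Longrightarrow> A \<subseteq> S \<Longrightarrow> carrier M \<subseteq> S"
proof -
  interpret vectorspace class_ring M by (rule vectorspace_M)
  obtain A where A: "finite A" "A \<subseteq> carrier M" "span A = carrier M" using assms by (auto simp: fin_dim_def)
  have "carrier M \<subseteq> S" if "is_sub M S" "A \<subseteq> S" for S
    using span_is_subset[OF that(2)] that(1) A(3) by (simp add: submodule_iff)
  with A show ?thesis using that by blast
qed

lemma linear_map_klinear:
  assumes "kspace M" "kspace N" "klinear M N f"
  shows "linear_map class_ring M N f"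
proof -
  interpret M: kspace M by fact
  interpret N: kspace N by fact
  show ?thesis
    by (intro linear_map.intro mod_hom.intro mod_hom_axioms.intro M.vectorspace_M N.vectorspace_M
        M.module_axioms N.module_axioms)
      (use assms(3) in \<open>auto simp: klinear_def module_hom_def\<close>)
qed

lemma fdim_image:
  assumes "kspace M" "kspace N" "klinear M N f" "f ` carrier M = carrier N" "fdim M"
  shows "fdim N"
  using linear_map.rank_nullity_main(2)[OF linear_map_klinear[OF assms(1-3)] assms(5,4)] .

lemma kdim_kernel:
  assumes "kspace M" "kspace N" "klinear M N f" "f ` carrier M = carrier N" "fdim M"
  shows "kdim M = kdim N + kdim (subsp M {x \<in> carrier M. f x = \<zero>\<^bsub>N\<^esub>})"
proof -
  interpret mod_hom class_ring M N f using linear_map_klinear[OF assms(1-3)] by (rule linear_map.axioms)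
  have "im = carrier N" "ker = {x \<in> carrier M. f x = \<zero>\<^bsub>N\<^esub>}" using assms(4) by (auto simp: im_def ker_def)
  then show ?thesis using linear_map.rank_nullity[OF linear_map_klinear[OF assms(1-3)] assms(5)] by simp
qed

lemma kdim_bij:
  assumes "kspace M" "kspace N" "klinear M N f" "bij_betw f (carrier M) (carrier N)" "fdim M"
  shows "kdim N = kdim M" "fdim N"
  using linear_map.dim_eq[OF linear_map_klinear[OF assms(1-3)] assms(5)]
      fdim_image[OF assms(1-3) _ assms(5)] assms(4)
  by (auto simp: bij_betw_def)

text \<open>Generators of the kernel together with lifts of generators of \<open>N\<close> generate
  \<open>M\<close>: two vectors with the same image differ by an element of the kernel.\<close>

lemma fdim_extension:
  assumes M: "kspace M" and N: "kspace N" and f: "klinear M N f" "f ` carrier M = carrier N"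
    and fd: "fdim N" "fdim (subsp M {x \<in> carrier M. f x = \<zero>\<^bsub>N\<^esub>})"
  shows "fdim M"
proof -
  interpret M: kspace M by (rule M)
  interpret N: kspace N by (rule N)
  let ?K = "{x \<in> carrier M. f x = \<zero>\<^bsub>N\<^esub>}"
  note K = M.is_sub_kernel[OF N f(1)]
  interpret K: kspace "subsp M ?K" by (rule M.kspace_sub[OF K])
  note fs = klinearD[OF f(1)] klinear_zero_minus[OF M N f(1)]
  obtain A where A: "finite A" "A \<subseteq> carrier N" "\<And>S. is_sub N S \<Longrightarrow> A \<subseteq> S \<Longrightarrow> carrier N \<subseteq> S"
    using N.fdimE[OF fd(1)] by blast
  obtain B where "finite B" "B \<subseteq> carrier (subsp M ?K)" "\<And>S. is_sub (subsp M ?K) S \<Longrightarrow> B \<subseteq> S \<Longrightarrow> carrier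
      (subsp M ?K) \<subseteq> S"
    by (rule K.fdimE[OF fd(2)]) (rule that)
  then have B: "finite B" "B \<subseteq> ?K" "\<And>S. is_sub (subsp M ?K) S \<Longrightarrow> B \<subseteq> S \<Longrightarrow> ?K \<subseteq> S"
    by simp_all
  let ?g = "inv_into (carrier M) f"
  have g: "?g x \<in> carrier M" "f (?g x) = x" if "x \<in> A" for x
    using that A(2) f(2) by (auto intro!: inv_into_into f_inv_into_f)
  show ?thesis
  proof (rule M.fdimI)
    show "finite (B \<union> ?g ` A)" "B \<union> ?g ` A \<subseteq> carrier M" using A B g by auto
    fix S assume S: "is_sub M S" "B \<union> ?g ` A \<subseteq> S"
    have SM: "S \<subseteq> carrier M" using S by (simp add: is_sub_def)
    have "is_sub (subsp M ?K) (S \<inter> ?K)" using S(1) K by (auto simp: is_sub_def)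
    then have 1: "?K \<subseteq> S" using B(3)[of "S \<inter> ?K"] B(2) S(2) by blast
    have "is_sub N (f ` S)"
    proof -
      interpret S: kspace "subsp M S" by (rule M.kspace_sub[OF S(1)])
      have "klinear (subsp M S) N f" using f(1) SM by (auto simp: klinear_def subset_iff Pi_iff)
      from N.is_sub_image[OF S.kspace_axioms this] show ?thesis by simp
    qed
    moreover have "A \<subseteq> f ` S" using g S(2) by (metis (no_types, lifting) UnCI image_iff subset_iff)
    ultimately have 2: "carrier N \<subseteq> f ` S" by (rule A(3))
    show "carrier M \<subseteq> S"
    proof
      fix x assume x: "x \<in> carrier M"
      then obtain y where y: "y \<in> S" "f x = f y" using fs(1)[OF x] 2 by auto
      then have "x \<ominus>\<^bsub>M\<^esub> y \<in> ?K" using x SM fs by (auto simp: a_minus_def N.r_neg)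
      then have "(x \<ominus>\<^bsub>M\<^esub> y) \<oplus>\<^bsub>M\<^esub> y \<in> S" using 1 y S(1) by (auto simp: is_sub_def)
      moreover have "(x \<ominus>\<^bsub>M\<^esub> y) \<oplus>\<^bsub>M\<^esub> y = x" using x y SM by (auto simp: M.vec_simps)
      ultimately show "x \<in> S" by simp
    qed
  qed
qed

text \<open>The kernel is the image of 1 - g f, a linear image of \<open>M\<close>.\<close>

lemma fdim_kernel_of_split:
  assumes M: "kspace M" and N: "kspace N" and f: "klinear M N f" and g: "klinear N M g"
    and fg: "\<And>x. x \<in> carrier N \<Longrightarrow> f (g x) = x" and fd: "fdim M"
  shows "fdim (subsp M {x \<in> carrier M. f x = \<zero>\<^bsub>N\<^esub>})"
proof -
  interpret M: kspace M by (rule M)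
  interpret N: kspace N by (rule N)
  let ?K = "{x \<in> carrier M. f x = \<zero>\<^bsub>N\<^esub>}" and ?p = "\<lambda>x. x \<ominus>\<^bsub>M\<^esub> g (f x)"
  note fs = klinearD[OF f] klinear_zero_minus[OF M N f]
  note gs = klinearD[OF g] klinear_zero_minus[OF N M g]
  have gf: "f x \<in> carrier N" "g (f x) \<in> carrier M" if "x \<in> carrier M" for x using fs(1)[OF that] gs(1) by blast+
  have pK: "?p x \<in> ?K" if "x \<in> carrier M" for x
    using fs(6)[OF that gf(2)[OF that]] gf[OF that] fg[OF gf(1)[OF that]] that by
        (simp add: a_minus_def N.r_neg)
  have sub: "carrier (subsp M ?K) = ?K" by simp
  have lin: "klinear M (subsp M ?K) ?p"
    unfolding klinear_def
  proof (intro conjI ballI allI)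
    show "?p \<in> carrier M \<rightarrow> carrier (subsp M ?K)" unfolding sub by (rule Pi_I) (rule pK)
  next
    fix x y assume xy: "x \<in> carrier M" "y \<in> carrier M"
    have "(x \<oplus>\<^bsub>M\<^esub> y) \<ominus>\<^bsub>M\<^esub> (u \<oplus>\<^bsub>M\<^esub> w) = (x \<ominus>\<^bsub>M\<^esub> u) \<oplus>\<^bsub>M\<^esub> (y \<ominus>\<^bsub>M\<^esub> w)" if "u \<in> carrier M" "w \<in> carrier M" for u w
      using xy that by (simp add: M.vec_simps)
    from this[OF gf(2)[OF xy(1)] gf(2)[OF xy(2)]]
    show "?p (x \<oplus>\<^bsub>M\<^esub> y) = ?p x \<oplus>\<^bsub>subsp M ?K\<^esub> ?p y"
      unfolding fs(2)[OF xy] gs(2)[OF gf(1)[OF xy(1)] gf(1)[OF xy(2)]] by simp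
  next
    fix c x assume x: "x \<in> carrier M"
    show "?p (c \<odot>\<^bsub>M\<^esub> x) = c \<odot>\<^bsub>subsp M ?K\<^esub> ?p x"
      unfolding fs(3)[OF x] gs(3)[OF gf(1)[OF x]] using M.sc_diff[OF x gf(2)[OF x]] by simp
  qed
  have "?p ` carrier M = carrier (subsp M ?K)"
    unfolding sub
  proof
    show "?K \<subseteq> ?p ` carrier M"
    proof
      fix x assume "x \<in> ?K"
      then have "x \<in> carrier M" "x = ?p x" by (simp_all add: gs(4))
      then show "x \<in> ?p ` carrier M" by (rule rev_image_eqI)
    qed
  qed (rule image_subsetI, rule pK)
  then show ?thesis by (rule fdim_image[OF M M.kspace_sub[OF M.is_sub_kernel[OF N f]] lin _ fd])
qed

section \<open>Finite products of subspaces\<close>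

definition fprod :: "'i set \<Rightarrow> ('i \<Rightarrow> 'm set) \<Rightarrow> ('k::field, 'm) module \<Rightarrow> ('k, 'i \<Rightarrow> 'm) module" where
  "fprod S K M = \<lparr>carrier = {y. (\<forall>i \<in> S. y i \<in> K i) \<and> (\<forall>i. i \<notin> S \<longrightarrow> y i = \<zero>\<^bsub>M\<^esub>)}, mult = (\<lambda>y z. y), one =
      (\<lambda>i. \<zero>\<^bsub>M\<^esub>),
     zero = (\<lambda>i. \<zero>\<^bsub>M\<^esub>), add = (\<lambda>y z i. y i \<oplus>\<^bsub>M\<^esub> z i), smult = (\<lambda>c y i. c \<odot>\<^bsub>M\<^esub> y i)\<rparr>"

lemma fprod_simps [simp]:
  "y \<in> carrier (fprod S K M) \<longleftrightarrow> (\<forall>i \<in> S. y i \<in> K i) \<and> (\<forall>i. i \<notin> S \<longrightarrow> y i = \<zero>\<^bsub>M\<^esub>)"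
  "y \<oplus>\<^bsub>fprod S K M\<^esub> z = (\<lambda>i. y i \<oplus>\<^bsub>M\<^esub> z i)" "\<zero>\<^bsub>fprod S K M\<^esub> = (\<lambda>i. \<zero>\<^bsub>M\<^esub>)" "c \<odot>\<^bsub>fprod S K M\<^esub> y =
      (\<lambda>i. c \<odot>\<^bsub>M\<^esub> y i)"
  by (simp_all add: fprod_def)

context kspace
begin

lemma kspace_fprod:
  assumes K: "\<And>i. i \<in> S \<Longrightarrow> is_sub M (K i)"
  shows "kspace (fprod S K M)"
proof -
  have K': "x \<in> carrier M" if "x \<in> K i" "i \<in> S" for x i using K[OF that(2)] that by (auto simp: is_sub_def)
  have c: "y i \<in> carrier M" if "y \<in> carrier (fprod S K M)" for y i
    using that K' by (cases "i \<in> S") auto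
  have cl: "\<And>x y. x \<in> carrier (fprod S K M) \<Longrightarrow> y \<in> carrier (fprod S K M) \<Longrightarrow>
      (\<lambda>i. x i \<oplus> y i) \<in> carrier (fprod S K M)"
    "(\<lambda>i. \<zero>) \<in> carrier (fprod S K M)" "\<And>a x. x \<in> carrier (fprod S K M) \<Longrightarrow> (\<lambda>i. a \<odot> x i) \<in> carrier (fprod S K M)"
    using K by (auto simp: is_sub_def)
  have ag: "abelian_group (fprod S K M)"
  proof (rule abelian_groupI)
    fix y assume y: "y \<in> carrier (fprod S K M)"
    have "(\<lambda>i. (-1) \<odot> y i) \<oplus>\<^bsub>fprod S K M\<^esub> y = \<zero>\<^bsub>fprod S K M\<^esub>"
      using c[OF y] by (auto simp: sc_uminus l_neg)
    with cl(3)[OF y, of "-1"] show "\<exists>z\<in>carrier (fprod S K M). z \<oplus>\<^bsub>fprod S K M\<^esub> y = \<zero>\<^bsub>fprod S K M\<^esub>" by blast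
  qed (simp_all only: fprod_simps(2-4) cl, simp_all add: c a_ac del: fprod_simps(1))
  show ?thesis
    by (intro kspace.intro moduleI) (simp_all add: class_cring ag cl c sc_add sc_distr sc_sc del:
        fprod_simps(1))
qed

text \<open>Evaluation at a new index \<open>j\<close> maps the product onto the subspace at
  \<open>j\<close>, with the product over the remaining indices as kernel.\<close>

lemma fdim_fprod:
  assumes "finite S" and K: "\<And>i. i \<in> S \<Longrightarrow> is_sub M (K i)" and fd: "\<And>i. i \<in> S \<Longrightarrow> fdim (subsp M (K i))"
  shows "fdim (fprod S K M) \<and> kdim (fprod S K M) = (\<Sum>i\<in>S. kdim (subsp M (K i)))"
  using assms
proof (induction S rule: finite_induct)
  case empty
  interpret F: kspace "fprod {} K M" by (rule kspace_fprod) simp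
  interpret V: vectorspace class_ring "fprod {} K M" by (rule F.vectorspace_M)
  have "carrier (fprod {} K M) = {\<zero>\<^bsub>fprod {} K M\<^esub>}" by (auto simp: fprod_def)
  then have g: "F.span {} = carrier (fprod {} K M)" using V.span_empty by simp
  have "V.fin_dim" unfolding V.fin_dim_def by (rule exI[of _ "{}"]) (use g in simp)
  moreover have "V.dim = 0" unfolding V.dim_def by (rule Least_eq_0, rule exI[of _ "{}"]) (use g in simp)
  ultimately show ?case by simp
next
  case (insert j S)
  let ?P = "fprod (insert j S) K M" and ?N = "subsp M (K j)"
  have P: "kspace ?P" by (rule kspace_fprod) (rule insert.prems)
  have Kj: "is_sub M (K j)" using insert.prems(1) by simp
  have N: "kspace ?N" using kspace_sub[OF Kj] .
  have lin: "klinear ?P ?N (\<lambda>y. y j)" by (auto simp: klinear_def)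
  have surj: "(\<lambda>y. y j) ` carrier ?P = carrier ?N"
  proof
    show "carrier ?N \<subseteq> (\<lambda>y. y j) ` carrier ?P"
    proof
      fix x assume "x \<in> carrier ?N"
      then have "(\<lambda>i. if i = j then x else \<zero>) \<in> carrier ?P" using insert.prems(1) by (auto simp: is_sub_def)
      then show "x \<in> (\<lambda>y. y j) ` carrier ?P" by (rule rev_image_eqI) simp
    qed
  qed auto
  have ker: "subsp ?P {y \<in> carrier ?P. y j = \<zero>\<^bsub>?N\<^esub>} = fprod S K M"
  proof -
    have "{y \<in> carrier ?P. y j = \<zero>} = carrier (fprod S K M)" using insert.hyps Kj by (auto simp: is_sub_def)
    then show ?thesis by (simp add: fprod_def)
  qed
  have IH: "fdim (fprod S K M)" "kdim (fprod S K M) = (\<Sum>i\<in>S. kdim (subsp M (K i)))"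
    using insert.IH insert.prems by simp_all
  have fdN: "fdim ?N" using insert.prems(2) by simp
  have fdP: "fdim ?P" by (rule fdim_extension[OF P N lin surj fdN]) (use ker IH in simp)
  moreover have "kdim ?P = kdim ?N + kdim (fprod S K M)" using kdim_kernel[OF P N lin surj fdP] unfolding ker .
  ultimately show ?case using IH insert.hyps by simp
qed

end

section \<open>The splitting of W into the old and the new space at the vertex\<close>

context refl_rep
begin

abbreviation "Ev w \<equiv> subsp M (E w ` carrier M)"

lemma is_sub_E: "w \<in> verts Q \<Longrightarrow> is_sub M (E w ` carrier M)"
  by (rule is_sub_image[OF kspace_axioms E_lin])

lemma in_Ev: "w \<in> verts Q \<Longrightarrow> x \<in> E w ` carrier M \<longleftrightarrow> x \<in> carrier M \<and> E w x = x"
  using E_E[of w w] by (auto simp: image_iff) (metis)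

lemma fdim_Ev: assumes "w \<in> verts Q" "fdim M" shows "fdim (Ev w)"
  by (rule fdim_image[OF kspace_axioms kspace_sub[OF is_sub_E[OF assms(1)]] _ _ assms(2), of "E w"])
    (use E_lin[OF assms(1)] in \<open>auto simp: klinear_def\<close>)

abbreviation "W \<equiv> fprod (set La) (\<lambda>a. E (tt a) ` carrier M) M"

lemma W_iff: "y \<in> carrier W \<longleftrightarrow> (\<forall>a \<in> set La. y a \<in> carrier M \<and> E (tt a) (y a) = y a) \<and>
    (\<forall>a. a \<notin> set La \<longrightarrow> y a = \<zero>)"
  using La_D by (auto simp: in_Ev)

lemma kspace_W: "kspace W"
  by (rule kspace_fprod) (use La_D in \<open>simp add: is_sub_E\<close>)

lemma fdim_W: "fdim M \<Longrightarrow> fdim W" "fdim M \<Longrightarrow> kdim W = (\<Sum>a\<in>set La. kdim (Ev (tt a)))"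
  using fdim_fprod[of "set La" "\<lambda>a. E (tt a) ` carrier M"] La_D by (simp_all add: is_sub_E fdim_Ev)

lemma tsum_W: "klinear W (Ev v) (tsum La)"
  unfolding klinear_def
proof (intro conjI ballI allI)
  show "tsum La \<in> carrier W \<rightarrow> carrier (Ev v)"
  proof
    fix y assume "y \<in> carrier W"
    then have "tsum La y \<in> carrier M" "E v (tsum La y) = tsum La y"
      using La_D v by (auto simp: W_iff simp del: fprod_simps(1) intro!: tsum_closed E_tsum) (simp add: set_La)
    then show "tsum La y \<in> carrier (Ev v)" using v by (simp add: in_Ev)
  qed
qed (use La_D in \<open>simp_all add: W_iff tsum_add tsum_sc del: fprod_simps(1)\<close>)

text \<open>This is \<mu> / (\<open>q v\<close> - 1), which splits \<pi> because \<pi> \<mu> =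
  \<open>q v\<close> - 1.\<close>

definition "sect x = (\<lambda>a. if a \<in> set La then inverse (q v - 1) \<odot> T (star a) x else \<zero>)"

lemma sect_lin: "klinear (Ev v) W sect"
proof -
  have "sect x \<in> carrier W" if "x \<in> carrier M" for x
    using that La_D E_T[of "star _" x] by (auto simp: W_iff sect_def lin_simps simp del: fprod_simps(1))
  then show ?thesis using v La_D
    by (auto simp: klinear_def in_Ev sect_def lin_simps sc_distr sc_sc mult.commute fun_eq_iff simp del:
        fprod_simps(1))
qed

lemma tsum_sect: "x \<in> carrier M \<Longrightarrow> E v x = x \<Longrightarrow> tsum La (sect x) = x"
proof -
  assume x: "x \<in> carrier M" "E v x = x"
  have "tsum La (sect x) = tsum La (\<lambda>a. inverse (q v - 1) \<odot> T (star a) x)"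
    by (rule tsum_cong) (simp add: sect_def)
  then show ?thesis using x La_D q_v by (simp add: tsum_sc tsum_La_star sc_sc)
qed

lemma tsum_surj: "tsum La ` carrier W = carrier (Ev v)"
proof
  show "carrier (Ev v) \<subseteq> tsum La ` carrier W"
  proof
    fix x assume x: "x \<in> carrier (Ev v)"
    then have "sect x \<in> carrier W" using klinearD(1)[OF sect_lin] by blast
    moreover have "tsum La (sect x) = x" using x v by (simp add: in_Ev tsum_sect)
    ultimately show "x \<in> tsum La ` carrier W" by (metis imageI)
  qed
qed (use klinearD(1)[OF tsum_W] in blast)

abbreviation "W0 \<equiv> subsp W {y \<in> carrier W. tsum La y = \<zero>}"

lemma fdim_W0: assumes "fdim M" shows "fdim W0" "(\<Sum>a\<in>set La. kdim (Ev (tt a))) = kdim (Ev v) + kdim W0"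
proof -
  note k = kspace_W kspace_sub[OF is_sub_E[OF v]]
  show "fdim W0" using fdim_kernel_of_split[OF k tsum_W sect_lin _ fdim_W(1)[OF assms]] tsum_sect v by
      (simp add: in_Ev)
  show "(\<Sum>a\<in>set La. kdim (Ev (tt a))) = kdim (Ev v) + kdim W0"
    using kdim_kernel[OF k tsum_W tsum_surj fdim_W(1)[OF assms]] fdim_W(2)[OF assms] by simp
qed

abbreviation "Yv \<equiv> subsp YM {y \<in> Y. y None = \<zero>}"

lemma klinear_None: "klinear YM (subsp M {x \<in> carrier M. E v x = \<zero>}) (\<lambda>y. y None)"
  by (auto simp: klinear_def YD)

lemma kspace_Yv: "kspace Yv"
proof -
  interpret K: kspace YM by (rule kspace_YM)
  have "klinear YM M (\<lambda>y. y None)" by (auto simp: klinear_def YD)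
  from K.kspace_sub[OF K.is_sub_kernel[OF kspace_axioms this]] show ?thesis by simp
qed

lemma kdim_Yv:
  assumes "fdim M"
  shows "fdim Yv" "(\<Sum>a\<in>set La. kdim (Ev (tt a))) = kdim (Ev v) + kdim Yv"
proof -
  interpret W: kspace W by (rule kspace_W)
  have k: "kspace W0" using W.kspace_sub[OF W.is_sub_kernel[OF kspace_sub[OF is_sub_E[OF v]] tsum_W]] by simp
  have cl: "pr \<zero> y \<in> Y" if "y \<in> carrier W0" for y
    using that v by (intro Y_I) (auto simp: W_iff lin_simps simp del: fprod_simps(1))
  have lin: "klinear W0 Yv (pr \<zero>)"
    using cl by (auto simp: klinear_def fun_eq_iff simp del: fprod_simps(1) split: option.splits)
  have "bij_betw (pr \<zero>) (carrier W0) (carrier Yv)"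
  proof (rule bij_betw_byWitness[where f' = "\<lambda>y a. y (Some a)"])
    show "\<forall>y\<in>carrier Yv. pr \<zero> (\<lambda>a. y (Some a)) = y" by (simp add: pr_eq_iff)
    show "(\<lambda>y a. y (Some a)) ` carrier Yv \<subseteq> carrier W0" by (auto simp: W_iff YD simp del: fprod_simps(1))
  qed (use cl in auto)
  from kdim_bij[OF k kspace_Yv lin this fdim_W0(1)[OF assms]] fdim_W0(2)[OF assms]
  show "fdim Yv" "(\<Sum>a\<in>set La. kdim (Ev (tt a))) = kdim (Ev v) + kdim Yv" by simp_all
qed

text \<open>The coordinate \<open>None\<close> maps onto the kernel of \<open>E v\<close>, which is
  the image of 1 - \<open>E v\<close>; the kernel of this coordinate is the new space at
  \<open>v\<close>.\<close>

lemma fdim_YM: assumes "fdim M" shows "fdim YM"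
proof -
  let ?N = "subsp M {x \<in> carrier M. E v x = \<zero>}"
  have sub: "is_sub M {x \<in> carrier M. E v x = \<zero>}" by (rule is_sub_kernel[OF kspace_axioms E_lin[OF v]])
  have "fdim ?N"
  proof (rule fdim_image[OF kspace_axioms kspace_sub[OF sub] _ _ assms])
    show "klinear M ?N (\<lambda>x. x \<ominus> E v x)" using v by (auto simp: klinear_def lin_simps E_E vec_simps)
    show "(\<lambda>x. x \<ominus> E v x) ` carrier M = carrier ?N"
    proof
      show "carrier ?N \<subseteq> (\<lambda>x. x \<ominus> E v x) ` carrier M"
      proof
        fix x assume "x \<in> carrier ?N"
        then have "x \<in> carrier M" "x = x \<ominus> E v x" by simp_all
        then show "x \<in> (\<lambda>x. x \<ominus> E v x) ` carrier M" by (rule rev_image_eqI)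
      qed
    qed (use v in \<open>auto simp: lin_simps E_E vec_simps\<close>)
  qed
  moreover have "(\<lambda>y. y None) ` carrier YM = carrier ?N"
  proof
    show "carrier ?N \<subseteq> (\<lambda>y. y None) ` carrier YM"
    proof
      fix x assume "x \<in> carrier ?N"
      then have "pr x (\<lambda>a. \<zero>) \<in> carrier YM" by (simp add: Y_nz)
      then show "x \<in> (\<lambda>y. y None) ` carrier YM" by (rule rev_image_eqI) simp
    qed
  qed (auto simp: YD)
  ultimately show ?thesis
    using kdim_Yv(1)[OF assms] by (intro fdim_extension[OF kspace_YM kspace_sub[OF sub] klinear_None]) simp_all
qed

end

section \<open>Dimension vectors\<close>

context refl_twice
begin

lemma E2_image: "w \<in> verts Q \<Longrightarrow> E2 w ` carrier N = c ` (Ey w ` Y)"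
  unfolding carrier_N image_image by (rule image_cong[OF refl]) (simp add: c_E)

lemma c_bij: "bij_betw c (carrier YM) (carrier N)"
  using inj_c carrier_N by (simp add: bij_betw_def)

text \<open>At a vertex \<open>w\<close> other than \<open>v\<close> the old space is carried over
  in the coordinate \<open>None\<close>. At \<open>v\<close> the new space is ker \<pi>, which
  complements the old one in W.\<close>

lemma kdim_reflection:
  assumes fd: "fdim M"
  shows "fdim N" "w \<in> verts Q \<Longrightarrow> w \<noteq> v \<Longrightarrow> kdim (N.Ev w) = kdim (Ev w)"
    "kdim (Ev v) + kdim (N.Ev v) = (\<Sum>a\<in>set La. kdim (Ev (tt a)))"
proof -
  show "fdim N" by (rule kdim_bij(2)[OF kspace_YM N.kspace_axioms c_lin c_bij fdim_YM[OF fd]])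
  show "kdim (N.Ev w) = kdim (Ev w)" if w: "w \<in> verts Q" "w \<noteq> v"
  proof (rule kdim_bij(1)[OF kspace_sub[OF is_sub_E[OF w(1)]] N.kspace_sub[OF N.is_sub_E[OF w(1)]] _ _
      fdim_Ev[OF w(1) fd]])
    have Y: "pr x (\<lambda>a. \<zero>) \<in> Y" if "x \<in> E w ` carrier M" for x
      using that w v by (auto intro!: Y_nz simp: E_E)
    have im: "Ey w ` Y = (\<lambda>x. pr x (\<lambda>a. \<zero>)) ` (E w ` carrier M)"
    proof
      show "Ey w ` Y \<subseteq> (\<lambda>x. pr x (\<lambda>a. \<zero>)) ` (E w ` carrier M)" using w by (auto simp: Ey_def YD)
      show "(\<lambda>x. pr x (\<lambda>a. \<zero>)) ` (E w ` carrier M) \<subseteq> Ey w ` Y"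
      proof (rule image_subsetI)
        fix x assume x: "x \<in> E w ` carrier M"
        then have "pr x (\<lambda>a. \<zero>) = Ey w (pr x (\<lambda>a. \<zero>))" using w by (auto simp: Ey_def E_E)
        with Y[OF x] show "pr x (\<lambda>a. \<zero>) \<in> Ey w ` Y" by (metis imageI)
      qed
    qed
    let ?g = "\<lambda>x. c (pr x (\<lambda>a. \<zero>))"
    have g: "?g ` (E w ` carrier M) = E2 w ` carrier N"
      unfolding E2_image[OF w(1)] im by (rule image_image[symmetric])
    show "bij_betw ?g (carrier (Ev w)) (carrier (N.Ev w))"
    proof (rule bij_betw_imageI)
      show "inj_on ?g (carrier (Ev w))"
        using Y by (intro inj_onI) (auto simp: c_eq_iff pr_eq_iff)
      show "?g ` carrier (Ev w) = carrier (N.Ev w)" using g by simp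
    qed
    have cl: "x \<oplus> y \<in> E w ` carrier M" "k \<odot> x \<in> E w ` carrier M"
        if "x \<in> E w ` carrier M" "y \<in> E w ` carrier M" for x y k
      using is_sub_E[OF w(1)] that by (auto simp: is_sub_def)
    have "?g (x \<oplus> y) = ?g x \<oplus>\<^bsub>N\<^esub> ?g y" if "x \<in> E w ` carrier M" "y \<in> E w ` carrier M" for x y
      unfolding c_simps(3)[OF Y[OF that(1)] Y[OF that(2)], symmetric]
      by (rule arg_cong[of _ _ c]) (auto simp: fun_eq_iff split: option.splits)
    moreover have "?g (k \<odot> x) = k \<odot>\<^bsub>N\<^esub> ?g x" if "x \<in> E w ` carrier M" for x k
      unfolding c_simps(4)[OF Y[OF that], symmetric]
      by (rule arg_cong[of _ _ c]) (auto simp: fun_eq_iff split: option.splits)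
    ultimately show "klinear (Ev w) (N.Ev w) ?g" using g by (auto simp: klinear_def)
  qed
  have "Ey v ` Y = {y \<in> Y. y None = \<zero>}"
  proof
    show "Ey v ` Y \<subseteq> {y \<in> Y. y None = \<zero>}" using v by (auto simp: Ey_def Y_upd lin_simps)
    show "{y \<in> Y. y None = \<zero>} \<subseteq> Ey v ` Y"
    proof
      fix y assume y: "y \<in> {y \<in> Y. y None = \<zero>}"
      then have "y = Ey v y" by (auto simp: Ey_def)
      with y show "y \<in> Ey v ` Y" by blast
    qed
  qed
  then have im: "c ` {y \<in> Y. y None = \<zero>} = E2 v ` carrier N" using E2_image[OF v] by simp
  have "kdim (N.Ev v) = kdim Yv"
  proof (rule kdim_bij(1)[OF kspace_Yv N.kspace_sub[OF N.is_sub_E[OF v]] _ _ kdim_Yv(1)[OF fd]])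
    show "klinear Yv (N.Ev v) c" using im by (auto simp: klinear_def c_simps)
    show "bij_betw c (carrier Yv) (carrier (N.Ev v))"
      using im inj_on_subset[OF inj_c, of "{y \<in> Y. y None = \<zero>}"] by (simp add: bij_betw_def)
  qed
  then show "kdim (Ev v) + kdim (N.Ev v) = (\<Sum>a\<in>set La. kdim (Ev (tt a)))" using kdim_Yv(2)[OF fd] by simp
qed

end

text \<open>The arrows of the double into \<open>v\<close> are the arrows of \<open>Q\<close> into
  \<open>v\<close> and the reverses of those out of \<open>v\<close>. For a dimension vector
  \<alpha> the left side is dim W, so dim W - \<alpha>_v is the coordinate at \<open>v\<close> of
  the reflected vector.\<close>

lemma (in refl_quiver) sum_La:
  "(\<Sum>a\<in>set La. \<alpha> (tt a)) = 2 * \<alpha> v - sym_form Q \<alpha> (coord_vec v)"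
proof -
  interpret fin_digraph Q by (rule fd)
  have 1: "(\<Sum>u\<in>verts Q. \<alpha> u * coord_vec v u) = \<alpha> v"
    using v by (simp add: coord_vec_def if_distrib sum.delta cong: if_cong)
  have 2: "(\<Sum>a\<in>arcs Q. f a * coord_vec v (g a)) = (\<Sum>a \<in> {a \<in> arcs Q. g a = v}. f a)" for f g
    by (simp add: coord_vec_def sum.inter_filter if_distrib cong: if_cong)
  have "a \<in> set La \<longleftrightarrow> a \<in> Orig ` {a \<in> arcs Q. head Q a = v} \<union> Star ` {a \<in> arcs Q. tail Q a = v}" for a
    unfolding set_La by (cases a) (auto simp: double_def)
  then have "set La = Orig ` {a \<in> arcs Q. head Q a = v} \<union> Star ` {a \<in> arcs Q. tail Q a = v}" by blast
  then have "(\<Sum>a\<in>set La. \<alpha> (tt a)) = (\<Sum>a \<in> Orig ` {a \<in> arcs Q. head Q a = v}. \<alpha> (tt a)) +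
      (\<Sum>a \<in> Star ` {a \<in> arcs Q. tail Q a = v}. \<alpha> (tt a))"
    by (simp only:) (rule sum.union_disjoint, auto)
  also have "\<dots> = (\<Sum>a \<in> arcs Q. \<alpha> (head Q a) * coord_vec v (tail Q a) + \<alpha> (tail Q a) * coord_vec v (head Q a))"
    by (simp add: sum.distrib 2 sum.reindex inj_on_def double_def)
  finally show ?thesis by (simp add: sym_form_def 1)
qed

lemma (in refl_copy) dim_vector_reflection:
  assumes "finite_dimensional Q lt q X"
  shows "finite_dimensional Q lt q' Z"
    "w \<in> verts Q \<Longrightarrow> int (dim_vector Q lt q' Z w) = refl_dim Q v (\<lambda>u. int (dim_vector Q lt q X u)) w"
proof -
  interpret t: refl_twice Q lt q U "mpa_E Q lt q X" "mpa_T Q lt q X" "mpa_G Q lt q X" v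
     ZZ.U "mpa_E Q lt q' Z" "mpa_T Q lt q' Z" "mpa_G Q lt q' Z" c
    by (rule refl_twice_copy)
  have fd: "fdim U" using assms by (simp add: finite_dimensional_def)
  show "finite_dimensional Q lt q' Z" using t.kdim_reflection(1)[OF fd] by (simp add: finite_dimensional_def)
  have dX: "dim_vector Q lt q X u = kdim (rr.Ev u)" for u
    unfolding dim_vector_def vertex_space_def U_simps(1) ..
  have dZ: "dim_vector Q lt q' Z u = kdim (ZZ.rr.Ev u)" for u
    unfolding dim_vector_def vertex_space_def ZZ.U_simps(1) ..
  show "int (dim_vector Q lt q' Z w) = refl_dim Q v (\<lambda>u. int (dim_vector Q lt q X u)) w" if w: "w \<in> verts Q"
  proof (cases "w = v")
    case True
    have "int (kdim (rr.Ev v)) + int (kdim (ZZ.rr.Ev v)) = (\<Sum>a\<in>set La. int (kdim (rr.Ev (tt a))))"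
      using t.kdim_reflection(3)[OF fd] by (simp flip: of_nat_add of_nat_sum)
    then show ?thesis using True sum_La[of "\<lambda>u. int (kdim (rr.Ev u))"]
      by (simp add: refl_dim_def dX dZ coord_vec_def[of v v])
  next
    case False
    then show ?thesis using t.kdim_reflection(2)[OF fd w] by
        (simp add: refl_dim_def dX dZ coord_vec_def[of v w])
  qed
qed

theorem theorem1p7:
  fixes Q :: "('v, 'a) pre_digraph" and lt :: "'a darrow rel" and v :: 'v
  assumes "fin_digraph Q"
    and "strict_linear_order_on (arcs (double Q)) lt"
    and "v \<in> verts Q" and "loopfree_at Q v"
    and "infinite (UNIV :: 'm set)"
  shows "\<exists>F :: ('v \<Rightarrow> 'k::field) \<Rightarrow>
      (('v, 'a, 'k, 'm) mpa_rep, 'm \<Rightarrow> 'm, ('v, 'a, 'k, 'm) mpa_rep, 'm \<Rightarrow> 'm) functor_data.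
    \<forall>q. (\<forall>w \<in> verts Q. q w \<noteq> 0) \<and> q v \<noteq> 1 \<longrightarrow>
      inverse_equivalences
        (module_category (mpa Q lt q)) (module_category (mpa Q lt (refl_weight Q v q)))
        (F q) (F (refl_weight Q v q)) \<and>
      (\<forall>X \<in> Obj (module_category (mpa Q lt q)). finite_dimensional Q lt q X \<longrightarrow>
        finite_dimensional Q lt (refl_weight Q v q) (on_obj (F q) X) \<and>
        (\<forall>w \<in> verts Q.
          int (dim_vector Q lt (refl_weight Q v q) (on_obj (F q) X) w) =
          refl_dim Q v (\<lambda>u. int (dim_vector Q lt q X u)) w))"
proof -
  have oq: "ordered_quiver Q lt" using assms(1,2) by (rule ordered_quiver.intro)
  interpret refl_quiver Q lt v using oq assms(3,4) by (intro refl_quiver.intro refl_quiver_axioms.intro)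
  have ok: "refl_module Q lt p X v" if "\<forall>w \<in> verts Q. p w \<noteq> 0" "p v \<noteq> 1" "left_module (mpa Q lt p) X"
    for p and X :: "('v, 'a, 'k, 'm) mpa_rep"
    by (intro refl_module.intro refl_module_axioms.intro mpa_module.intro oq refl_quiver_axioms that(2,3))
        (use that(1) in blast)
  let ?F = "refl_functor Q lt v ::
    ('v \<Rightarrow> 'k) \<Rightarrow> (('v, 'a, 'k, 'm) mpa_rep, 'm \<Rightarrow> 'm, ('v, 'a, 'k, 'm) mpa_rep, 'm \<Rightarrow> 'm) functor_data"
  have "inverse_equivalences (module_category (mpa Q lt q)) (module_category (mpa Q lt (refl_weight Q v q)))
      (?F q) (?F (refl_weight Q v q))"
    if q: "\<forall>w \<in> verts Q. q w \<noteq> 0" "q v \<noteq> 1" for q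
  proof -
    have q': "\<forall>w \<in> verts Q. refl_weight Q v q w \<noteq> 0" "refl_weight Q v q v \<noteq> 1"
      using refl_weight_ok[of q] q by blast+
    \<comment> \<open>The reflected weight satisfies the same hypotheses and reflects back to
      \<open>q\<close>, so the statements for the inverse functor are those for the functor at the
      reflected weight.\<close>
    have qq: "refl_weight Q v (refl_weight Q v q) = q"
      using q(1) v by (intro refl_weight_refl_weight) blast
    show ?thesis
      unfolding inverse_equivalences_def
      using refl_functor_is_functor[OF assms(5) ok, of q] refl_functor_inverse[OF assms(5) ok q]
        refl_functor_is_functor[OF assms(5) ok, of "refl_weight Q v q"] refl_functor_inverse[OF assms(5) ok q']
        q q' unfolding qq by blast
  qed
  moreover have "finite_dimensional Q lt (refl_weight Q v q) (on_obj (?F q) X)"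
    "w \<in> verts Q \<Longrightarrow> int (dim_vector Q lt (refl_weight Q v q) (on_obj (?F q) X) w) =
      refl_dim Q v (\<lambda>u. int (dim_vector Q lt q X u)) w"
    if q: "\<forall>w \<in> verts Q. q w \<noteq> 0" "q v \<noteq> 1" and X: "X \<in> Obj (module_category (mpa Q lt q))"
      and fd: "finite_dimensional Q lt q X" for q X w
  proof -
    have "refl_module Q lt q X v" using X by (intro ok q) (simp add: module_category_def)
    then interpret refl_copy Q lt q X v "fst (refl_choice Q lt v q X)" "snd (refl_choice Q lt v q X)"
      using assms(5) by (rule refl_copy_choice)
    have o: "on_obj (?F q) X = snd (refl_choice Q lt v q X)" by (simp add: refl_functor_def)
    show "finite_dimensional Q lt (refl_weight Q v q) (on_obj (?F q) X)"
      unfolding o by (rule dim_vector_reflection(1)[OF fd])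
    show "w \<in> verts Q \<Longrightarrow> int (dim_vector Q lt (refl_weight Q v q) (on_obj (?F q) X) w) =
        refl_dim Q v (\<lambda>u. int (dim_vector Q lt q X u)) w"
      unfolding o by (rule dim_vector_reflection(2)[OF fd])
  qed
  ultimately show ?thesis by (intro exI[of _ ?F]) blast
qed

end
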